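(* Let $X$ and $Y$ be scaling elements (each in some $C^*$-algebra). (i) If $X$ is proper, then there exists a $*$-homomorphism $\varphi\colon C^*(X)\to C^*(Y)$ with $\varphi(X)=Y$ if and only if $\mathrm{sp}(|X^*|)\supset\mathrm{sp}(|Y^*|)$. (ii) If $X$ is non-proper, then there exists a $*$-homomorphism $\varphi\colon C^*(X)\to C^*(Y)$ with $\varphi(X)=Y$ if and only if $\mathrm{sp}(|X^*|)\supset\mathrm{sp}(|Y^*|)$ and $Y$ is non-proper.
   Context: An element $X$ of a $C^*$-algebra is a scaling element if $(X^*X)X=X$ and $X^*X\neq XX^*$. $C^*(X)$ denotes the (not necessarily unital) $C^*$-algebra generated by $X$. The symbol $\supset$ allows equality. Here $|X|=(X^*X)^{1/2}$, $|X^*|=(XX^* )^{1/2}$, $\mathrm{sp}$ denotes the spectrum (taken in the unitization if the algebra is non-unital), and $1_C$ is the characteristic function of a set $C$. For every scaling element $X$ one has $0,1\in\mathrm{sp}(|X^*|)\subset[0,\infty)$, and $\mathrm{sp}(|X|)\cup\{0\}=\mathrm{sp}(|X^*|)$. A scaling element $X$ is called non-proper if $\mathrm{sp}(|X^*|)\setminus\{0,1\}$ is compact and $1_{\{1\}}(|X|)=1_{\mathrm{sp}(|X^*|)\setminus\{0\}}(|X^*|)$ (functional calculus; when $\mathrm{sp}(|X^*|)\setminus\{0,1\}$ is compact these functions are continuous on the relevant spectra). Otherwise $X$ is called proper. *)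

theory Defs
  imports "HOL-Analysis.Analysis"
begin

(* A C*-algebra: a complex Banach algebra, not necessarily unital, with a conjugate-linear
   involution satisfying the C*-identity.  The underlying real structure is that of the
   library classes; scaleR_scaleC ties it to the complex one. *)
class cstar_algebra = real_normed_algebra + banach +
  fixes scaleC :: "complex \<Rightarrow> 'a \<Rightarrow> 'a"  (infixr "*\<^sub>C" 75)
    and star :: "'a \<Rightarrow> 'a"
  assumes scaleC_add_right: "c *\<^sub>C (x + y) = c *\<^sub>C x + c *\<^sub>C y"
    and scaleC_add_left: "(c + d) *\<^sub>C x = c *\<^sub>C x + d *\<^sub>C x"
    and scaleC_scaleC: "c *\<^sub>C d *\<^sub>C x = (c * d) *\<^sub>C x"
    and scaleR_scaleC: "r *\<^sub>R x = complex_of_real r *\<^sub>C x"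
    and mult_scaleC_left: "(c *\<^sub>C x) * y = c *\<^sub>C (x * y)"
    and mult_scaleC_right: "x * (c *\<^sub>C y) = c *\<^sub>C (x * y)"
    and norm_scaleC: "norm (c *\<^sub>C x) = cmod c * norm x"
    and star_add: "star (x + y) = star x + star y"
    and star_scaleC: "star (c *\<^sub>C x) = cnj c *\<^sub>C star x"
    and star_mult: "star (x * y) = star y * star x"
    and star_star: "star (star x) = x"
    and cstar_identity: "norm (star x * x) = (norm x)\<^sup>2"

definition is_identity :: "'a::cstar_algebra \<Rightarrow> bool"
  where "is_identity e \<longleftrightarrow> (\<forall>x. e * x = x \<and> x * e = x)"

(* The product of the unitization, where (a, s) stands for a + s1 and (0, 1) is the unit. *)
definition unitization_mult ::
    "'a::cstar_algebra \<times> complex \<Rightarrow> 'a \<times> complex \<Rightarrow> 'a \<times> complex"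
  where "unitization_mult u v =
    (fst u * fst v + snd u *\<^sub>C fst v + snd v *\<^sub>C fst u, snd u * snd v)"

definition spectrum :: "'a::cstar_algebra \<Rightarrow> complex set"
  where "spectrum a =
    (if \<exists>e::'a. is_identity e
     then {c. \<not> (\<exists>e b. is_identity e \<and> (a - c *\<^sub>C e) * b = e \<and> b * (a - c *\<^sub>C e) = e)}
     else {c. \<not> (\<exists>u. unitization_mult (a, - c) u = (0, 1) \<and> unitization_mult u (a, - c) = (0, 1))})"

(* The functions continuous on the spectrum of a which vanish at 0 if 0 is in the spectrum,
   i.e. C_0(sp(a) - {0}); functions agreeing on the spectrum represent the same element. *)
definition cfc_domain :: "'a::cstar_algebra \<Rightarrow> (complex \<Rightarrow> complex) set"
  where "cfc_domain a = {f. continuous_on (spectrum a) f \<and> (0 \<in> spectrum a \<longrightarrow> f 0 = 0)}"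

(* Phi is a *-homomorphism from C_0(sp(a) - {0}) sending the identity function to a. *)
definition is_cfc :: "'a::cstar_algebra \<Rightarrow> ((complex \<Rightarrow> complex) \<Rightarrow> 'a) \<Rightarrow> bool"
  where "is_cfc a \<Phi> \<longleftrightarrow>
    (\<forall>f\<in>cfc_domain a. \<forall>g\<in>cfc_domain a.
       ((\<forall>z\<in>spectrum a. f z = g z) \<longrightarrow> \<Phi> f = \<Phi> g) \<and>
       \<Phi> (\<lambda>z. f z + g z) = \<Phi> f + \<Phi> g \<and>
       \<Phi> (\<lambda>z. f z * g z) = \<Phi> f * \<Phi> g) \<and>
    (\<forall>f\<in>cfc_domain a. \<forall>c. \<Phi> (\<lambda>z. c * f z) = c *\<^sub>C \<Phi> f) \<and>
    (\<forall>f\<in>cfc_domain a. \<Phi> (\<lambda>z. cnj (f z)) = star (\<Phi> f)) \<and>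
    \<Phi> (\<lambda>z. z) = a"

(* Continuous functional calculus f(a), for normal a and f in cfc_domain a; such an f gives
   an element of the algebra itself even if there is no unit.  Outside these conditions the
   value carries no meaning. *)
definition cfc :: "(complex \<Rightarrow> complex) \<Rightarrow> 'a::cstar_algebra \<Rightarrow> 'a"
  where "cfc f a = (THE b. \<exists>\<Phi>. is_cfc a \<Phi> \<and> b = \<Phi> f)"

definition cstar_abs :: "'a::cstar_algebra \<Rightarrow> 'a"
  where "cstar_abs x = cfc (\<lambda>z. complex_of_real (sqrt (Re z))) (star x * x)"

definition closed_star_subalgebra :: "'a::cstar_algebra set \<Rightarrow> bool"
  where "closed_star_subalgebra B \<longleftrightarrow>
    closed B \<and> 0 \<in> B \<and>
    (\<forall>x\<in>B. \<forall>y\<in>B. x + y \<in> B \<and> x * y \<in> B) \<and>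
    (\<forall>x\<in>B. star x \<in> B \<and> (\<forall>c. c *\<^sub>C x \<in> B))"

definition cstar_generated :: "'a::cstar_algebra \<Rightarrow> 'a set"
  where "cstar_generated x = \<Inter> {B. closed_star_subalgebra B \<and> x \<in> B}"

definition star_homomorphism_on ::
    "'a::cstar_algebra set \<Rightarrow> 'b::cstar_algebra set \<Rightarrow> ('a \<Rightarrow> 'b) \<Rightarrow> bool"
  where "star_homomorphism_on B C \<phi> \<longleftrightarrow>
    \<phi> ` B \<subseteq> C \<and>
    (\<forall>x\<in>B. \<forall>y\<in>B. \<phi> (x + y) = \<phi> x + \<phi> y \<and> \<phi> (x * y) = \<phi> x * \<phi> y) \<and>
    (\<forall>x\<in>B. \<phi> (star x) = star (\<phi> x) \<and> (\<forall>c. \<phi> (c *\<^sub>C x) = c *\<^sub>C \<phi> x))"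

definition scaling_element :: "'a::cstar_algebra \<Rightarrow> bool"
  where "scaling_element x \<longleftrightarrow> (star x * x) * x = x \<and> star x * x \<noteq> x * star x"

(* cstar_abs (star x) is the square root of x * star x, as star (star x) = x.  Both indicator
   functions vanish at 0, and the compactness condition makes them continuous on the spectra
   they are applied to. *)
definition non_proper :: "'a::cstar_algebra \<Rightarrow> bool"
  where "non_proper x \<longleftrightarrow>
    scaling_element x \<and>
    compact (spectrum (cstar_abs (star x)) - {0, 1}) \<and>
    cfc (indicator {1}) (cstar_abs x) =
      cfc (indicator (spectrum (cstar_abs (star x)) - {0})) (cstar_abs (star x))"

definition proper :: "'a::cstar_algebra \<Rightarrow> bool"
  where "proper x \<longleftrightarrow> scaling_element x \<and> \<not> non_proper x"

end

theory Submission
  imports Defs "HOL-Computational_Algebra.Fundamental_Theorem_Algebra"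
begin

text \<open>Write \<open>h = X\<^sup>* X\<close>, \<open>b = X X\<^sup>*\<close> and \<open>S = sp(h) = sp(b)\<close>. Since \<open>h X = X\<close>, the
  element \<open>X\<close> behaves like a field of weighted shifts \<open>e\<^sub>0 \<rightarrow> e\<^sub>1 \<rightarrow> e\<^sub>2 \<rightarrow> \<dots>\<close> over \<open>s \<in> S\<close> in which only the first
  weight, the square root of \<open>s\<close>, differs from 1; the values \<open>s = 0, 1\<close> stand for the unilateral
  shift, and this shift is missing precisely if \<open>X\<close> is non-proper. It suffices to show
  \<open>\<parallel>P(Y)\<parallel> \<le> \<parallel>P(X)\<parallel>\<close> for every *-polynomial \<open>P\<close>. The homogeneous components \<open>P\<^sub>k\<close> are treated separately:
  the elements of degree zero are diagonal, and \<open>\<parallel>P\<^sub>k(Y)\<parallel>\<^sup>2 = \<parallel>(P\<^sub>k\<^sup>* P\<^sub>k)(Y)\<parallel>\<close> is a spectral radius, bounded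
  by the diagonal entries of the model over \<open>sp(Y Y\<^sup>*)\<close>. Conversely approximate eigenvectors of \<open>b\<close>
  generate asymptotic copies of the model inside the algebra of \<open>X\<close>, so the matrix entries of \<open>P\<close> over
  \<open>S\<close> are bounded by \<open>\<parallel>P(X)\<parallel>\<close>. This gives \<open>\<parallel>P(Y)\<parallel> \<le> (2 L + 1) \<parallel>P(X)\<parallel>\<close> with \<open>L\<close> the maximal length of
  a word, and the factor disappears on taking powers of \<open>P\<^sup>* P\<close>.\<close>

section \<open>Elementary consequences of the axioms\<close>

text \<open>The estimate cannot use the projections onto homogeneous components that a gauge action
  would give: the automorphisms sending X to zX, |z| = 1, are themselves instances of the theorem.
  Matrix entries replace them, since the entry between e_m and e_n sees only words of degree m - n.
  Vectors are elements of the algebra, with \<open>star x * y\<close> as inner product. The upper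
  estimate for Y is available in degree zero, where h X = X nests the summands so that the spectrum
  can be peeled off level by level; 2 L + 1 counts the degrees from -L to L.

  The values 0 and 1 are delicate. At s = 0 the model is a zero vector next to the shift, so both
  values carry the same information. The vector e_0 of the shift is fixed by h and killed by b; if
  \<open>S - {0, 1}\<close> is compact, the difference of the projections 1_{1}(h) and 1_{S -
  {0}}(b) is the trace of this vector in the algebra, and its vanishing is non-properness. If
  \<open>S - {0, 1}\<close> is not compact, it accumulates at 0 or 1, and the shift is controlled by
  a limit of models.\<close>

lemma scaleC_one [simp]: "(1::complex) *\<^sub>C x = x" for x :: "'a::cstar_algebra"
  using scaleR_scaleC[of 1 x] by simp

lemma scaleC_zero_left [simp]: "(0::complex) *\<^sub>C x = 0" for x :: "'a::cstar_algebra"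
  using scaleR_scaleC[of 0 x] by simp

lemma scaleC_zero_right [simp]: "c *\<^sub>C (0::'a::cstar_algebra) = 0"
  using scaleC_add_right[of c 0 "0::'a"] by simp

lemma scaleC_minus_right: "c *\<^sub>C (- x) = - (c *\<^sub>C x)" for x :: "'a::cstar_algebra"
  using scaleC_add_right[of c x "- x"] by (simp add: eq_neg_iff_add_eq_0 add.commute)

lemma scaleC_minus_left: "(- c) *\<^sub>C x = - (c *\<^sub>C x)" for x :: "'a::cstar_algebra"
  using scaleC_add_left[of c "- c" x] by (simp add: eq_neg_iff_add_eq_0 add.commute)

lemma scaleC_diff_right: "c *\<^sub>C (x - y) = c *\<^sub>C x - c *\<^sub>C y" for x :: "'a::cstar_algebra"
  using scaleC_add_right[of c x "- y"] by (simp add: scaleC_minus_right)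

lemma scaleC_diff_left: "(c - d) *\<^sub>C x = c *\<^sub>C x - d *\<^sub>C x" for x :: "'a::cstar_algebra"
  using scaleC_add_left[of c "- d" x] by (simp add: scaleC_minus_left)

lemma star_zero [simp]: "star (0::'a::cstar_algebra) = 0"
  using star_add[of 0 "0::'a"] by simp

lemma star_minus: "star (- x) = - star x" for x :: "'a::cstar_algebra"
  using star_add[of x "- x"] by (simp add: eq_neg_iff_add_eq_0 add.commute)

lemma star_diff: "star (x - y) = star x - star y" for x :: "'a::cstar_algebra"
  using star_add[of x "- y"] by (simp add: star_minus)

lemmas star_simps = star_add star_diff star_minus star_scaleC star_mult star_star

lemma norm_star [simp]: "norm (star x) = norm x" for x :: "'a::cstar_algebra"
proof -
  have le: "norm y \<le> norm (star y)" for y :: 'a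
  proof (cases "y = 0")
    case False
    have "norm y * norm y \<le> norm (star y) * norm y"
      using cstar_identity[of y] norm_mult_ineq[of "star y" y] by (simp add: power2_eq_square)
    then show ?thesis using False by simp
  qed auto
  show ?thesis using le[of x] le[of "star x"] by (simp add: star_star)
qed

lemma bounded_linear_star: "bounded_linear (star :: 'a::cstar_algebra \<Rightarrow> 'a)"
  by (rule bounded_linear_intro[where K = 1])
    (simp_all add: star_add star_scaleC scaleR_scaleC)

lemma bounded_linear_scaleC: "bounded_linear (\<lambda>x::'a::cstar_algebra. c *\<^sub>C x)"
  by (rule bounded_linear_intro[where K = "cmod c"])
    (simp_all add: scaleC_add_right scaleR_scaleC scaleC_scaleC norm_scaleC mult.commute)

lemmas tendsto_star [tendsto_intros] = bounded_linear.tendsto[OF bounded_linear_star]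

lemma tendsto_scaleC [tendsto_intros]:
  fixes f :: "'b \<Rightarrow> 'a::cstar_algebra"
  assumes "(c \<longlongrightarrow> k) F" and "(f \<longlongrightarrow> l) F"
  shows "((\<lambda>x. c x *\<^sub>C f x) \<longlongrightarrow> k *\<^sub>C l) F"
proof -
  have "((\<lambda>x. (c x - k) *\<^sub>C f x) \<longlongrightarrow> 0) F"
  proof -
    have "((\<lambda>x. cmod (c x - k) * norm (f x)) \<longlongrightarrow> 0 * norm l) F"
      by (intro tendsto_intros assms tendsto_norm_zero) (use assms(1) in \<open>simp add: LIM_zero\<close>)
    then show ?thesis
      by (subst tendsto_norm_zero_iff[symmetric]) (simp add: norm_scaleC)
  qed
  moreover have "((\<lambda>x. k *\<^sub>C f x) \<longlongrightarrow> k *\<^sub>C l) F"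
    by (rule bounded_linear.tendsto[OF bounded_linear_scaleC assms(2)])
  ultimately have "((\<lambda>x. (c x - k) *\<^sub>C f x + k *\<^sub>C f x) \<longlongrightarrow> 0 + k *\<^sub>C l) F"
    by (rule tendsto_add)
  then show ?thesis by (simp add: scaleC_diff_left)
qed

section \<open>The unitization as a Banach algebra\<close>

text \<open>The norm below is not the C*-norm; it is only used to have a Banach algebra with
  unit in which the spectrum makes sense.\<close>

datatype 'a unitization = Unitz (upart: 'a) (uscal: complex)

instantiation unitization :: (cstar_algebra) real_normed_algebra_1
begin

definition "(0 :: 'a unitization) = Unitz 0 0"
definition "(1 :: 'a unitization) = Unitz 0 1"
definition "(u :: 'a unitization) + v = Unitz (upart u + upart v) (uscal u + uscal v)"
definition "(u :: 'a unitization) - v = Unitz (upart u - upart v) (uscal u - uscal v)"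
definition "- (u :: 'a unitization) = Unitz (- upart u) (- uscal u)"
definition "(u :: 'a unitization) * v = Unitz (upart u * upart v + uscal u *\<^sub>C upart v + uscal v *\<^sub>C upart u)
  (uscal u * uscal v)"
definition "r *\<^sub>R (u :: 'a unitization) = Unitz (r *\<^sub>R upart u) (r *\<^sub>R uscal u)"
definition "norm (u :: 'a unitization) = norm (upart u) + cmod (uscal u)"
definition "dist (u :: 'a unitization) v = norm (u - v)"
definition "sgn (u :: 'a unitization) = scaleR (inverse (norm u)) u"
definition uniformity_unitization_def [code del]:
  "(uniformity :: ('a unitization \<times> 'a unitization) filter) =
    (INF e\<in>{0 <..}. principal {(x, y). dist x y < e})"
definition open_unitization_def [code del]:
  "open (A :: 'a unitization set) = (\<forall>x\<in>A. \<forall>\<^sub>F (x', y) in uniformity. x' = x \<longrightarrow> y \<in> A)"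

lemmas unitization_defs = zero_unitization_def one_unitization_def plus_unitization_def
  minus_unitization_def uminus_unitization_def times_unitization_def scaleR_unitization_def
  norm_unitization_def

instance
proof
  fix u v w :: "'a unitization" and r s :: real
  show "u + v + w = u + (v + w)" "u + v = v + u" "0 + u = u" "- u + u = 0" "u - v = u + - v"
    by (simp_all add: unitization_defs add_ac)
  show "r *\<^sub>R (u + v) = r *\<^sub>R u + r *\<^sub>R v" "(r + s) *\<^sub>R u = r *\<^sub>R u + s *\<^sub>R u"
    "r *\<^sub>R s *\<^sub>R u = (r * s) *\<^sub>R u" "1 *\<^sub>R u = u"
    by (simp_all add: unitization_defs scaleR_add_right scaleR_add_left)
  show "(u + v) * w = u * w + v * w" "u * (v + w) = u * v + u * w"
    by (simp_all add: unitization_defs algebra_simps scaleC_add_right scaleC_add_left)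
  show "u * v * w = u * (v * w)"
    by (simp add: unitization_defs algebra_simps scaleC_add_right scaleC_add_left
        scaleC_scaleC mult_scaleC_left mult_scaleC_right)
  show "1 * u = u" "u * 1 = u" "(0 :: 'a unitization) \<noteq> 1"
    by (simp_all add: unitization_defs)
  show "r *\<^sub>R u * v = r *\<^sub>R (u * v)" "u * r *\<^sub>R v = r *\<^sub>R (u * v)"
    by (simp_all add: unitization_defs algebra_simps scaleR_scaleC scaleC_add_right
        scaleC_scaleC mult_scaleC_left mult_scaleC_right scaleR_conv_of_real)
  show "dist u v = norm (u - v)" by (rule dist_unitization_def)
  show "sgn u = scaleR (inverse (norm u)) u" by (rule sgn_unitization_def)
  show "(uniformity :: ('a unitization \<times> 'a unitization) filter) =
    (INF e\<in>{0 <..}. principal {(x, y). dist x y < e})" by (rule uniformity_unitization_def)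
  show "open A = (\<forall>x\<in>A. \<forall>\<^sub>F (x', y) in uniformity. x' = x \<longrightarrow> y \<in> A)"
    for A :: "'a unitization set" by (rule open_unitization_def)
  show "(norm u = 0) = (u = 0)"
    by (cases u) (simp add: unitization_defs add_nonneg_eq_0_iff)
  show "norm (u + v) \<le> norm u + norm v"
    using norm_triangle_ineq[of "upart u" "upart v"] norm_triangle_ineq[of "uscal u" "uscal v"]
    by (simp add: unitization_defs)
  show "norm (r *\<^sub>R u) = \<bar>r\<bar> * norm u" by (simp add: unitization_defs distrib_left)
  show "norm (u * v) \<le> norm u * norm v"
  proof -
    have "norm (upart u * upart v + uscal u *\<^sub>C upart v + uscal v *\<^sub>C upart u)
        \<le> norm (upart u) * norm (upart v) + cmod (uscal u) * norm (upart v)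
          + cmod (uscal v) * norm (upart u)"
      by (intro norm_triangle_mono norm_mult_ineq) (simp_all add: norm_scaleC)
    then show ?thesis by (simp add: unitization_defs norm_mult algebra_simps)
  qed
  show "norm (1 :: 'a unitization) = 1" by (simp add: unitization_defs)
qed

end

lemma upart_simps [simp]:
  "upart (u + v) = upart u + upart v" "upart (u - v) = upart u - upart v"
  "upart 0 = (0 :: 'a)" "upart 1 = (0 :: 'a)" "upart (r *\<^sub>R u) = r *\<^sub>R upart u"
  "uscal (u + v) = uscal u + uscal v" "uscal (u - v) = uscal u - uscal v"
  "uscal (u * v) = uscal u * uscal v" "uscal (0 :: 'a unitization) = 0"
  "uscal (1 :: 'a unitization) = 1" "uscal (r *\<^sub>R u) = r *\<^sub>R uscal u"
  for u v :: "'a::cstar_algebra unitization"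
  by (simp_all add: unitization_defs)

lemma bounded_linear_upart: "bounded_linear (upart :: 'a::cstar_algebra unitization \<Rightarrow> 'a)"
  by (rule bounded_linear_intro[where K = 1]) (simp_all add: norm_unitization_def)

lemma bounded_linear_uscal: "bounded_linear (uscal :: 'a::cstar_algebra unitization \<Rightarrow> complex)"
  by (rule bounded_linear_intro[where K = 1]) (simp_all add: norm_unitization_def)

definition emb :: "'a::cstar_algebra \<Rightarrow> 'a unitization"
  where "emb a = Unitz a 0"

definition usc :: "complex \<Rightarrow> 'a::cstar_algebra unitization"
  where "usc c = Unitz 0 c"

lemma emb_simps:
  "emb (a + b) = emb a + emb b" "emb (a - b) = emb a - emb b" "emb (a * b) = emb a * emb b"
  "emb (c *\<^sub>C a) = usc c * emb a" "emb 0 = 0" "emb (- a) = - emb a"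
  by (simp_all add: emb_def usc_def unitization_defs)

lemma emb_parts [simp]: "upart (emb a) = a" "uscal (emb a) = 0" "norm (emb a) = norm a"
  by (simp_all add: emb_def norm_unitization_def)

lemma emb_inject [simp]: "emb a = emb b \<longleftrightarrow> a = b"
  by (simp add: emb_def)

lemma usc_parts [simp]: "upart (usc c) = 0" "uscal (usc c) = c" "norm (usc c) = cmod c"
  by (simp_all add: usc_def norm_unitization_def)

lemma usc_simps [simp]: "usc 0 = 0" "usc 1 = 1"
  by (simp_all add: usc_def unitization_defs)

lemma usc_hom:
  "usc (c + d) = usc c + usc d" "usc (c - d) = usc c - usc d" "usc (c * d) = usc c * usc d"
  "usc (- c) = - usc c"
  by (simp_all add: usc_def unitization_defs)

lemma usc_commute: "usc c * u = u * usc c" for u :: "'a::cstar_algebra unitization"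
  by (simp add: usc_def unitization_defs mult.commute)

lemma scaleR_usc: "r *\<^sub>R u = usc (of_real r) * u" for u :: "'a::cstar_algebra unitization"
  by (simp add: usc_def unitization_defs scaleR_scaleC scaleR_conv_of_real)

lemma bounded_linear_emb: "bounded_linear (emb :: 'a::cstar_algebra \<Rightarrow> 'a unitization)"
  by (rule bounded_linear_intro[where K = 1])
    (simp_all add: emb_simps, simp add: emb_def unitization_defs)

lemma bounded_linear_usc: "bounded_linear (usc :: complex \<Rightarrow> 'a::cstar_algebra unitization)"
  by (rule bounded_linear_intro[where K = 1])
    (simp_all add: usc_hom, simp add: usc_def unitization_defs)

lemmas tendsto_upart [tendsto_intros] = bounded_linear.tendsto[OF bounded_linear_upart]
lemmas tendsto_emb [tendsto_intros] = bounded_linear.tendsto[OF bounded_linear_emb]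
lemmas tendsto_usc [tendsto_intros] = bounded_linear.tendsto[OF bounded_linear_usc]

lemma unitization_decomp: "u = emb (upart u) + usc (uscal u)"
  by (cases u) (simp add: emb_def usc_def unitization_defs)

lemma uscal_zero_emb: "uscal u = 0 \<Longrightarrow> u = emb (upart u)"
  using unitization_decomp[of u] by simp

instance unitization :: (cstar_algebra) banach
proof
  fix U :: "nat \<Rightarrow> 'a unitization" assume C: "Cauchy U"
  have "Cauchy (\<lambda>n. upart (U n))" "Cauchy (\<lambda>n. uscal (U n))"
    by (rule bounded_linear.Cauchy[OF bounded_linear_upart C]
        bounded_linear.Cauchy[OF bounded_linear_uscal C])+
  then obtain a c where "(\<lambda>n. upart (U n)) \<longlonglongrightarrow> a" "(\<lambda>n. uscal (U n)) \<longlonglongrightarrow> c"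
    by (meson Cauchy_convergent convergent_def)
  then have "(\<lambda>n. emb (upart (U n)) + usc (uscal (U n))) \<longlonglongrightarrow> emb a + usc c"
    by (intro tendsto_intros)
  then show "convergent U"
    unfolding unitization_decomp[symmetric] convergent_def by blast
qed

section \<open>Invertibility and the spectrum in the unitization\<close>

definition invertible_el :: "'a::ring_1 \<Rightarrow> bool"
  where "invertible_el u \<longleftrightarrow> (\<exists>v. u * v = 1 \<and> v * u = 1)"

definition inv_el :: "'a::ring_1 \<Rightarrow> 'a"
  where "inv_el u = (THE v. u * v = 1 \<and> v * u = 1)"

lemma inv_el_unique: "u * v = 1 \<Longrightarrow> v * u = 1 \<Longrightarrow> inv_el u = v"
  unfolding inv_el_def by (rule the_equality) (auto, metis mult.assoc mult_1 mult_1_right)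

lemma invertible_elI: "u * v = 1 \<Longrightarrow> v * u = 1 \<Longrightarrow> invertible_el u"
  unfolding invertible_el_def by blast

lemma inv_el: "invertible_el u \<Longrightarrow> u * inv_el u = 1" "invertible_el u \<Longrightarrow> inv_el u * u = 1"
  unfolding invertible_el_def using inv_el_unique by metis+

lemma inv_el_cancel:
  assumes "invertible_el u"
  shows "u * (inv_el u * x) = x" and "inv_el u * (u * x) = x"
  using inv_el[OF assms] by (simp_all add: mult.assoc[symmetric])

lemma invertible_el_mult:
  assumes "invertible_el u" "invertible_el v"
  shows "invertible_el (u * v)" and "inv_el (u * v) = inv_el v * inv_el u"
proof -
  have "(u * v) * (inv_el v * inv_el u) = 1" "(inv_el v * inv_el u) * (u * v) = 1"
    by (simp_all add: mult.assoc inv_el_cancel inv_el assms)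
  then show "invertible_el (u * v)" "inv_el (u * v) = inv_el v * inv_el u"
    by (blast intro: invertible_elI inv_el_unique)+
qed

lemma invertible_el_commute_factor:
  assumes "invertible_el (u * v)" and "u * v = v * u"
  shows "invertible_el u"
proof -
  obtain w where w: "u * v * w = 1" "w * (u * v) = 1"
    using assms(1) unfolding invertible_el_def by blast
  have "w * v * u = 1" using w assms(2) by (simp add: mult.assoc)
  moreover have "u * (v * w) = 1" using w by (simp add: mult.assoc)
  ultimately have "w * v = v * w" by (metis mult.assoc mult_1 mult_1_right)
  then show ?thesis
    using \<open>w * v * u = 1\<close> \<open>u * (v * w) = 1\<close> by (intro invertible_elI[of _ "v * w"]) auto
qed

lemma neumann_sums:
  fixes x :: "'a::{real_normed_algebra_1,banach}"
  assumes "norm x < 1"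
  shows "summable (\<lambda>n. x ^ n)" and "(1 - x) * (\<Sum>n. x ^ n) = 1" and "(\<Sum>n. x ^ n) * (1 - x) = 1"
    and "norm (\<Sum>n. x ^ n) \<le> 1 / (1 - norm x)"
proof -
  have ns: "summable (\<lambda>n. norm (x ^ n))"
    by (rule summable_comparison_test'[where g = "\<lambda>n. norm x ^ n"])
      (use assms in \<open>auto simp: norm_power_ineq summable_geometric\<close>)
  then show s: "summable (\<lambda>n. x ^ n)" by (rule summable_norm_cancel)
  let ?S = "\<Sum>n. x ^ n"
  have "?S = 1 + (\<Sum>n. x ^ Suc n)" using suminf_split_head[OF s] by simp
  moreover have "(\<Sum>n. x ^ Suc n) = x * ?S" by (simp add: suminf_mult[OF s])
  moreover have "(\<Sum>n. x ^ Suc n) = ?S * x"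
    unfolding power_Suc2 by (rule suminf_mult2[OF s, symmetric])
  ultimately show "(1 - x) * ?S = 1" "?S * (1 - x) = 1" by (simp_all add: algebra_simps)
  have "norm ?S \<le> (\<Sum>n. norm (x ^ n))" by (rule summable_norm[OF ns])
  also have "\<dots> \<le> (\<Sum>n. norm x ^ n)"
    by (rule suminf_le) (use ns assms in \<open>auto simp: norm_power_ineq summable_geometric\<close>)
  also have "\<dots> = 1 / (1 - norm x)" using assms by (simp add: suminf_geometric)
  finally show "norm ?S \<le> 1 / (1 - norm x)" .
qed

lemma invertible_one_minus:
  "norm (x :: 'a::{real_normed_algebra_1,banach}) < 1 \<Longrightarrow> invertible_el (1 - x)"
  using neumann_sums invertible_elI by metis

text \<open>Neumann series for \<open>w = (1 - x) * u\<close>. The explicit bound on the inverse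
  yields continuity of inversion; read contrapositively, the lemma makes the resolvent blow up at a
  spectral point, which is the source of the approximate eigenvectors.\<close>

lemma invertible_perturb:
  fixes u w :: "'a::{real_normed_algebra_1,banach}"
  assumes "invertible_el u" and "norm (w - u) * norm (inv_el u) \<le> 1 / 2"
  shows "invertible_el w" and "norm (inv_el w) \<le> 2 * norm (inv_el u)"
proof -
  define x where "x = (u - w) * inv_el u"
  have nx: "norm x \<le> 1 / 2"
    using norm_mult_ineq[of "u - w" "inv_el u"] assms(2)
    by (simp add: x_def norm_minus_commute)
  have w: "w = (1 - x) * u" using inv_el[OF assms(1)] by (simp add: x_def algebra_simps)
  have inv: "invertible_el (1 - x)" using nx by (intro invertible_one_minus) simp
  show "invertible_el w" unfolding w by (rule invertible_el_mult(1)[OF inv assms(1)])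
  have e: "inv_el (1 - x) = (\<Sum>n. x ^ n)"
    using neumann_sums[of x] nx by (intro inv_el_unique) auto
  have "inv_el w = inv_el u * inv_el (1 - x)"
    unfolding w by (rule invertible_el_mult(2)[OF inv assms(1)])
  then have "norm (inv_el w) \<le> norm (inv_el u) * norm (\<Sum>n. x ^ n)"
    by (simp add: e norm_mult_ineq)
  also have "\<dots> \<le> norm (inv_el u) * 2"
  proof (rule mult_left_mono)
    have "norm (\<Sum>n. x ^ n) \<le> 1 / (1 - norm x)" using neumann_sums[of x] nx by simp
    also have "\<dots> \<le> 2" using nx by (simp add: field_simps)
    finally show "norm (\<Sum>n. x ^ n) \<le> 2" .
  qed simp
  finally show "norm (inv_el w) \<le> 2 * norm (inv_el u)" by simp
qed

lemma inv_el_diff: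
  assumes "invertible_el u" "invertible_el w"
  shows "inv_el w - inv_el u = inv_el w * (u - w) * inv_el u"
  using inv_el[OF assms(1)] inv_el[OF assms(2)] by (simp add: algebra_simps mult.assoc)

lemma continuous_on_inv_el:
  fixes f :: "'b::metric_space \<Rightarrow> 'a::{real_normed_algebra_1,banach}"
  assumes "continuous_on S f" and "\<And>x. x \<in> S \<Longrightarrow> invertible_el (f x)"
  shows "continuous_on S (\<lambda>x. inv_el (f x))"
  unfolding continuous_on_def
proof
  fix x assume x: "x \<in> S"
  let ?F = "at x within S"
  have lim: "(f \<longlongrightarrow> f x) ?F" using assms(1) x by (simp add: continuous_on_def)
  have "((\<lambda>y. norm (f y - f x) * norm (inv_el (f x))) \<longlongrightarrow> 0 * norm (inv_el (f x))) ?F"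
    by (intro tendsto_intros tendsto_norm_zero) (use lim in \<open>simp add: LIM_zero\<close>)
  then have "eventually (\<lambda>y. norm (f y - f x) * norm (inv_el (f x)) < 1 / 2) ?F"
    by (rule order_tendstoD) simp
  then have ev: "eventually (\<lambda>y. norm (inv_el (f y) - inv_el (f x))
      \<le> (2 * norm (inv_el (f x))) * norm (f y - f x) * norm (inv_el (f x))) ?F"
  proof (rule eventually_mono)
    fix y assume y: "norm (f y - f x) * norm (inv_el (f x)) < 1 / 2"
    note p = invertible_perturb[OF assms(2)[OF x] less_imp_le[OF y]]
    have "norm (inv_el (f y) - inv_el (f x))
        \<le> norm (inv_el (f y)) * norm (f x - f y) * norm (inv_el (f x))"
      unfolding inv_el_diff[OF assms(2)[OF x] p(1)]
      by (meson norm_ge_zero mult_right_mono norm_mult_ineq order_trans)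
    also have "\<dots> \<le> (2 * norm (inv_el (f x))) * norm (f x - f y) * norm (inv_el (f x))"
      by (intro mult_right_mono p) auto
    finally show "norm (inv_el (f y) - inv_el (f x))
      \<le> (2 * norm (inv_el (f x))) * norm (f y - f x) * norm (inv_el (f x))"
      by (simp add: norm_minus_commute)
  qed
  have "((\<lambda>y. (2 * norm (inv_el (f x))) * norm (f y - f x) * norm (inv_el (f x)))
      \<longlongrightarrow> (2 * norm (inv_el (f x))) * 0 * norm (inv_el (f x))) ?F"
    by (intro tendsto_intros tendsto_norm_zero) (use lim in \<open>simp add: LIM_zero\<close>)
  then have "((\<lambda>y. inv_el (f y) - inv_el (f x)) \<longlongrightarrow> 0) ?F"
    by (intro Lim_null_comparison[OF ev]) simp
  then show "((\<lambda>y. inv_el (f y)) \<longlongrightarrow> inv_el (f x)) ?F" by (simp add: LIM_zero_iff)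
qed

lemma open_invertible_el: "open {u :: 'a::{real_normed_algebra_1,banach}. invertible_el u}"
proof (rule openI)
  fix u :: 'a assume "u \<in> {u. invertible_el u}"
  then have u: "invertible_el u" by simp
  define e where "e = 1 / (2 * (norm (inv_el u) + 1))"
  have e: "e > 0" by (simp add: e_def add_nonneg_pos)
  have "w \<in> {u. invertible_el u}" if "w \<in> ball u e" for w
  proof -
    have "norm (w - u) * norm (inv_el u) \<le> e * (norm (inv_el u) + 1)"
      by (intro mult_mono) (use that e in \<open>auto simp: dist_norm norm_minus_commute\<close>)
    also have "\<dots> = 1 / 2" 
      using add_nonneg_pos[OF norm_ge_zero[of "inv_el u"] zero_less_one]
      unfolding e_def by (simp add: divide_simps)
    finally show ?thesis using invertible_perturb(1)[OF u] by simp
  qed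
  then show "\<exists>e>0. ball u e \<subseteq> {u. invertible_el u}" using e by blast
qed

text \<open>The unitization is used even if \<open>'a\<close> has a unit. The set then always
  contains 0, which suits a calculus with functions vanishing at 0, and it differs from
  \<open>spectrum\<close> at most by this point, see \<open>Sp_eq\<close>.\<close>

definition Sp :: "'a::cstar_algebra \<Rightarrow> complex set"
  where "Sp a = {c. \<not> invertible_el (emb a - usc c)}"

lemma zero_in_Sp [simp]: "0 \<in> Sp (a :: 'a::cstar_algebra)"
proof -
  have "emb a * v \<noteq> 1" for v
  proof
    assume "emb a * v = 1"
    then have "uscal (emb a * v) = uscal (1 :: 'a unitization)" by (rule arg_cong)
    then show False by simp
  qed
  then show ?thesis by (auto simp: Sp_def invertible_el_def)
qed

lemma closed_Sp: "closed (Sp a)"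
proof -
  have "continuous_on UNIV (\<lambda>c. emb a - usc c)"
    by (intro continuous_on_diff continuous_on_const linear_continuous_on bounded_linear_usc)
  then have "open ((\<lambda>c. emb a - usc c) -` {u. invertible_el u})"
    by (rule open_vimage[OF open_invertible_el])
  then show ?thesis by (simp add: closed_def Sp_def Compl_eq vimage_def)
qed

lemma invertible_usc: "c \<noteq> 0 \<Longrightarrow> invertible_el (usc c)"
  by (rule invertible_elI[of _ "usc (inverse c)"]) (simp_all add: usc_hom[symmetric])

lemma invertible_usc_mult_iff:
  assumes "c \<noteq> 0" shows "invertible_el (usc c * u) \<longleftrightarrow> invertible_el u"
proof
  assume "invertible_el (usc c * u)"
  then have "invertible_el (usc (inverse c) * (usc c * u))"
    using assms by (simp add: invertible_el_mult(1) invertible_usc)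
  then show "invertible_el u" using assms by (simp add: mult.assoc[symmetric] usc_hom[symmetric])
qed (use assms invertible_usc invertible_el_mult(1) in blast)

lemma Sp_norm_le:
  assumes "c \<in> Sp a" shows "cmod c \<le> norm a"
proof (rule ccontr)
  assume "\<not> cmod c \<le> norm a"
  then have c: "norm a < cmod c" "c \<noteq> 0" using norm_ge_zero[of a] by auto
  have "norm (usc (1 / c) * emb a) \<le> norm a / cmod c"
    using norm_mult_ineq[of "usc (1 / c)" "emb a"] by (simp add: norm_divide)
  also have "\<dots> < 1" using c by simp
  finally have "norm (usc (1 / c) * emb a) < 1" .
  then have "invertible_el (usc (- c) * (1 - usc (1 / c) * emb a))"
    using c by (simp add: invertible_usc_mult_iff invertible_one_minus)
  also have "usc (- c) * (1 - usc (1 / c) * emb a) = emb a - usc c"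
    using c by (simp add: right_diff_distrib mult.assoc[symmetric] usc_hom[symmetric])
      (simp add: usc_hom)
  finally show False using assms by (simp add: Sp_def)
qed

lemma compact_Sp: "compact (Sp a)"
  using closed_Sp Sp_norm_le by (auto simp: compact_eq_bounded_closed bounded_iff)

lemma Sp_commute: "Sp (x * y) = Sp (y * x)" for x :: "'a::cstar_algebra"
proof -
  have "c \<in> Sp (x * y)" if c: "c \<in> Sp (y * x)" for c and x y :: 'a
  proof (cases "c = 0")
    case False
    show ?thesis
    proof (rule ccontr)
      assume "c \<notin> Sp (x * y)"
      then obtain v where v: "(emb x * emb y - usc c) * v = 1" "v * (emb x * emb y - usc c) = 1"
        by (auto simp: Sp_def invertible_el_def emb_simps)
      \<comment> \<open>Jacobson's formula: if \<open>v\<close> inverts \<open>x * y - c\<close>,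
        then \<open>(y * v * x - 1) / c\<close> inverts \<open>y * x - c\<close>.\<close>
      define w where "w = usc (1 / c) * (emb y * v * emb x - 1)"
      have cc: "usc c * usc (1 / c) = 1" "usc (1 / c) * usc c = 1"
        using False by (simp_all add: usc_hom[symmetric])
      have 0: "emb x * (emb y * v) = 1 + usc c * v" "v * (emb x * emb y) = 1 + usc c * v"
        using v by (simp_all add: algebra_simps usc_commute[of c v])
      have k: "emb x * (emb y * (v * z)) = z + usc c * (v * z)"
        "v * (emb x * (emb y * z)) = z + usc c * (v * z)" for z
        using arg_cong[OF 0(1), of "\<lambda>t. t * z"] arg_cong[OF 0(2), of "\<lambda>t. t * z"]
        by (simp_all add: algebra_simps)
      have m: "t * usc c = usc c * t" "t * (usc c * z) = usc c * (t * z)"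
        if "t \<in> {emb x, emb y, v}" for t z
        by (metis usc_commute) (metis usc_commute mult.assoc)
      have "(emb y * emb x - usc c) * (emb y * v * emb x - 1) = usc c"
        by (simp add: algebra_simps k m)
      then have 1: "(emb y * emb x - usc c) * w = 1"
        unfolding w_def usc_commute[of "1 / c"] by (simp add: mult.assoc[symmetric] cc)
      have "(emb y * v * emb x - 1) * (emb y * emb x - usc c) = usc c"
        by (simp add: algebra_simps k m)
      then have 2: "w * (emb y * emb x - usc c) = 1"
        unfolding w_def by (simp add: mult.assoc cc)
      show False using c 1 2 by (auto simp: Sp_def emb_simps invertible_el_def)
    qed
  qed simp
  then show ?thesis by blast
qed

text \<open>In the unitization \<open>(p - m) * (c - (m - k)) = (k - m) * (p + c - m)\<close>. Later
  \<open>p\<close> is a function of \<open>b\<close> or \<open>h\<close> that acts as the scalar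
  \<open>k\<close> on the remaining summand \<open>c\<close>, so the spectrum of a nested sum splits
  off one level at a time.\<close>

lemma Sp_add_subset:
  fixes p c :: "'a::cstar_algebra"
  assumes "p * c = k *\<^sub>C c" and "c * p = k *\<^sub>C c" and "m \<in> Sp (p + c)"
  shows "m \<in> Sp p \<or> m = k \<or> m - k \<in> Sp c"
proof (rule ccontr)
  assume *: "\<not> ?thesis"
  have 1: "emb p * emb c = usc k * emb c"
    using arg_cong[OF assms(1), of emb] by (simp add: emb_simps)
  have "(emb p - usc m) * (emb c - usc (m - k)) = usc (k - m) * (emb (p + c) - usc m)"
    using 1 by (simp add: algebra_simps usc_hom emb_simps usc_commute[of _ "emb p"]
        usc_commute[of _ "emb c"] usc_commute[of m "usc k"])
  moreover have "invertible_el ((emb p - usc m) * (emb c - usc (m - k)))"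
    using * by (intro invertible_el_mult(1)) (auto simp: Sp_def)
  ultimately have "invertible_el (emb (p + c) - usc m)"
    using * invertible_usc_mult_iff[of "k - m" "emb (p + c) - usc m"] by auto
  then show False using assms(3) by (simp add: Sp_def)
qed

section \<open>The spectral radius of self-adjoint elements\<close>

text \<open>Rickart's proof that the spectral radius is attained, without functionals or power series:
  averaging the resolvent over \<open>z\<close> and \<open>- z\<close> gives the resolvent of the square at
  \<open>z\<^sup>2\<close>, so a modulus of uniform continuity between \<open>z\<close> and
  \<open>\<rho> z\<close> is inherited by all powers with exponent \<open>2 ^ m\<close>.\<close>

lemma resolvent_double:
  fixes y :: "'a::cstar_algebra unitization"
  assumes "invertible_el (1 - usc z * y)" and "invertible_el (1 - usc (- z) * y)"
  shows "invertible_el (1 - usc (z\<^sup>2) * y\<^sup>2)"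
    and "2 *\<^sub>R inv_el (1 - usc (z\<^sup>2) * y\<^sup>2)
      = inv_el (1 - usc z * y) + inv_el (1 - usc (- z) * y)"
proof -
  let ?p = "1 - usc z * y" and ?q = "1 - usc (- z) * y"
  have e: "1 - usc (z\<^sup>2) * y\<^sup>2 = ?q * ?p"
  proof -
    have "usc (z\<^sup>2) * y\<^sup>2 = usc z * (usc z * y) * y"
      by (simp add: power2_eq_square usc_hom mult.assoc)
    also have "usc z * (usc z * y) = (usc z * y) * usc z" by (rule usc_commute)
    finally show ?thesis by (simp add: usc_hom algebra_simps)
  qed
  show "invertible_el (1 - usc (z\<^sup>2) * y\<^sup>2)"
    unfolding e by (rule invertible_el_mult(1)[OF assms(2,1)])
  have "inv_el ?p + inv_el ?q = inv_el ?p * (?q + ?p) * inv_el ?q"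
    using inv_el[OF assms(1)] inv_el[OF assms(2)]
    by (simp add: distrib_left distrib_right mult.assoc)
  also have "?q + ?p = 2 *\<^sub>R 1" by (simp add: usc_hom scaleR_2)
  finally show "2 *\<^sub>R inv_el (1 - usc (z\<^sup>2) * y\<^sup>2) = inv_el ?p + inv_el ?q"
    unfolding e invertible_el_mult(2)[OF assms(2,1)] by simp
qed

lemma resolvent_iterate:
  fixes y :: "'a::cstar_algebra unitization"
  assumes inv: "\<And>z. cmod z \<le> 1 \<Longrightarrow> invertible_el (1 - usc z * y)"
    and r: "0 \<le> r" "r \<le> 1"
    and le: "\<And>z. cmod z = 1 \<Longrightarrow>
      norm (inv_el (1 - usc z * y) - inv_el (1 - usc (of_real r * z) * y)) \<le> e"
  shows "(cmod z \<le> 1 \<longrightarrow> invertible_el (1 - usc z * y ^ (2 ^ m))) \<and> (cmod z = 1 \<longrightarrow>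
      norm (inv_el (1 - usc z * y ^ (2 ^ m))
        - inv_el (1 - usc (of_real (r ^ (2 ^ m)) * z) * y ^ (2 ^ m))) \<le> e)"
proof (induction m arbitrary: z)
  case 0
  then show ?case using inv le by simp
next
  case (Suc m)
  define w where "w = csqrt z"
  define y' where "y' = y ^ (2 ^ m)"
  define r' where "r' = r ^ (2 ^ m)"
  have r': "0 \<le> r'" "r' \<le> 1" using r by (auto simp: r'_def power_le_one)
  have z: "z = w\<^sup>2" by (simp add: w_def)
  have pw: "y ^ 2 ^ Suc m = y'\<^sup>2" "r ^ 2 ^ Suc m = r'\<^sup>2"
    by (simp_all add: y'_def r'_def power_mult[symmetric] mult.commute)
  have IH1: "invertible_el (1 - usc v * y')" if "cmod v \<le> 1" for v
    using Suc.IH that y'_def by blast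
  have IH2: "norm (inv_el (1 - usc v * y') - inv_el (1 - usc (of_real r' * v) * y')) \<le> e"
    if "cmod v = 1" for v using Suc.IH that unfolding y'_def r'_def by blast
  have w1: "cmod w \<le> 1" if "cmod z \<le> 1"
    using that by (simp add: w_def)
  have "invertible_el (1 - usc z * y'\<^sup>2)" if "cmod z \<le> 1"
    unfolding z by (rule resolvent_double(1)) (use IH1 w1[OF that] in auto)
  moreover have "norm (inv_el (1 - usc z * y'\<^sup>2) - inv_el (1 - usc (of_real (r'\<^sup>2) * z) * y'\<^sup>2)) \<le> e"
    if "cmod z = 1"
  proof -
    have cw: "cmod w = 1" using that by (simp add: w_def)
    let ?v = "of_real r' * w"
    have cv: "cmod ?v \<le> 1" using r' cw by (simp add: norm_mult)
    have v: "of_real (r'\<^sup>2) * z = ?v\<^sup>2" by (simp add: z power_mult_distrib)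
    have d1: "2 *\<^sub>R inv_el (1 - usc z * y'\<^sup>2) = inv_el (1 - usc w * y') + inv_el (1 - usc (- w) * y')"
      unfolding z by (rule resolvent_double(2)) (use IH1 cw in auto)
    have d2: "2 *\<^sub>R inv_el (1 - usc (?v\<^sup>2) * y'\<^sup>2)
        = inv_el (1 - usc ?v * y') + inv_el (1 - usc (- ?v) * y')"
      by (rule resolvent_double(2)) (use IH1 cv in auto)
    have "2 * norm (inv_el (1 - usc z * y'\<^sup>2) - inv_el (1 - usc (?v\<^sup>2) * y'\<^sup>2))
        = norm (2 *\<^sub>R inv_el (1 - usc z * y'\<^sup>2) - 2 *\<^sub>R inv_el (1 - usc (?v\<^sup>2) * y'\<^sup>2))"
      by (simp add: scaleR_diff_right[symmetric])
    also have "\<dots> = norm ((inv_el (1 - usc w * y') - inv_el (1 - usc ?v * y'))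
        + (inv_el (1 - usc (- w) * y') - inv_el (1 - usc (of_real r' * (- w)) * y')))"
      unfolding d1 d2 by (simp add: algebra_simps)
    also have "\<dots> \<le> e + e"
      by (intro norm_triangle_mono IH2) (use cw in auto)
    finally show ?thesis unfolding v by simp
  qed
  ultimately show ?case unfolding pw by simp
qed

lemma norm_power_selfadjoint:
  fixes a :: "'a::cstar_algebra"
  assumes "star a = a"
  shows "norm (emb a ^ (2 ^ m)) = norm a ^ (2 ^ m)"
proof -
  have "\<exists>c. star c = c \<and> emb c = emb a ^ (2 ^ m) \<and> norm c = norm a ^ (2 ^ m)"
  proof (induction m)
    case 0
    then show ?case using assms by auto
  next
    case (Suc m)
    then obtain c where c: "star c = c" "emb c = emb a ^ (2 ^ m)" "norm c = norm a ^ (2 ^ m)"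
      by blast
    have "norm (c * c) = (norm c)\<^sup>2" using cstar_identity[of c] c(1) by simp
    then show ?case using c
      by (intro exI[of _ "c * c"])
        (simp add: star_mult emb_simps power_mult[symmetric] power2_eq_square[symmetric] mult.commute)
  qed
  then show ?thesis by (metis emb_parts(3))
qed

theorem spectral_radius_selfadjoint:
  fixes a :: "'a::cstar_algebra"
  assumes "star a = a"
  obtains c where "c \<in> Sp a" and "norm a \<le> cmod c"
proof (cases "a = 0")
  case True
  then show ?thesis using that[of 0] zero_in_Sp[of a] by simp
next
  case False
  note witness = that
  show ?thesis
  proof (rule ccontr)
    assume no: "\<not> thesis"
    \<comment> \<open>If the claim fails, every spectral value has modulus less than
      \<open>norm a\<close>, so \<open>1 - z * y\<close> is invertible for all z in the closed unit
      disc, although all powers \<open>y ^ (2 ^ k)\<close> have norm 1.\<close>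
    define n where "n = norm a"
    have n: "n > 0" using False by (simp add: n_def)
    define y where "y = usc (of_real (1 / n)) * emb a"
    have inv: "invertible_el (1 - usc z * y)" if z: "cmod z \<le> 1" for z
    proof (cases "z = 0")
      case True
      then show ?thesis by (auto intro: invertible_elI)
    next
      case False
      define c where "c = of_real n / z"
      have "c \<noteq> 0" using False n by (simp add: c_def)
      have "cmod c \<ge> n" using z False n by (simp add: c_def norm_divide field_simps)
      then have "invertible_el (emb a - usc c)" using no witness[of c] by (auto simp: Sp_def n_def)
      then have "invertible_el (usc (- inverse c) * (emb a - usc c))"
        using \<open>c \<noteq> 0\<close> by (simp add: invertible_usc_mult_iff)
      also have "usc (- inverse c) * (emb a - usc c) = 1 - usc (inverse c) * emb a"
        using \<open>c \<noteq> 0\<close> by (simp add: right_diff_distrib usc_hom(3)[symmetric])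
          (simp add: usc_hom)
      also have "usc (inverse c) * emb a = usc z * y"
        by (simp add: y_def mult.assoc[symmetric] usc_hom(3)[symmetric] c_def divide_inverse mult.commute)
      finally show ?thesis .
    qed
    have "continuous_on (cball 0 1) (\<lambda>z. inv_el (1 - usc z * y))"
      using inv by (intro continuous_on_inv_el continuous_intros linear_continuous_on
          bounded_linear_usc) auto
    then have "uniformly_continuous_on (cball 0 1) (\<lambda>z. inv_el (1 - usc z * y))"
      by (rule compact_uniformly_continuous) auto
    then obtain d where d: "d > 0" "\<And>z w. cmod z \<le> 1 \<Longrightarrow> cmod w \<le> 1 \<Longrightarrow> dist z w < d \<Longrightarrow>
        dist (inv_el (1 - usc z * y)) (inv_el (1 - usc w * y)) < 1 / 4"
      unfolding uniformly_continuous_on_def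
      by (metis divide_pos_pos mem_cball_0 zero_less_numeral zero_less_one)
    define r where "r = 1 - min (d / 2) (1 / 2)"
    have r: "0 < r" "r < 1" "1 - r < d" using d(1) by (auto simp: r_def min_def)
    have ns: "norm (inv_el (1 - usc z * y) - inv_el (1 - usc (of_real r * z) * y)) \<le> 1 / 4"
      if "cmod z = 1" for z
    proof -
      have "z - of_real r * z = of_real (1 - r) * z" by (simp add: algebra_simps)
      then have "dist z (of_real r * z) = 1 - r"
        using that r by (simp add: dist_norm norm_mult del: of_real_diff)
      then have "dist (inv_el (1 - usc z * y)) (inv_el (1 - usc (of_real r * z) * y)) < 1 / 4"
        using that r by (intro d(2)) (auto simp: norm_mult)
      then show ?thesis by (simp add: dist_norm)
    qed
    \<comment> \<open>For t < 1/9 the resolvent at t is within 1/9 times 9/8, that is 1/8, of 1. So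
      the resolvent at 1 is within 1/4 + 1/8 = 3/8 of 1, and the norm of \<open>x\<close> is at most
      2 times 3/8, less than 1.\<close>
    obtain k where k: "r ^ k < 1 / 9" using real_arch_pow_inv[of "1/9" r] r by auto
    define t where "t = r ^ (2 ^ k)"
    have "t \<le> r ^ k" unfolding t_def using r by (intro power_decreasing) (auto intro: less_imp_le)
    then have "t < 1 / 9" using k by linarith
    moreover have "0 < t" using r by (simp add: t_def)
    ultimately have t: "0 < t" "t < 1 / 9" by blast+
    define x where "x = y ^ (2 ^ k)"
    have "x = usc (of_real (1 / n ^ (2 ^ k))) * emb a ^ (2 ^ k)"
      unfolding x_def y_def
      by (simp only: scaleR_usc[symmetric] scaleR_power power_one_over)
    then have "norm x = 1"
      using n by (simp only: scaleR_usc[symmetric]) (simp add: norm_power_selfadjoint[OF assms] n_def)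
    have ix: "invertible_el (1 - usc z * x)" if "cmod z \<le> 1" for z
      unfolding x_def using resolvent_iterate[OF inv _ _ ns] r that by auto
    have near: "norm (inv_el (1 - x) - inv_el (1 - usc (of_real t) * x)) \<le> 1 / 4"
      unfolding x_def t_def using resolvent_iterate[OF inv _ _ ns, where z = 1 and m = k] r by auto
    have tx: "norm (usc (of_real t) * x) = t"
      using \<open>norm x = 1\<close> t by (simp add: scaleR_usc[symmetric])
    define R where "R = inv_el (1 - usc (of_real t) * x)"
    have R: "(1 - usc (of_real t) * x) * R = 1" unfolding R_def
      by (rule inv_el) (rule ix, use t in auto)
    have "R = (\<Sum>j. (usc (of_real t) * x) ^ j)"
      unfolding R_def using tx t by (intro inv_el_unique neumann_sums) auto
    then have "norm R \<le> 1 / (1 - t)" using neumann_sums(4)[of "usc (of_real t) * x"] tx t by simp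
    also have "\<dots> \<le> 9 / 8" using t by (simp add: field_simps)
    finally have "norm R \<le> 9 / 8" .
    have "R - 1 = usc (of_real t) * x * R" using R by (simp add: algebra_simps)
    then have "norm (R - 1) \<le> t * norm R" using norm_mult_ineq[of "usc (of_real t) * x" R] tx by simp
    also have "\<dots> \<le> 1 / 9 * (9 / 8)" using t \<open>norm R \<le> 9 / 8\<close> by (intro mult_mono) auto
    finally have "norm (R - 1) \<le> 1 / 8" by simp
    then have le: "norm (inv_el (1 - x) - 1) \<le> 3 / 8"
      using near norm_triangle_ineq[of "inv_el (1 - x) - R" "R - 1"] by (simp add: R_def)
    have "invertible_el (1 - x)" using ix[of 1] by simp
    then have "x = (1 - x) * (inv_el (1 - x) - 1)" by (simp add: right_diff_distrib inv_el)
    then have "norm x \<le> norm (1 - x) * norm (inv_el (1 - x) - 1)" by (metis norm_mult_ineq)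
    also have "\<dots> \<le> 2 * (3 / 8)"
      using le norm_triangle_ineq4[of 1 x] \<open>norm x = 1\<close> by (intro mult_mono) auto
    finally show False using \<open>norm x = 1\<close> by simp
  qed
qed

section \<open>Approximate eigenvectors\<close>

text \<open>The norms of the resolvents at \<open>l n\<close> tend to infinity, so after
  normalization they are almost annihilated by \<open>a - c\<close>. They live in the unitization;
  since c is not 0, \<open>a * v / c\<close> lies in the algebra and is asymptotically equal to
  \<open>v\<close>.\<close>

lemma approximate_eigenvector:
  fixes a :: "'a::cstar_algebra"
  assumes c: "c \<in> Sp a" "c \<noteq> 0" and lim: "l \<longlonglongrightarrow> c" and l: "\<And>n. l n \<notin> Sp a"
  obtains u :: "nat \<Rightarrow> 'a" where "(\<lambda>n. norm (u n)) \<longlonglongrightarrow> 1"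
    and "(\<lambda>n. a * u n - c *\<^sub>C u n) \<longlonglongrightarrow> 0"
proof -
  define R where "R = (\<lambda>n. inv_el (emb a - usc (l n)))"
  have inv: "invertible_el (emb a - usc (l n))" for n using l[of n] by (simp add: Sp_def)
  have R: "(emb a - usc (l n)) * R n = 1" for n unfolding R_def by (rule inv_el[OF inv])
  have Rpos: "norm (R n) > 0" for n using R[of n] by auto
  have "cmod (l n - c) * norm (R n) > 1 / 2" for n
  proof (rule ccontr)
    assume "\<not> ?thesis"
    then have "norm (emb a - usc c - (emb a - usc (l n))) * norm (inv_el (emb a - usc (l n))) \<le> 1 / 2"
      by (simp add: R_def usc_hom(2)[symmetric])
    then show False using invertible_perturb(1)[OF inv] c(1) by (simp add: Sp_def)
  qed
  then have Rinv: "1 / norm (R n) \<le> 2 * cmod (l n - c)" for n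
    using Rpos[of n] by (simp add: field_simps less_imp_le)
  define v where "v = (\<lambda>n. (1 / norm (R n)) *\<^sub>R R n)"
  have nv: "norm (v n) = 1" for n using Rpos[of n] by (simp add: v_def)
  have av: "emb a * v n - usc c * v n = usc (l n - c) * v n + (1 / norm (R n)) *\<^sub>R 1" for n
  proof -
    have "emb a * R n = usc (l n) * R n + 1" using R[of n] by (simp add: algebra_simps)
    then show ?thesis
      by (simp add: v_def usc_hom algebra_simps)
  qed
  have z: "(\<lambda>n. emb a * v n - usc c * v n) \<longlonglongrightarrow> 0"
  proof (rule Lim_null_comparison)
    show "\<forall>\<^sub>F n in sequentially. norm (emb a * v n - usc c * v n) \<le> 3 * cmod (l n - c)"
    proof (intro always_eventually allI)
      fix n
      have "norm (emb a * v n - usc c * v n) \<le> norm (usc (l n - c) * v n) + 1 / norm (R n)"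
        unfolding av by (rule norm_triangle_le) simp
      also have "norm (usc (l n - c) * v n) \<le> cmod (l n - c)"
        using norm_mult_ineq[of "usc (l n - c)" "v n"] nv by simp
      finally show "norm (emb a * v n - usc c * v n) \<le> 3 * cmod (l n - c)" using Rinv[of n] by simp
    qed
    have "(\<lambda>n. 3 * cmod (l n - c)) \<longlonglongrightarrow> 3 * 0"
      by (intro tendsto_intros tendsto_norm_zero) (use lim in \<open>simp add: LIM_zero\<close>)
    then show "(\<lambda>n. 3 * cmod (l n - c)) \<longlonglongrightarrow> 0" by simp
  qed
  define u where "u = (\<lambda>n. upart (usc (1 / c) * (emb a * v n)))"
  have u: "emb (u n) = usc (1 / c) * (emb a * v n)" for n
    unfolding u_def by (rule uscal_zero_emb[symmetric]) simp
  have cc: "usc (1 / c) * (usc c * t) = t" "usc c * (usc (1 / c) * t) = t" for t :: "'a unitization"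
    using c(2) by (simp_all add: mult.assoc[symmetric] usc_hom(3)[symmetric])
  have "(\<lambda>n. usc (1 / c) * (emb a * v n - usc c * v n)) \<longlonglongrightarrow> usc (1 / c) * 0"
    by (intro tendsto_intros z)
  then have uv: "(\<lambda>n. emb (u n) - v n) \<longlonglongrightarrow> 0" by (simp add: u right_diff_distrib cc)
  have "(\<lambda>n. norm (u n) - 1) \<longlonglongrightarrow> 0"
  proof (rule Lim_null_comparison[OF _ tendsto_norm_zero[OF uv]])
    show "\<forall>\<^sub>F n in sequentially. norm (norm (u n) - 1) \<le> norm (emb (u n) - v n)"
      using norm_triangle_ineq3[of "emb (u _)" "v _"] nv by simp
  qed
  then have 1: "(\<lambda>n. norm (u n)) \<longlonglongrightarrow> 1" by (simp add: LIM_zero_iff)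
  have "(\<lambda>n. emb a * (usc (1 / c) * (emb a * v n - usc c * v n))) \<longlonglongrightarrow> emb a * (usc (1 / c) * 0)"
    by (intro tendsto_intros z)
  then have "(\<lambda>n. emb a * emb (u n) - usc c * emb (u n)) \<longlonglongrightarrow> 0"
    by (simp add: u right_diff_distrib cc)
  then have "(\<lambda>n. upart (emb (a * u n - c *\<^sub>C u n))) \<longlonglongrightarrow> upart 0"
    by (intro tendsto_upart) (simp add: emb_simps)
  then have 2: "(\<lambda>n. a * u n - c *\<^sub>C u n) \<longlonglongrightarrow> 0" by simp
  show thesis by (rule that[OF 1 2])
qed

text \<open>A spectral point c with largest |Im c| can be approached from outside the spectrum if it
  is not real, so it has approximate eigenvectors u. Then \<open>star u * a * u\<close> is close to
  \<open>star u * u\<close> times c and, by taking adjoints, also times the conjugate of c.\<close>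

theorem Sp_selfadjoint_real:
  fixes a :: "'a::cstar_algebra"
  assumes sa: "star a = a" and "z \<in> Sp a"
  shows "Im z = 0"
proof (rule ccontr)
  assume z: "Im z \<noteq> 0"
  have "continuous_on (Sp a) (\<lambda>c. \<bar>Im c\<bar>)" by (intro continuous_intros)
  then obtain c where c: "c \<in> Sp a" "\<And>w. w \<in> Sp a \<Longrightarrow> \<bar>Im w\<bar> \<le> \<bar>Im c\<bar>"
    using continuous_attains_sup[OF compact_Sp, of a "\<lambda>c. \<bar>Im c\<bar>"] assms(2) by blast
  have c0: "Im c \<noteq> 0" using z c(2)[OF assms(2)] by auto
  define l where "l = (\<lambda>n. c + Complex 0 (sgn (Im c)) * of_real (1 / real (Suc n)))"
  have "l \<longlonglongrightarrow> c + Complex 0 (sgn (Im c)) * of_real 0"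
    unfolding l_def by (intro tendsto_intros LIMSEQ_Suc lim_1_over_n) 
  then have lim: "l \<longlonglongrightarrow> c" by simp
  have "\<bar>Im (l n)\<bar> > \<bar>Im c\<bar>" for n
  proof -
    define p where "p = 1 / real (Suc n)"
    have "p > 0" by (simp add: p_def)
    moreover have "Im (l n) = Im c + sgn (Im c) * p" by (simp add: l_def p_def)
    ultimately show ?thesis using c0 by (auto simp: sgn_if abs_if)
  qed
  then have l: "l n \<notin> Sp a" for n using c(2) by (meson leD)
  obtain u where u: "(\<lambda>n. norm (u n)) \<longlonglongrightarrow> 1" "(\<lambda>n. a * u n - c *\<^sub>C u n) \<longlonglongrightarrow> 0"
    using approximate_eigenvector[OF c(1) _ lim l] c0 by (metis complex.sel(2) zero_complex.code)
  have "(\<lambda>n. star (u n) * (a * u n - c *\<^sub>C u n)) \<longlonglongrightarrow> 0"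
  proof (rule Lim_null_comparison)
    show "\<forall>\<^sub>F n in sequentially. norm (star (u n) * (a * u n - c *\<^sub>C u n))
        \<le> norm (u n) * norm (a * u n - c *\<^sub>C u n)"
      using norm_mult_ineq[of "star (u _)"] by simp
    show "(\<lambda>n. norm (u n) * norm (a * u n - c *\<^sub>C u n)) \<longlonglongrightarrow> 0"
      using tendsto_mult[OF u(1) tendsto_norm_zero[OF u(2)]] by simp
  qed
  then have 1: "(\<lambda>n. star (u n) * a * u n - c *\<^sub>C (star (u n) * u n)) \<longlonglongrightarrow> 0"
    by (simp add: right_diff_distrib mult.assoc mult_scaleC_right)
  have 2: "(\<lambda>n. star (u n) * a * u n - cnj c *\<^sub>C (star (u n) * u n)) \<longlonglongrightarrow> 0"
    using tendsto_star[OF 1] by (simp add: star_simps sa mult.assoc)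
  have "(\<lambda>n. norm ((cnj c - c) *\<^sub>C (star (u n) * u n))) \<longlonglongrightarrow> 0"
    using tendsto_norm[OF tendsto_diff[OF 1 2]] by (simp add: scaleC_diff_left)
  then have "(\<lambda>n. cmod (cnj c - c) * (norm (u n))\<^sup>2) \<longlonglongrightarrow> 0"
    by (simp add: norm_scaleC cstar_identity)
  moreover have "(\<lambda>n. cmod (cnj c - c) * (norm (u n))\<^sup>2) \<longlonglongrightarrow> cmod (cnj c - c) * 1\<^sup>2"
    by (intro tendsto_intros u)
  ultimately have "cmod (cnj c - c) * 1\<^sup>2 = 0" using LIMSEQ_unique by blast
  then show False using c0 by (auto simp: complex_eq_iff)
qed

lemma approximate_eigenvector_selfadjoint:
  fixes a :: "'a::cstar_algebra"
  assumes sa: "star a = a" and c: "c \<in> Sp a" "c \<noteq> 0"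
  obtains u :: "nat \<Rightarrow> 'a" where "(\<lambda>n. norm (u n)) \<longlonglongrightarrow> 1"
    and "(\<lambda>n. a * u n - c *\<^sub>C u n) \<longlonglongrightarrow> 0"
proof -
  define l where "l = (\<lambda>n. c + \<i> * of_real (1 / real (Suc n)))"
  have "l \<longlonglongrightarrow> c + \<i> * of_real 0"
    unfolding l_def by (intro tendsto_intros LIMSEQ_Suc lim_1_over_n)
  then have lim: "l \<longlonglongrightarrow> c" by simp
  have "Im (l n) \<noteq> 0" for n
    using Sp_selfadjoint_real[OF sa c(1)] by (simp add: l_def)
  then have "l n \<notin> Sp a" for n using Sp_selfadjoint_real[OF sa] by blast
  then show thesis using approximate_eigenvector[OF c lim] that by blast
qed

section \<open>Contractivity of homomorphisms\<close>

text \<open>The domain is only a subalgebra, so its resolvents are taken from the Neumann series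
  instead of from spectral permanence.\<close>

lemma star_homomorphism_contractive:
  fixes B :: "'a::cstar_algebra set" and C :: "'b::cstar_algebra set"
  assumes B: "closed_star_subalgebra B" and hom: "star_homomorphism_on B C f" and x: "x \<in> B"
  shows "norm (f x) \<le> norm x"
proof -
  note hom' = hom[unfolded star_homomorphism_on_def] and B' = B[unfolded closed_star_subalgebra_def]
  define a where "a = star x * x"
  have a: "a \<in> B" using x B' by (auto simp: a_def)
  have fa: "f a = star (f x) * f x" using x hom' B' by (auto simp: a_def)
  have "star (f a) = f a" by (simp add: fa star_simps)
  then obtain c where c: "c \<in> Sp (f a)" "norm (f a) \<le> cmod c"
    by (rule spectral_radius_selfadjoint)
  have "cmod c \<le> norm a"
  proof (rule ccontr)
    assume "\<not> cmod c \<le> norm a"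
    then have lt: "norm a < cmod c" and c0: "c \<noteq> 0" using norm_ge_zero[of a] by auto
    define y where "y = (1 / c) *\<^sub>C a"
    have y: "y \<in> B" using a B' by (simp add: y_def)
    have ny: "norm (emb y) < 1" using lt c0 by (simp add: y_def norm_scaleC norm_divide)
    note N = neumann_sums[OF ny]
    define s where "s = (\<Sum>n. emb y ^ n)"
    define w where "w = upart s"
    \<comment> \<open>The empty partial sum has scalar part 0, so the scalar part is taken of the
      sum up to \<open>Suc k\<close>, which contains the constant term.\<close>
    have part: "upart (\<Sum>n<k. emb y ^ n) \<in> B \<and> uscal (\<Sum>n<Suc k. emb y ^ n) = 1" for k
    proof (induction k)
      case 0
      then show ?case using B' by simp
    next
      case (Suc k)
      have "(\<Sum>n<Suc k. emb y ^ n) = 1 + emb y * (\<Sum>n<k. emb y ^ n)"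
        by (subst sum.lessThan_Suc_shift) (simp add: sum_distrib_left)
      moreover have "upart (emb y * u) = y * upart u + uscal u *\<^sub>C y" for u
        by (simp add: emb_def unitization_defs)
      ultimately have "upart (\<Sum>n<Suc k. emb y ^ n)
          = y * upart (\<Sum>n<k. emb y ^ n) + uscal (\<Sum>n<k. emb y ^ n) *\<^sub>C y" by simp
      moreover have "uscal (emb y ^ Suc k) = 0" by simp
      ultimately show ?case using Suc y B' by (simp del: power_Suc)
    qed
    have lim: "(\<lambda>k. \<Sum>n<k. emb y ^ n) \<longlonglongrightarrow> s"
      unfolding s_def by (rule summable_LIMSEQ[OF N(1)])
    have w: "w \<in> B"
      unfolding w_def by (rule closed_sequentially[OF _ _ tendsto_upart[OF lim]]) (use part B' in auto)
    have "(\<lambda>k. uscal (\<Sum>n<Suc k. emb y ^ n)) \<longlonglongrightarrow> uscal s"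
      by (rule LIMSEQ_Suc, rule bounded_linear.tendsto[OF bounded_linear_uscal lim])
    then have "uscal s = 1" using part LIMSEQ_unique[OF _ tendsto_const] by simp
    then have s: "s = 1 + emb w" using unitization_decomp[of s] by (simp add: w_def add.commute)
    \<comment> \<open>\<open>w\<close> is a quasi-inverse: these equations involve only elements of
      \<open>B\<close>, so \<open>f\<close> carries them over, and \<open>1 + f w\<close> inverts
      \<open>1 - f y\<close>.\<close>
    have "emb (w - y - y * w) = 0" "emb (w - y - w * y) = 0"
      using N(2,3) unfolding s_def[symmetric] s by (simp_all add: emb_simps algebra_simps)
    then have e: "w = y + y * w" "w = y + w * y" by (simp_all add: emb_def unitization_defs algebra_simps)
    have "f w = f y + f y * f w" using e(1) y w hom' B' by metis
    moreover have "f w = f y + f w * f y" using e(2) y w hom' B' by metis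
    ultimately have "(1 - emb (f y)) * (1 + emb (f w)) = 1" "(1 + emb (f w)) * (1 - emb (f y)) = 1"
      by (simp_all add: algebra_simps emb_simps(1,3)[symmetric])
    then have "invertible_el (1 - emb (f y))" by (rule invertible_elI)
    then have "invertible_el (usc (- c) * (1 - emb (f y)))"
      using c0 by (simp add: invertible_usc_mult_iff)
    moreover have "f y = (1 / c) *\<^sub>C f a" using a hom' by (simp add: y_def)
    then have "usc (- c) * (1 - emb (f y)) = emb (f a) - usc c"
      using c0 by (simp add: right_diff_distrib emb_simps mult.assoc[symmetric] usc_hom(3)[symmetric])
        (simp add: usc_hom)
    ultimately show False using c(1) by (simp add: Sp_def)
  qed
  then have "(norm (f x))\<^sup>2 \<le> (norm x)\<^sup>2"
    using c(2) cstar_identity[of "f x"] cstar_identity[of x] by (simp only: fa[symmetric] a_def[symmetric])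
  then show ?thesis by (rule power2_le_imp_le) simp
qed

section \<open>Polynomial calculus\<close>

definition upoly :: "complex poly \<Rightarrow> 'a::cstar_algebra unitization \<Rightarrow> 'a unitization"
  where "upoly p u = fold_coeffs (\<lambda>c v. usc c + u * v) p 0"

lemma upoly_0 [simp]: "upoly 0 u = 0"
  by (simp add: upoly_def)

lemma upoly_pCons [simp]: "upoly (pCons c p) u = usc c + u * upoly p u"
  by (cases "p = 0 \<and> c = 0") (auto simp: upoly_def)

lemma upoly_add: "upoly (p + q) u = upoly p u + upoly q u"
  by (induction p q rule: poly_induct2) (simp_all add: usc_hom algebra_simps)

lemma upoly_smult: "upoly (smult c p) u = usc c * upoly p u"
proof (induction p)
  case (pCons a p)
  have "u * (usc c * upoly p u) = usc c * (u * upoly p u)" by (metis usc_commute mult.assoc)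
  then show ?case using pCons by (simp add: usc_hom algebra_simps usc_commute[of a "usc c"])
qed simp

lemma upoly_mult: "upoly (p * q) u = upoly p u * upoly q u"
  by (induction p) (simp_all add: upoly_add upoly_smult algebra_simps)

lemma invertible_upoly:
  fixes a :: "'a::cstar_algebra"
  assumes "p \<noteq> 0" and "\<And>z. poly p z = 0 \<Longrightarrow> z \<notin> Sp a"
  shows "invertible_el (upoly p (emb a))"
  using assms
proof (induction "degree p" arbitrary: p)
  case 0
  then obtain c where "p = [:c:]" "c \<noteq> 0" by (metis degree_eq_zeroE pCons_0_0)
  then show ?case by (simp add: invertible_usc)
next
  case (Suc n)
  then have "\<not> constant (poly p)" by (simp add: constant_degree)
  then obtain z where z: "poly p z = 0" using fundamental_theorem_of_algebra by blast
  then obtain q where q: "p = [:- z, 1:] * q" by (metis dvdE poly_eq_0_iff_dvd)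
  have "q \<noteq> 0" using Suc.prems q by auto
  have "degree p = Suc (degree q)" unfolding q using \<open>q \<noteq> 0\<close> by (subst degree_mult_eq) auto
  moreover have "w \<notin> Sp a" if "poly q w = 0" for w using Suc.prems(2)[of w] that q by simp
  ultimately have "invertible_el (upoly q (emb a))" using Suc \<open>q \<noteq> 0\<close> by auto
  moreover have "invertible_el (emb a - usc z)" using Suc.prems(2)[OF z] by (simp add: Sp_def)
  moreover have "upoly p (emb a) = (emb a - usc z) * upoly q (emb a)"
    unfolding q upoly_mult by (simp add: usc_hom)
  ultimately show ?case by (simp add: invertible_el_mult)
qed

text \<open>\<open>zev q a\<close> stands for \<open>a q(a)\<close>, which needs no unit.\<close>

definition zev :: "complex poly \<Rightarrow> 'a::cstar_algebra \<Rightarrow> 'a"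
  where "zev q a = upart (upoly (pCons 0 q) (emb a))"

lemma emb_zev: "emb (zev q a) = emb a * upoly q (emb a)"
  using uscal_zero_emb[of "upoly (pCons 0 q) (emb a)"] by (simp add: zev_def)

lemma zev_0 [simp]: "zev 0 a = 0"
  by (simp add: zev_def)

lemma zev_pCons: "zev (pCons c q) a = c *\<^sub>C a + a * zev q a"
proof -
  have "emb (zev (pCons c q) a) = emb (c *\<^sub>C a + a * zev q a)"
    by (simp add: emb_zev emb_simps usc_commute[of c] distrib_left)
  then show ?thesis by simp
qed

lemma zev_1: "zev 1 a = a"
  using zev_pCons[of 1 0 a] by (simp add: one_pCons)

lemma zev_add: "zev (p + q) a = zev p a + zev q a"
proof -
  have "emb (zev (p + q) a) = emb (zev p a + zev q a)"
    by (simp add: emb_zev upoly_add emb_simps distrib_left)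
  then show ?thesis by simp
qed

lemma zev_smult: "zev (smult c p) a = c *\<^sub>C zev p a"
proof -
  have "emb (zev (smult c p) a) = emb (c *\<^sub>C zev p a)"
    by (simp add: emb_zev upoly_smult emb_simps) (metis usc_commute mult.assoc)
  then show ?thesis by simp
qed

lemma zev_diff: "zev (p - q) a = zev p a - zev q a"
  using zev_add[of "p - q" q a] by simp

text \<open>The implicit factor z of \<open>zev q a\<close> has to be made explicit: z p(z) times z
  q(z) is z times p(z) (z q(z)).\<close>

lemma zev_mult: "zev (p * pCons 0 q) a = zev p a * zev q a"
proof -
  have "emb (zev (p * pCons 0 q) a) = emb (zev p a * zev q a)"
    by (simp add: emb_zev upoly_mult emb_simps mult.assoc del: mult_pCons_right)
  then show ?thesis by simp
qed

lemma zev_commute: "a * zev q a = zev q a * a"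
  using zev_mult[of 1 q a] zev_mult[of q 1 a] by (simp add: zev_1 mult.commute)

lemma star_zev:
  assumes "star a = a" shows "star (zev q a) = zev (map_poly cnj q) a"
  by (induction q) (simp_all add: zev_pCons map_poly_pCons star_simps assms zev_commute)

lemma Sp_zev: "Sp (zev q a) = (\<lambda>z. z * poly q z) ` Sp a"
proof (intro equalityI subsetI)
  fix m assume m: "m \<in> Sp (zev q a)"
  show "m \<in> (\<lambda>z. z * poly q z) ` Sp a"
  proof (rule ccontr)
    assume no: "m \<notin> (\<lambda>z. z * poly q z) ` Sp a"
    define p where "p = pCons (- m) q"
    have "poly p 0 \<noteq> 0" using no zero_in_Sp[of a] by (force simp: p_def)
    then have "p \<noteq> 0" by auto
    moreover have "z \<notin> Sp a" if "poly p z = 0" for z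
      using no that by (auto simp: p_def image_iff algebra_simps)
    ultimately have "invertible_el (upoly p (emb a))" by (rule invertible_upoly)
    then show False using m by (simp add: Sp_def p_def emb_zev usc_hom)
  qed
next
  fix m assume "m \<in> (\<lambda>z. z * poly q z) ` Sp a"
  then obtain z where z: "z \<in> Sp a" "m = z * poly q z" by blast
  define p where "p = pCons (- m) q"
  have "poly p z = 0" by (simp add: p_def z)
  then obtain r where r: "p = [:- z, 1:] * r" by (metis dvdE poly_eq_0_iff_dvd)
  have "emb (zev q a) - usc m = upoly p (emb a)" by (simp add: emb_zev p_def usc_hom)
  moreover have "\<not> invertible_el (upoly p (emb a))"
  proof
    assume inv: "invertible_el (upoly p (emb a))"
    have e: "upoly [:- z, 1:] (emb a) = emb a - usc z" by (simp add: usc_hom)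
    have "upoly p (emb a) = (emb a - usc z) * upoly r (emb a)" unfolding r upoly_mult e ..
    moreover have "upoly p (emb a) = upoly r (emb a) * (emb a - usc z)"
      unfolding r mult.commute[of _ r] upoly_mult e ..
    ultimately have "invertible_el (emb a - usc z)"
      using inv invertible_el_commute_factor by metis
    then show False using z(1) by (simp add: Sp_def)
  qed
  ultimately show "m \<in> Sp (zev q a)" by (simp add: Sp_def)
qed

lemma norm_zev_le:
  assumes sa: "star a = a" and le: "\<And>z. z \<in> Sp a \<Longrightarrow> cmod (z * poly q z) \<le> B"
  shows "norm (zev q a) \<le> B"
proof -
  have B: "B \<ge> 0" using le[OF zero_in_Sp] by simp
  \<comment> \<open>The spectral radius formula needs a self-adjoint element. On the real spectrum
    of \<open>a\<close> the polynomial of \<open>y\<close> takes the value |z q(z)|^2.\<close>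
  define y where "y = zev (map_poly cnj q * pCons 0 q) a"
  have y: "y = star (zev q a) * zev q a" by (simp only: y_def zev_mult star_zev[OF sa])
  then have "star y = y" by (simp add: star_simps)
  then obtain c where c: "c \<in> Sp y" "norm y \<le> cmod c" by (rule spectral_radius_selfadjoint)
  obtain z where z: "z \<in> Sp a" "c = z * poly (map_poly cnj q * pCons 0 q) z"
    using c(1) unfolding y_def Sp_zev by blast
  have "cnj z = z" using Sp_selfadjoint_real[OF sa z(1)] by (simp add: complex_eq_iff)
  then have "c = cnj (z * poly q z) * (z * poly q z)" by (simp add: z(2) mult_ac)
  then have "cmod c = (cmod (z * poly q z))\<^sup>2" by (simp add: norm_mult power2_eq_square)
  also have "\<dots> \<le> B\<^sup>2" using le[OF z(1)] by (intro power_mono) auto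
  finally have "(norm (zev q a))\<^sup>2 \<le> B\<^sup>2" using c(2) by (simp add: y cstar_identity)
  then show ?thesis by (rule power2_le_imp_le) (rule B)
qed

definition c0_on :: "complex set \<Rightarrow> (complex \<Rightarrow> complex) \<Rightarrow> bool"
  where "c0_on K f \<longleftrightarrow> continuous_on K f \<and> f 0 = 0"

abbreviation unif :: "complex set \<Rightarrow> (nat \<Rightarrow> complex poly) \<Rightarrow> (complex \<Rightarrow> complex) \<Rightarrow> bool"
  where "unif K q f \<equiv> uniform_limit K (\<lambda>n z. z * poly (q n) z) f sequentially"

lemma weierstrass_real_part:
  assumes K: "compact K" and g: "continuous_on K g" and e: "e > 0"
  obtains p :: "complex poly" where "\<And>z. z \<in> K \<Longrightarrow> Im z = 0 \<Longrightarrow> cmod (poly p z - of_real (g z)) < e"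
proof -
  let ?K = "{x. complex_of_real x \<in> K}"
  have "closed ?K"
    using closed_vimage[OF compact_imp_closed[OF K], of complex_of_real]
    by (simp add: vimage_def continuous_intros)
  moreover have "bounded ?K" using compact_imp_bounded[OF K] unfolding bounded_iff by force
  ultimately have "compact ?K" by (simp add: compact_eq_bounded_closed)
  moreover have "continuous_on ?K (\<lambda>x. g (of_real x))"
    by (rule continuous_on_compose2[OF g]) (auto intro!: continuous_intros)
  ultimately obtain h where h: "real_polynomial_function h"
    "\<And>x. x \<in> ?K \<Longrightarrow> \<bar>g (of_real x) - h x\<bar> < e"
    using Stone_Weierstrass_real_polynomial_function e by blast
  obtain b n where b: "h = (\<lambda>x. \<Sum>i\<le>n. b i * x ^ i)"
    using h(1) real_polynomial_function_iff_sum by blast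
  define p where "p = (\<Sum>i\<le>n. monom (complex_of_real (b i)) i)"
  have p: "poly p (of_real x) = of_real (h x)" for x
    by (simp add: p_def b poly_sum poly_monom)
  have "cmod (poly p z - of_real (g z)) < e" if "z \<in> K" "Im z = 0" for z
  proof -
    have z: "of_real (Re z) = z" using that(2) by (simp add: complex_eq_iff)
    then have "cmod (poly p z - of_real (g z)) = \<bar>h (Re z) - g z\<bar>"
      using p[of "Re z"] by (metis norm_of_real of_real_diff)
    then show ?thesis using h(2)[of "Re z"] z that(1) by (simp add: abs_minus_commute)
  qed
  then show thesis using that by blast
qed

lemma weierstrass_c0:
  assumes K: "compact K" "\<And>z. z \<in> K \<Longrightarrow> Im z = 0" "0 \<in> K" and f: "c0_on K f"
  obtains q where "unif K q f"
proof -
  have "\<exists>q. \<forall>z\<in>K. cmod (z * poly q z - f z) < e" if e: "e > 0" for e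
  proof -
    have cf: "continuous_on K f" "f 0 = 0" using f by (simp_all add: c0_on_def)
    obtain p1 where p1: "\<And>z. z \<in> K \<Longrightarrow> Im z = 0 \<Longrightarrow> cmod (poly p1 z - of_real (Re (f z))) < e / 4"
      using weierstrass_real_part[OF K(1), of "\<lambda>z. Re (f z)" "e / 4"] cf e
      by (auto intro: continuous_intros)
    obtain p2 where p2: "\<And>z. z \<in> K \<Longrightarrow> Im z = 0 \<Longrightarrow> cmod (poly p2 z - of_real (Im (f z))) < e / 4"
      using weierstrass_real_part[OF K(1), of "\<lambda>z. Im (f z)" "e / 4"] cf e
      by (auto intro: continuous_intros)
    define p where "p = p1 + smult \<i> p2"
    have p: "cmod (poly p z - f z) < e / 2" if "z \<in> K" for z
    proof -
      have "poly p z - f z = (poly p1 z - of_real (Re (f z))) + \<i> * (poly p2 z - of_real (Im (f z)))"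
        by (simp add: p_def algebra_simps) (metis complex_eq mult.commute)
      then have "cmod (poly p z - f z) \<le> cmod (poly p1 z - of_real (Re (f z)))
          + cmod (\<i> * (poly p2 z - of_real (Im (f z))))" by (metis norm_triangle_ineq)
      then show ?thesis using p1[OF that K(2)[OF that]] p2[OF that K(2)[OF that]]
        by (simp add: norm_mult)
    qed
    \<comment> \<open>Dropping the constant term c costs less than e / 2, since f vanishes at 0 and
      0 lies in K.\<close>
    obtain c q where q: "p = pCons c q" by (cases p)
    have "cmod c < e / 2" using p[OF K(3)] cf(2) by (simp add: q)
    then have "cmod (z * poly q z - f z) < e" if "z \<in> K" for z
      using p[OF that] norm_triangle_ineq4[of "poly p z - f z" c] by (simp add: q)
    then show ?thesis by blast
  qed
  then obtain Q where Q: "\<And>e z. e > 0 \<Longrightarrow> z \<in> K \<Longrightarrow> cmod (z * poly (Q e) z - f z) < e" by metis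
  have "unif K (\<lambda>n. Q (1 / real (Suc n))) f"
  proof (rule uniform_limitI)
    fix e :: real assume "e > 0"
    then have "\<forall>\<^sub>F n in sequentially. 1 / real (Suc n) < e"
      by (intro order_tendstoD(2)[OF LIMSEQ_Suc[OF lim_1_over_n]])
    then show "\<forall>\<^sub>F n in sequentially. \<forall>z\<in>K. dist (z * poly (Q (1 / real (Suc n))) z) (f z) < e"
      by (rule eventually_mono)
        (metis Q dist_norm less_trans of_nat_0_less_iff zero_less_Suc zero_less_divide_1_iff)
  qed
  then show thesis by (rule that)
qed

section \<open>Continuous functional calculus\<close>

text \<open>A calculus defined by approximation, so that its properties follow from those of
  polynomials by passing to the limit. \<open>cfc\<close> is characterized by a homomorphism
  instead; \<open>cfc_eq_cal\<close> identifies the two for self-adjoint elements.\<close>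

definition cal :: "'a::cstar_algebra \<Rightarrow> (complex \<Rightarrow> complex) \<Rightarrow> 'a"
  where "cal a f = (THE y. \<forall>q. unif (Sp a) q f \<longrightarrow> (\<lambda>n. zev (q n) a) \<longlonglongrightarrow> y)"

lemma norm_zev_diff_le:
  assumes sa: "star a = a"
    and "\<forall>z\<in>Sp a. dist (z * poly q z) (f z) < e" "\<forall>z\<in>Sp a. dist (z * poly r z) (f z) < e"
  shows "norm (zev q a - zev r a) \<le> 2 * e"
  unfolding zev_diff[symmetric]
proof (rule norm_zev_le[OF sa])
  fix z assume z: "z \<in> Sp a"
  have "z * poly (q - r) z = (z * poly q z - f z) - (z * poly r z - f z)"
    by (simp add: algebra_simps)
  then show "cmod (z * poly (q - r) z) \<le> 2 * e"
    using assms(2,3) z norm_triangle_ineq4[of "z * poly q z - f z" "z * poly r z - f z"]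
    by (fastforce simp: dist_norm)
qed

lemma zev_diff_tendsto_0:
  assumes sa: "star a = a" and "unif (Sp a) q f" and "unif (Sp a) r f"
  shows "(\<lambda>n. zev (q n) a - zev (r n) a) \<longlonglongrightarrow> 0"
proof (rule tendstoI)
  fix e :: real assume e: "e > 0"
  then have "\<forall>\<^sub>F n in sequentially. \<forall>z\<in>Sp a. dist (z * poly (q n) z) (f z) < e / 3"
    "\<forall>\<^sub>F n in sequentially. \<forall>z\<in>Sp a. dist (z * poly (r n) z) (f z) < e / 3"
    using uniform_limitD[OF assms(2), of "e / 3"] uniform_limitD[OF assms(3), of "e / 3"] by auto
  then show "\<forall>\<^sub>F n in sequentially. dist (zev (q n) a - zev (r n) a) 0 < e"
    by eventually_elim (use e norm_zev_diff_le[OF sa] in fastforce)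
qed

lemma convergent_zev:
  assumes sa: "star a = a" and q: "unif (Sp a) q f"
  shows "convergent (\<lambda>n. zev (q n) a)"
proof -
  have "Cauchy (\<lambda>n. zev (q n) a)"
  proof (rule CauchyI)
    fix e :: real assume e: "e > 0"
    then obtain N where N: "\<And>n. n \<ge> N \<Longrightarrow> \<forall>z\<in>Sp a. dist (z * poly (q n) z) (f z) < e / 3"
      using uniform_limitD[OF q, of "e / 3"] unfolding eventually_sequentially by auto
    have "norm (zev (q m) a - zev (q n) a) < e" if "m \<ge> N" "n \<ge> N" for m n
      using norm_zev_diff_le[OF sa N[OF that(1)] N[OF that(2)]] e by simp
    then show "\<exists>M. \<forall>m\<ge>M. \<forall>n\<ge>M. norm (zev (q m) a - zev (q n) a) < e" by blast
  qed
  then show ?thesis by (rule Cauchy_convergent)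
qed

context
  fixes a :: "'a::cstar_algebra"
  assumes sa: "star a = a"
begin

lemma weierstrass_Sp:
  assumes "c0_on (Sp a) f" obtains q where "unif (Sp a) q f"
  using weierstrass_c0[OF compact_Sp Sp_selfadjoint_real[OF sa] zero_in_Sp assms] by blast

lemma cal_tendsto:
  assumes "unif (Sp a) q f"
  shows "(\<lambda>n. zev (q n) a) \<longlonglongrightarrow> cal a f"
proof -
  obtain y where y: "(\<lambda>n. zev (q n) a) \<longlonglongrightarrow> y"
    using convergent_zev[OF sa assms] by (auto simp: convergent_def)
  have "(\<lambda>n. zev (r n) a) \<longlonglongrightarrow> y" if "unif (Sp a) r f" for r
    using tendsto_diff[OF y zev_diff_tendsto_0[OF sa assms that]] by simp
  then have "cal a f = y" unfolding cal_def
    by (intro the_equality) (use y assms LIMSEQ_unique in blast)+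
  then show ?thesis using y by simp
qed

lemma cal_eqI:
  assumes "unif (Sp a) q f" and "(\<lambda>n. zev (q n) a) \<longlonglongrightarrow> y"
  shows "cal a f = y"
  using cal_tendsto[OF assms(1)] assms(2) LIMSEQ_unique by blast

lemma cal_cong:
  assumes "\<And>z. z \<in> Sp a \<Longrightarrow> f z = g z" shows "cal a f = cal a g"
proof -
  have "unif (Sp a) q f \<longleftrightarrow> unif (Sp a) q g" for q
    by (rule uniform_limit_cong') (use assms in auto)
  then show ?thesis by (simp add: cal_def)
qed

lemma cal_poly: "cal a (\<lambda>z. z * poly q z) = zev q a"
  by (rule cal_eqI[of "\<lambda>_. q"]) (simp_all add: uniform_limit_const)

lemma cal_id: "cal a (\<lambda>z. z) = a"
  using cal_poly[of 1] by (simp add: zev_1)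

lemma bounded_image_c0: "c0_on (Sp a) f \<Longrightarrow> bounded (f ` Sp a)"
  unfolding c0_on_def by (elim conjE) (intro compact_imp_bounded compact_continuous_image compact_Sp)

lemma cal_add:
  assumes "c0_on (Sp a) f" "c0_on (Sp a) g"
  shows "cal a (\<lambda>z. f z + g z) = cal a f + cal a g"
proof -
  obtain q r where q: "unif (Sp a) q f" and r: "unif (Sp a) r g"
    using assms weierstrass_Sp by metis
  have "unif (Sp a) (\<lambda>n. q n + r n) (\<lambda>z. f z + g z)"
    using uniform_limit_add[OF q r] by (simp add: distrib_left)
  then show ?thesis
    by (rule cal_eqI) (simp add: zev_add tendsto_add cal_tendsto q r)
qed

lemma cal_mult:
  assumes "c0_on (Sp a) f" "c0_on (Sp a) g"
  shows "cal a (\<lambda>z. f z * g z) = cal a f * cal a g"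
proof -
  obtain q r where q: "unif (Sp a) q f" and r: "unif (Sp a) r g"
    using assms weierstrass_Sp by metis
  have "uniform_limit (Sp a) (\<lambda>n z. (z * poly (q n) z) * (z * poly (r n) z)) (\<lambda>z. f z * g z) sequentially"
    by (rule bounded_bilinear.bounded_uniform_limit[OF bounded_bilinear_mult q r
          bounded_image_c0[OF assms(2)] bounded_image_c0[OF assms(1)]])
  then have "unif (Sp a) (\<lambda>n. q n * pCons 0 (r n)) (\<lambda>z. f z * g z)"
    by (simp add: mult_ac)
  then show ?thesis
    by (rule cal_eqI) (simp only: zev_mult tendsto_mult cal_tendsto q r)
qed

lemma cal_cmult:
  assumes "c0_on (Sp a) f"
  shows "cal a (\<lambda>z. c * f z) = c *\<^sub>C cal a f"
proof -
  obtain q where q: "unif (Sp a) q f" using assms weierstrass_Sp by metis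
  have "unif (Sp a) (\<lambda>n. smult c (q n)) (\<lambda>z. c * f z)"
    using bounded_linear.uniform_limit[OF bounded_linear_mult_right[of c] q]
    by (simp add: mult_ac)
  then show ?thesis
    by (rule cal_eqI) (simp add: zev_smult tendsto_scaleC cal_tendsto q)
qed

lemma cal_star:
  assumes "c0_on (Sp a) f"
  shows "cal a (\<lambda>z. cnj (f z)) = star (cal a f)"
proof -
  obtain q where q: "unif (Sp a) q f" using assms weierstrass_Sp by metis
  have "uniform_limit (Sp a) (\<lambda>n z. cnj (z * poly (q n) z)) (\<lambda>z. cnj (f z)) sequentially"
    by (rule bounded_linear.uniform_limit[OF bounded_linear_cnj q])
  moreover have "cnj z = z" if "z \<in> Sp a" for z
    using Sp_selfadjoint_real[OF sa that] by (simp add: complex_eq_iff)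
  ultimately have "unif (Sp a) (\<lambda>n. map_poly cnj (q n)) (\<lambda>z. cnj (f z))"
    by (subst uniform_limit_cong'[where g = "\<lambda>n z. cnj (z * poly (q n) z)"
          and i = "\<lambda>z. cnj (f z)"]) auto
  then show ?thesis
    by (rule cal_eqI) (simp add: star_zev[OF sa, symmetric] tendsto_star cal_tendsto q)
qed

end

lemma c0_on_intros:
  "c0_on K (\<lambda>z. z)"
  "c0_on K f \<Longrightarrow> c0_on K g \<Longrightarrow> c0_on K (\<lambda>z. f z + g z)"
  "c0_on K f \<Longrightarrow> continuous_on K g \<Longrightarrow> c0_on K (\<lambda>z. f z * g z)"
  "c0_on K f \<Longrightarrow> c0_on K (\<lambda>z. c * f z)"
  "c0_on K f \<Longrightarrow> c0_on K (\<lambda>z. cnj (f z))"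
  by (auto simp: c0_on_def intro!: continuous_intros)

section \<open>Comparison with the spectrum and functional calculus of the statement\<close>

lemma invertible_emb_minus_iff:
  "invertible_el (emb a - usc c) \<longleftrightarrow>
    (\<exists>u. unitization_mult (a, - c) u = (0, 1) \<and> unitization_mult u (a, - c) = (0, 1))"
proof -
  have e: "(emb a - usc c) * Unitz b d = 1 \<longleftrightarrow> unitization_mult (a, - c) (b, d) = (0, 1)"
    "Unitz b d * (emb a - usc c) = 1 \<longleftrightarrow> unitization_mult (b, d) (a, - c) = (0, 1)" for b d
    by (auto simp: unitization_mult_def emb_def usc_def unitization_defs)
  show ?thesis unfolding invertible_el_def by (metis e surj_pair unitization.exhaust)
qed

lemma not_in_spectrum_unital:
  fixes a :: "'a::cstar_algebra"
  assumes e: "is_identity e"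
  shows "c \<notin> spectrum a \<longleftrightarrow> (\<exists>b. (a - c *\<^sub>C e) * b = e \<and> b * (a - c *\<^sub>C e) = e)"
proof -
  have u: "e' = e" if "is_identity e'" for e' using e that unfolding is_identity_def by metis
  have "\<exists>e::'a. is_identity e" using e by blast
  then have "spectrum a = {c. \<not> (\<exists>e b. is_identity e \<and> (a - c *\<^sub>C e) * b = e \<and> b * (a - c *\<^sub>C e) = e)}"
    unfolding spectrum_def by (rule if_P)
  then have "c \<notin> spectrum a \<longleftrightarrow>
      (\<exists>e b. is_identity e \<and> (a - c *\<^sub>C e) * b = e \<and> b * (a - c *\<^sub>C e) = e)"
    by simp
  also have "\<dots> \<longleftrightarrow> (\<exists>b. (a - c *\<^sub>C e) * b = e \<and> b * (a - c *\<^sub>C e) = e)"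
    using u e by blast
  finally show ?thesis .
qed

lemma Sp_nonunital:
  fixes a :: "'a::cstar_algebra"
  assumes "\<not> (\<exists>e::'a. is_identity e)"
  shows "Sp a = spectrum a"
  unfolding spectrum_def Sp_def invertible_emb_minus_iff if_not_P[OF assms] ..

lemma Sp_eq: "Sp a = insert 0 (spectrum a)" for a :: "'a::cstar_algebra"
proof (cases "\<exists>e::'a. is_identity e")
  case False
  then have "Sp a = spectrum a" by (rule Sp_nonunital)
  then show ?thesis using zero_in_Sp[of a] by auto
next
  case True
  then obtain e :: 'a where e: "is_identity e" by blast
  then have e': "e * x = x" "x * e = x" for x by (simp_all add: is_identity_def)
  have nz: "c \<in> Sp a \<longleftrightarrow> c \<in> spectrum a" if c: "c \<noteq> 0" for c
  proof -
    have "invertible_el (emb a - usc c) \<longleftrightarrow> (\<exists>b. (a - c *\<^sub>C e) * b = e \<and> b * (a - c *\<^sub>C e) = e)"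
    proof
      assume "invertible_el (emb a - usc c)"
      then obtain v where v: "(emb a - usc c) * v = 1" "v * (emb a - usc c) = 1"
        unfolding invertible_el_def by blast
      obtain b d where bd: "v = Unitz b d" by (cases v)
      have 1: "a * b - c *\<^sub>C b + d *\<^sub>C a = 0" "b * a - c *\<^sub>C b + d *\<^sub>C a = 0" "- c * d = 1"
        using v by (simp_all add: bd emb_def usc_def unitization_defs scaleC_minus_left algebra_simps)
      have cd: "c *\<^sub>C d *\<^sub>C e = - e"
        using 1(3) by (simp add: scaleC_scaleC) (metis minus_minus scaleC_minus_left scaleC_one)
      have "(a - c *\<^sub>C e) * (b + d *\<^sub>C e) = e" "(b + d *\<^sub>C e) * (a - c *\<^sub>C e) = e"
        using 1(1,2) cd
        by (simp_all add: distrib_left distrib_right left_diff_distrib right_diff_distrib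
            mult_scaleC_left mult_scaleC_right e' scaleC_scaleC mult.commute[of d c])
          (simp_all add: algebra_simps scaleC_add_right scaleC_diff_right scaleC_scaleC)
      then show "\<exists>b. (a - c *\<^sub>C e) * b = e \<and> b * (a - c *\<^sub>C e) = e" by blast
    next
      assume "\<exists>b. (a - c *\<^sub>C e) * b = e \<and> b * (a - c *\<^sub>C e) = e"
      then obtain b where b: "(a - c *\<^sub>C e) * b = e" "b * (a - c *\<^sub>C e) = e" by blast
      have "a * b = e + c *\<^sub>C b" "b * a = e + c *\<^sub>C b"
        using b by (simp_all add: left_diff_distrib right_diff_distrib mult_scaleC_left
            mult_scaleC_right e' algebra_simps)
      \<comment> \<open>This inverse is \<open>b - (1 - e) / c\<close>, because \<open>a - c\<close>
        acts as \<open>- c\<close> on the complementary idempotent \<open>1 - e\<close> of the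
        unitization.\<close>
      then have "(emb a - usc c) * Unitz (b + (1 / c) *\<^sub>C e) (- 1 / c) = 1"
        "Unitz (b + (1 / c) *\<^sub>C e) (- 1 / c) * (emb a - usc c) = 1"
        using c by (simp_all add: emb_def usc_def unitization_defs distrib_left distrib_right
            scaleC_minus_left scaleC_add_right scaleC_scaleC mult_scaleC_left mult_scaleC_right e')
      then show "invertible_el (emb a - usc c)" by (rule invertible_elI)
    qed
    then show ?thesis using not_in_spectrum_unital[OF e, of c a] by (auto simp: Sp_def)
  qed
  show ?thesis
  proof (rule set_eqI)
    fix c show "c \<in> Sp a \<longleftrightarrow> c \<in> insert 0 (spectrum a)"
      using nz[of c] by (cases "c = 0") simp_all
  qed
qed

text \<open>An approximate eigenvector u for c satisfies u \<approx> c b u, which keeps c away from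
  0. So if \<open>a\<close> is invertible, the point 0 added in \<open>Sp a\<close> is isolated, and
  continuous functions on \<open>spectrum a\<close> extend to it by 0.\<close>

lemma unital_Sp_gap:
  fixes a :: "'a::cstar_algebra"
  assumes sa: "star a = a" and e: "is_identity e" "b * a = e" and c: "c \<in> Sp a" "c \<noteq> 0"
  shows "1 \<le> cmod c * norm b"
proof -
  obtain u where u: "(\<lambda>n. norm (u n)) \<longlonglongrightarrow> 1" "(\<lambda>n. a * u n - c *\<^sub>C u n) \<longlonglongrightarrow> 0"
    using approximate_eigenvector_selfadjoint[OF sa c] by blast
  have bau: "b * (a * x) = x" for x using e by (simp add: mult.assoc[symmetric] is_identity_def)
  have "(\<lambda>n. norm (u n) - cmod c * (norm b * norm (u n))) \<longlonglongrightarrow> 1 - cmod c * (norm b * 1)"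
    by (intro tendsto_intros u)
  moreover have "(\<lambda>n. norm b * norm (a * u n - c *\<^sub>C u n)) \<longlonglongrightarrow> norm b * 0"
    by (intro tendsto_intros tendsto_norm_zero u)
  moreover have "norm (u n) - cmod c * (norm b * norm (u n)) \<le> norm b * norm (a * u n - c *\<^sub>C u n)" for n
  proof -
    have "u n = b * (a * u n - c *\<^sub>C u n) + c *\<^sub>C (b * u n)"
      by (simp add: right_diff_distrib bau mult_scaleC_right)
    then have "norm (u n) \<le> norm (b * (a * u n - c *\<^sub>C u n)) + norm (c *\<^sub>C (b * u n))"
      by (metis norm_triangle_ineq)
    also have "\<dots> \<le> norm b * norm (a * u n - c *\<^sub>C u n) + cmod c * (norm b * norm (u n))"
      unfolding norm_scaleC by (intro add_mono mult_left_mono norm_mult_ineq) auto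
    finally show ?thesis by simp
  qed
  ultimately have "1 - cmod c * (norm b * 1) \<le> norm b * 0"
    by (meson LIMSEQ_le)
  then show ?thesis by simp
qed

lemma cfc_domain_c0_on:
  fixes a :: "'a::cstar_algebra"
  assumes sa: "star a = a" and f: "f \<in> cfc_domain a"
  shows "c0_on (Sp a) (f(0 := 0))"
proof (cases "0 \<in> spectrum a")
  case True
  then have "Sp a = spectrum a" "f(0 := 0) = f" using f by (auto simp: Sp_eq cfc_domain_def)
  then show ?thesis using f True by (simp add: c0_on_def cfc_domain_def)
next
  case False
  have "\<exists>e::'a. is_identity e"
  proof (rule ccontr)
    assume "\<not> ?thesis"
    then have "Sp a = spectrum a" by (rule Sp_nonunital)
    then show False using False zero_in_Sp[of a] by simp
  qed
  then obtain e :: 'a where e: "is_identity e" by blast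
  obtain b where b: "b * a = e" using not_in_spectrum_unital[OF e, of 0 a] False by auto
  have "spectrum a = Sp a \<inter> {c. 1 \<le> cmod c * norm b}"
    using unital_Sp_gap[OF sa e b] False by (auto simp: Sp_eq)
  moreover have "closed {c::complex. 1 \<le> cmod c * norm b}"
    by (intro closed_Collect_le continuous_intros)
  ultimately have "closed (spectrum a)" by (simp add: closed_Int closed_Sp)
  moreover have "continuous_on (spectrum a) (f(0 := 0))"
    by (rule continuous_on_eq[of _ f]) (use f False in \<open>auto simp: cfc_domain_def\<close>)
  ultimately have "continuous_on ({0} \<union> spectrum a) (f(0 := 0))"
    by (intro continuous_on_closed_Un) auto
  then show ?thesis by (simp add: c0_on_def Sp_eq)
qed

lemma c0_on_cfc_domain:
  assumes "c0_on (Sp a) f" shows "f \<in> cfc_domain a"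
  using assms continuous_on_subset[of "Sp a" f "spectrum a"] Sp_eq[of a]
  by (simp add: cfc_domain_def c0_on_def subset_insertI)

text \<open>Existence of the homomorphism behind \<open>cfc\<close>. If 0 is not in
  \<open>spectrum a\<close>, a function in \<open>cfc_domain a\<close> has an arbitrary value at 0;
  the update normalizes it.\<close>

lemma is_cfc_cal:
  fixes a :: "'a::cstar_algebra"
  assumes sa: "star a = a"
  shows "is_cfc a (\<lambda>f. cal a (f(0 := 0)))"
  unfolding is_cfc_def
proof (intro conjI ballI impI allI)
  fix f g assume f: "f \<in> cfc_domain a" and g: "g \<in> cfc_domain a"
  note cf = cfc_domain_c0_on[OF sa f] and cg = cfc_domain_c0_on[OF sa g]
  show "cal a (f(0 := 0)) = cal a (g(0 := 0))" if "\<forall>z\<in>spectrum a. f z = g z"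
    by (rule cal_cong[OF sa]) (use that in \<open>auto simp: Sp_eq\<close>)
  have "(\<lambda>z. f z + g z)(0 := 0) = (\<lambda>z. (f(0 := 0)) z + (g(0 := 0)) z)"
    "(\<lambda>z. f z * g z)(0 := 0) = (\<lambda>z. (f(0 := 0)) z * (g(0 := 0)) z)" by auto
  then show "cal a ((\<lambda>z. f z + g z)(0 := 0)) = cal a (f(0 := 0)) + cal a (g(0 := 0))"
    "cal a ((\<lambda>z. f z * g z)(0 := 0)) = cal a (f(0 := 0)) * cal a (g(0 := 0))"
    by (simp_all only: cal_add[OF sa cf cg] cal_mult[OF sa cf cg])
next
  fix f c assume f: "f \<in> cfc_domain a"
  have "(\<lambda>z. c * f z)(0 := 0) = (\<lambda>z. c * (f(0 := 0)) z)" by auto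
  then show "cal a ((\<lambda>z. c * f z)(0 := 0)) = c *\<^sub>C cal a (f(0 := 0))"
    by (simp only: cal_cmult[OF sa cfc_domain_c0_on[OF sa f]])
next
  fix f assume f: "f \<in> cfc_domain a"
  have "(\<lambda>z. cnj (f z))(0 := 0) = (\<lambda>z. cnj ((f(0 := 0)) z))" by auto
  then show "cal a ((\<lambda>z. cnj (f z))(0 := 0)) = star (cal a (f(0 := 0)))"
    by (simp only: cal_star[OF sa cfc_domain_c0_on[OF sa f]])
next
  have "(\<lambda>z. z)(0 := 0) = (\<lambda>z::complex. z)" by auto
  then show "cal a ((\<lambda>z. z)(0 := 0)) = a" by (simp only: cal_id[OF sa])
qed

lemma is_cfcD:
  assumes "is_cfc a P"
  shows "f \<in> cfc_domain a \<Longrightarrow> g \<in> cfc_domain a \<Longrightarrow> (\<And>z. z \<in> spectrum a \<Longrightarrow> f z = g z) \<Longrightarrow> P f = P g"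
    and "f \<in> cfc_domain a \<Longrightarrow> g \<in> cfc_domain a \<Longrightarrow> P (\<lambda>z. f z + g z) = P f + P g"
    and "f \<in> cfc_domain a \<Longrightarrow> g \<in> cfc_domain a \<Longrightarrow> P (\<lambda>z. f z * g z) = P f * P g"
    and "f \<in> cfc_domain a \<Longrightarrow> P (\<lambda>z. c * f z) = c *\<^sub>C P f"
    and "f \<in> cfc_domain a \<Longrightarrow> P (\<lambda>z. cnj (f z)) = star (P f)"
    and "P (\<lambda>z. z) = a"
proof -
  note D = assms[unfolded is_cfc_def]
  note D1 = bspec[OF bspec[OF conjunct1[OF D]]]
  show "P f = P g" if "f \<in> cfc_domain a" "g \<in> cfc_domain a" "\<And>z. z \<in> spectrum a \<Longrightarrow> f z = g z"
    by (rule mp[OF conjunct1[OF D1[OF that(1,2)]]]) (rule ballI, rule that(3))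
  show "P (\<lambda>z. f z + g z) = P f + P g" if "f \<in> cfc_domain a" "g \<in> cfc_domain a"
    by (rule conjunct1[OF conjunct2[OF D1[OF that]]])
  show "P (\<lambda>z. f z * g z) = P f * P g" if "f \<in> cfc_domain a" "g \<in> cfc_domain a"
    by (rule conjunct2[OF conjunct2[OF D1[OF that]]])
  show "P (\<lambda>z. c * f z) = c *\<^sub>C P f" if "f \<in> cfc_domain a"
    by (rule spec[OF bspec[OF conjunct1[OF conjunct2[OF D]] that]])
  show "P (\<lambda>z. cnj (f z)) = star (P f)" if "f \<in> cfc_domain a"
    by (rule bspec[OF conjunct1[OF conjunct2[OF conjunct2[OF D]]] that])
  show "P (\<lambda>z. z) = a"
    by (rule conjunct2[OF conjunct2[OF conjunct2[OF D]]])
qed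

text \<open>\<open>is_cfc\<close> is purely algebraic. Continuity is recovered from this inclusion
  and the spectral radius formula in \<open>is_cfc_norm\<close>; uniqueness then follows from the
  density of polynomials.\<close>

lemma is_cfc_Sp:
  fixes a :: "'a::cstar_algebra"
  assumes P: "is_cfc a P" and f: "f \<in> cfc_domain a"
  shows "Sp (P f) \<subseteq> insert 0 (f ` spectrum a)"
proof
  fix m assume m: "m \<in> Sp (P f)"
  show "m \<in> insert 0 (f ` spectrum a)"
  proof (rule ccontr)
    assume no: "m \<notin> insert 0 (f ` spectrum a)"
    \<comment> \<open>Chosen so that \<open>(f - m) * (g - 1 / m) = 1\<close>, while
      \<open>g\<close> vanishes where \<open>f\<close> does and hence stays in the domain.\<close>
    define g where "g = (\<lambda>z. f z / (m * (f z - m)))"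
    have cf: "continuous_on (spectrum a) f" using f by (simp add: cfc_domain_def)
    have "m * (f z - m) \<noteq> 0" if "z \<in> spectrum a" for z using no that by auto
    then have "continuous_on (spectrum a) g" unfolding g_def
      by (intro continuous_intros cf) auto
    then have g: "g \<in> cfc_domain a" using f by (auto simp: g_def cfc_domain_def)
    have dom: "(\<lambda>z. c * f z) \<in> cfc_domain a" "(\<lambda>z. c * g z) \<in> cfc_domain a"
      "(\<lambda>z. f z * g z) \<in> cfc_domain a" "(\<lambda>z. m * g z + (1 / m) * f z) \<in> cfc_domain a"
      "(\<lambda>z. g z * f z) \<in> cfc_domain a" for c
      using f g no by (auto simp: cfc_domain_def intro!: continuous_intros)
    have e: "f z * g z = m * g z + (1 / m) * f z" if "z \<in> spectrum a" for z
    proof -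
      have "f z \<noteq> m" "m \<noteq> 0" using no that by auto
      then have "f z - m \<noteq> 0" by simp
      have "(f z - m) * g z = (1 / m) * f z"
        using \<open>f z - m \<noteq> 0\<close> \<open>m \<noteq> 0\<close> by (simp add: g_def)
      then show ?thesis by (simp add: algebra_simps)
    qed
    have s: "P (\<lambda>z. m * g z + (1 / m) * f z) = m *\<^sub>C P g + (1 / m) *\<^sub>C P f"
      by (simp only: is_cfcD(2)[OF P dom(2,1)] is_cfcD(4)[OF P f] is_cfcD(4)[OF P g])
    have fg: "P f * P g = m *\<^sub>C P g + (1 / m) *\<^sub>C P f"
      unfolding is_cfcD(3)[OF P f g, symmetric] s[symmetric]
      by (rule is_cfcD(1)[OF P dom(3,4) e])
    have gf: "P g * P f = m *\<^sub>C P g + (1 / m) *\<^sub>C P f"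
      unfolding is_cfcD(3)[OF P g f, symmetric] s[symmetric]
      by (rule is_cfcD(1)[OF P dom(5,4)]) (use e in \<open>simp add: mult.commute\<close>)
    have mm: "usc m * usc (1 / m) = 1" using no by (simp add: usc_hom(3)[symmetric])
    have "(emb (P f) - usc m) * (emb (P g) - usc (1 / m)) = emb (P f * P g) - usc m * emb (P g)
        - usc (1 / m) * emb (P f) + usc m * usc (1 / m)"
      by (simp add: emb_simps algebra_simps usc_commute[of _ "emb (P f)"])
    moreover have "(emb (P g) - usc (1 / m)) * (emb (P f) - usc m) = emb (P g * P f) - usc m * emb (P g)
        - usc (1 / m) * emb (P f) + usc m * usc (1 / m)"
      by (simp add: emb_simps algebra_simps usc_commute[of m])
    ultimately have "invertible_el (emb (P f) - usc m)"
      by (intro invertible_elI[of _ "emb (P g) - usc (1 / m)"])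
        (simp_all only: fg gf emb_simps mm, simp_all)
    then show False using m by (simp add: Sp_def)
  qed
qed

lemma is_cfc_norm:
  fixes a :: "'a::cstar_algebra"
  assumes P: "is_cfc a P" and f: "f \<in> cfc_domain a"
    and le: "\<And>z. z \<in> spectrum a \<Longrightarrow> cmod (f z) \<le> B" "B \<ge> 0"
  shows "norm (P f) \<le> B"
proof -
  have f': "(\<lambda>z. cnj (f z)) \<in> cfc_domain a" "(\<lambda>z. cnj (f z) * f z) \<in> cfc_domain a"
    using f by (auto simp: cfc_domain_def intro!: continuous_intros)
  define y where "y = P (\<lambda>z. cnj (f z) * f z)"
  have "y = P (\<lambda>z. cnj (f z)) * P f" unfolding y_def by (rule is_cfcD(3)[OF P f'(1) f])
  also have "P (\<lambda>z. cnj (f z)) = star (P f)" by (rule is_cfcD(5)[OF P f])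
  finally have y: "y = star (P f) * P f" .
  then have "star y = y" by (simp add: star_simps)
  then obtain c where c: "c \<in> Sp y" "norm y \<le> cmod c" by (rule spectral_radius_selfadjoint)
  have "cmod c \<le> B\<^sup>2"
  proof (cases "c = 0")
    case False
    then obtain z where z: "z \<in> spectrum a" "c = cnj (f z) * f z"
      using c(1) is_cfc_Sp[OF P f'(2)] unfolding y_def by auto
    have "cmod c = (cmod (f z))\<^sup>2" by (simp add: z(2) norm_mult power2_eq_square)
    then show ?thesis using le(1)[OF z(1)] by (simp add: power_mono)
  qed simp
  then have "(norm (P f))\<^sup>2 \<le> B\<^sup>2" using c(2) by (simp add: y cstar_identity)
  then show ?thesis by (rule power2_le_imp_le) (rule le(2))
qed

lemma is_cfc_poly:
  fixes a :: "'a::cstar_algebra"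
  assumes P: "is_cfc a P"
  shows "P (\<lambda>z. z * poly q z) = zev q a"
proof (induction q)
  case 0
  have id: "(\<lambda>z. z) \<in> cfc_domain a" by (auto simp: cfc_domain_def)
  then have "P (\<lambda>z. 0 * z) = 0 *\<^sub>C P (\<lambda>z. z)" by (rule is_cfcD(4)[OF P])
  then show ?case by simp
next
  case (pCons c q)
  have dom: "(\<lambda>z. z) \<in> cfc_domain a" "(\<lambda>z. c * z) \<in> cfc_domain a"
    "(\<lambda>z. z * poly q z) \<in> cfc_domain a" "(\<lambda>z. z * (z * poly q z)) \<in> cfc_domain a"
    by (auto simp: cfc_domain_def intro!: continuous_intros)
  have "P (\<lambda>z. c * z + z * (z * poly q z)) = P (\<lambda>z. c * z) + P (\<lambda>z. z * (z * poly q z))"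
    by (rule is_cfcD(2)[OF P dom(2,4)])
  also have "P (\<lambda>z. c * z) = c *\<^sub>C P (\<lambda>z. z)" by (rule is_cfcD(4)[OF P dom(1)])
  also have "P (\<lambda>z. z * (z * poly q z)) = P (\<lambda>z. z) * P (\<lambda>z. z * poly q z)"
    by (rule is_cfcD(3)[OF P dom(1,3)])
  also have "P (\<lambda>z. z) = a" by (rule is_cfcD(6)[OF P])
  finally show ?case by (simp add: pCons zev_pCons distrib_left mult.commute mult.left_commute)
qed

lemma is_cfc_eq_cal:
  fixes a :: "'a::cstar_algebra"
  assumes sa: "star a = a" and P: "is_cfc a P" and f: "c0_on (Sp a) f"
  shows "P f = cal a f"
proof -
  obtain q where q: "unif (Sp a) q f" using weierstrass_Sp[OF sa f] by blast
  have "(\<lambda>n. zev (q n) a - P f) \<longlonglongrightarrow> 0"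
  proof (rule LIMSEQ_I)
    fix e :: real assume e: "e > 0"
    then obtain N where N: "\<And>n z. n \<ge> N \<Longrightarrow> z \<in> Sp a \<Longrightarrow> dist (z * poly (q n) z) (f z) < e / 2"
      using uniform_limitD[OF q, of "e / 2"] unfolding eventually_sequentially by auto
    have "norm (zev (q n) a - P f - 0) < e" if n: "n \<ge> N" for n
    proof -
      have dom: "(\<lambda>z. z * poly (q n) z) \<in> cfc_domain a" "(\<lambda>z. (- 1) * f z) \<in> cfc_domain a"
        "(\<lambda>z. z * poly (q n) z + (- 1) * f z) \<in> cfc_domain a" "f \<in> cfc_domain a"
        using c0_on_cfc_domain[OF f] by (auto simp: cfc_domain_def intro!: continuous_intros)
      have "P (\<lambda>z. z * poly (q n) z + (- 1) * f z) = P (\<lambda>z. z * poly (q n) z) + P (\<lambda>z. (- 1) * f z)"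
        by (rule is_cfcD(2)[OF P dom(1,2)])
      also have "P (\<lambda>z. (- 1) * f z) = (- 1) *\<^sub>C P f" by (rule is_cfcD(4)[OF P dom(4)])
      finally have "zev (q n) a - P f = P (\<lambda>z. z * poly (q n) z + (- 1) * f z)"
        by (simp add: is_cfc_poly[OF P] scaleC_minus_left)
      moreover have "norm (P (\<lambda>z. z * poly (q n) z + (- 1) * f z)) \<le> e / 2"
        by (rule is_cfc_norm[OF P dom(3)])
          (use N[OF n] e in \<open>auto simp: Sp_eq dist_norm intro: less_imp_le\<close>)
      ultimately show ?thesis using e by simp
    qed
    then show "\<exists>N. \<forall>n\<ge>N. norm (zev (q n) a - P f - 0) < e" by blast
  qed
  then have "(\<lambda>n. zev (q n) a) \<longlonglongrightarrow> P f" by (simp add: LIM_zero_iff)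
  then show ?thesis using cal_tendsto[OF sa q] LIMSEQ_unique by blast
qed

theorem cfc_eq_cal:
  fixes a :: "'a::cstar_algebra"
  assumes sa: "star a = a" and f: "c0_on (Sp a) f"
  shows "cfc f a = cal a f"
  unfolding cfc_def
proof (rule the_equality)
  have "f(0 := 0) = f" using f by (auto simp: c0_on_def)
  then show "\<exists>P. is_cfc a P \<and> cal a f = P f" using is_cfc_cal[OF sa] by metis
next
  fix b assume "\<exists>P. is_cfc a P \<and> b = P f"
  then show "b = cal a f" using is_cfc_eq_cal[OF sa _ f] by blast
qed

section \<open>Norm, spectrum, composition and intertwining in the functional calculus\<close>

context
  fixes a :: "'a::cstar_algebra"
  assumes sa: "star a = a"
begin

lemma norm_cal_le:
  assumes f: "c0_on (Sp a) f" and le: "\<And>z. z \<in> Sp a \<Longrightarrow> cmod (f z) \<le> B"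
  shows "norm (cal a f) \<le> B"
proof -
  have f0: "f(0 := 0) = f" using f by (intro fun_upd_idem) (simp add: c0_on_def)
  have B: "0 \<le> B" using le[OF zero_in_Sp] norm_ge_zero order_trans by blast
  have le': "cmod (f z) \<le> B" if "z \<in> spectrum a" for z
    using le that Sp_eq[of a] by blast
  have "norm (cal a (f(0 := 0))) \<le> B"
    by (rule is_cfc_norm[OF is_cfc_cal[OF sa] c0_on_cfc_domain[OF f] le' B])
  then show ?thesis unfolding f0 .
qed

lemma Sp_cal:
  assumes f: "c0_on (Sp a) f"
  shows "Sp (cal a f) = f ` Sp a"
proof
  have f0: "f 0 = 0" using f by (simp add: c0_on_def)
  then have f1: "f(0 := 0) = f" by (rule fun_upd_idem)
  have "Sp (cal a (f(0 := 0))) \<subseteq> insert 0 (f ` spectrum a)"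
    by (rule is_cfc_Sp[OF is_cfc_cal[OF sa] c0_on_cfc_domain[OF f]])
  then have "Sp (cal a f) \<subseteq> insert 0 (f ` spectrum a)" unfolding f1 .
  also have "\<dots> = f ` Sp a" by (simp only: Sp_eq[of a] image_insert f0)
  finally show "Sp (cal a f) \<subseteq> f ` Sp a" .
next
  show "f ` Sp a \<subseteq> Sp (cal a f)"
  proof
    fix m assume "m \<in> f ` Sp a"
    then obtain z where z: "z \<in> Sp a" "m = f z" by blast
    obtain q where q: "unif (Sp a) q f" using weierstrass_Sp[OF sa f] by blast
    have lim: "(\<lambda>n. emb (zev (q n) a) - usc (z * poly (q n) z)) \<longlonglongrightarrow> emb (cal a f) - usc (f z)"
      by (intro tendsto_intros cal_tendsto[OF sa q] tendsto_uniform_limitI[OF q z(1)])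
    have noninv: "emb (zev (q n) a) - usc (z * poly (q n) z) \<in> - {u. invertible_el u}" for n
      using Sp_zev[of "q n" a] z(1) by (auto simp: Sp_def)
    have "closed (- {u :: 'a unitization. invertible_el u})"
      using open_invertible_el by (rule closed_Compl)
    then have "emb (cal a f) - usc (f z) \<in> - {u. invertible_el u}"
      using noninv lim by (rule closed_sequentially)
    then show "m \<in> Sp (cal a f)" by (simp add: Sp_def z(2))
  qed
qed

lemma zev_cal:
  assumes f: "c0_on (Sp a) f"
  shows "zev q (cal a f) = cal a (\<lambda>z. f z * poly q (f z))"
proof (induction q)
  case 0
  then show ?case using cal_poly[OF sa, of 0] by simp
next
  case (pCons c q)
  have cf: "continuous_on (Sp a) f" using f by (simp add: c0_on_def)
  have g: "c0_on (Sp a) (\<lambda>z. f z * poly q (f z))"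
    by (intro c0_on_intros f continuous_intros cf)
  have "f z * poly (pCons c q) (f z) = c * f z + f z * (f z * poly q (f z))" for z
    by (simp add: algebra_simps)
  then have "cal a (\<lambda>z. f z * poly (pCons c q) (f z))
      = cal a (\<lambda>z. c * f z + f z * (f z * poly q (f z)))" by (simp only:)
  also have "\<dots> = c *\<^sub>C cal a f + cal a f * cal a (\<lambda>z. f z * poly q (f z))"
    unfolding cal_cmult[OF sa f, symmetric] cal_mult[OF sa f g, symmetric]
    by (intro cal_add[OF sa] c0_on_intros f continuous_intros cf)
  finally show ?case by (simp add: pCons zev_pCons)
qed

text \<open>With \<open>f\<close> the square root this turns functions of the absolute values of X
  and \<open>star X\<close> into functions of \<open>h\<close> and \<open>b\<close>.\<close>

lemma cal_comp:
  assumes f: "c0_on (Sp a) f" and real: "star (cal a f) = cal a f" and g: "c0_on (Sp (cal a f)) g"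
  shows "cal (cal a f) g = cal a (\<lambda>z. g (f z))"
proof -
  obtain q where q: "unif (Sp (cal a f)) q g" using weierstrass_Sp[OF real g] by blast
  have cf: "continuous_on (Sp a) f" "f 0 = 0" using f by (simp_all add: c0_on_def)
  have gf: "c0_on (Sp a) (\<lambda>z. g (f z))"
    using g cf unfolding c0_on_def Sp_cal[OF f] by (auto intro: continuous_on_compose2)
  have "(\<lambda>n. zev (q n) (cal a f) - cal a (\<lambda>z. g (f z))) \<longlonglongrightarrow> 0"
  proof (rule LIMSEQ_I)
    fix e :: real assume e: "e > 0"
    then obtain N where N: "\<And>n z. n \<ge> N \<Longrightarrow> z \<in> Sp a \<Longrightarrow> dist (f z * poly (q n) (f z)) (g (f z)) < e / 2"
      using uniform_limitD[OF q, of "e / 2"] unfolding eventually_sequentially Sp_cal[OF f] by auto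
    have "norm (zev (q n) (cal a f) - cal a (\<lambda>z. g (f z)) - 0) < e" if n: "n \<ge> N" for n
    proof -
      have h: "c0_on (Sp a) (\<lambda>z. f z * poly (q n) (f z))" "c0_on (Sp a) (\<lambda>z. (- 1) * g (f z))"
        by (intro c0_on_intros f gf continuous_intros cf)+
      have "zev (q n) (cal a f) - cal a (\<lambda>z. g (f z))
          = cal a (\<lambda>z. f z * poly (q n) (f z) + (- 1) * g (f z))"
        unfolding cal_add[OF sa h] cal_cmult[OF sa gf] zev_cal[OF f] by (simp add: scaleC_minus_left)
      moreover have "norm (cal a (\<lambda>z. f z * poly (q n) (f z) + (- 1) * g (f z))) \<le> e / 2"
        by (intro norm_cal_le c0_on_intros(2)[OF h])
          (use N[OF n] in \<open>auto simp: dist_norm intro: less_imp_le\<close>)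
      ultimately show ?thesis using e by simp
    qed
    then show "\<exists>N. \<forall>n\<ge>N. norm (zev (q n) (cal a f) - cal a (\<lambda>z. g (f z)) - 0) < e" by blast
  qed
  then have "(\<lambda>n. zev (q n) (cal a f)) \<longlonglongrightarrow> cal a (\<lambda>z. g (f z))" by (simp add: LIM_zero_iff)
  then show ?thesis by (rule cal_eqI[OF real q])
qed

text \<open>Equal spectra let one polynomial sequence serve both calculi. The instance of interest
  is \<open>b * X = X * h\<close>.\<close>

lemma cal_intertwine:
  assumes sc: "star c = c" "Sp c = Sp a" and y: "a * y = y * c" and f: "c0_on (Sp a) f"
  shows "cal a f * y = y * cal c f"
proof -
  obtain q where q: "unif (Sp a) q f" using weierstrass_Sp[OF sa f] by blast
  then have q': "unif (Sp c) q f" by (simp add: sc)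
  have "zev p a * y = y * zev p c" for p
  proof (induction p)
    case (pCons d p)
    have "a * zev p a * y = a * y * zev p c" by (simp add: mult.assoc pCons)
    also have "\<dots> = y * (c * zev p c)" by (simp add: y mult.assoc)
    finally show ?case
      by (simp add: zev_pCons distrib_left distrib_right mult_scaleC_left mult_scaleC_right y)
  qed simp
  then have "(\<lambda>n. zev (q n) a * y) \<longlonglongrightarrow> y * cal c f"
    by (simp add: tendsto_mult_left cal_tendsto[OF sc(1) q'])
  moreover have "(\<lambda>n. zev (q n) a * y) \<longlonglongrightarrow> cal a f * y"
    by (intro tendsto_intros cal_tendsto[OF sa q])
  ultimately show ?thesis using LIMSEQ_unique by blast
qed

lemma cal_eigen:
  assumes y: "a * y = k *\<^sub>C y" and k: "k \<in> Sp a" and f: "c0_on (Sp a) f"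
  shows "cal a f * y = f k *\<^sub>C y"
proof -
  obtain q where q: "unif (Sp a) q f" using weierstrass_Sp[OF sa f] by blast
  have "zev p a * y = (k * poly p k) *\<^sub>C y" for p
  proof (induction p)
    case (pCons d p)
    have "a * zev p a * y = (k * poly p k) *\<^sub>C (a * y)"
      by (simp add: mult.assoc pCons mult_scaleC_right)
    then show ?case
      by (simp add: zev_pCons distrib_left distrib_right mult_scaleC_left y scaleC_scaleC
          scaleC_add_left mult_ac)
  qed simp
  then have "(\<lambda>n. zev (q n) a * y) \<longlonglongrightarrow> f k *\<^sub>C y"
    by (simp add: tendsto_scaleC tendsto_uniform_limitI[OF q k])
  moreover have "(\<lambda>n. zev (q n) a * y) \<longlonglongrightarrow> cal a f * y"
    by (intro tendsto_intros cal_tendsto[OF sa q])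
  ultimately show ?thesis using LIMSEQ_unique by blast
qed

lemma cal_eigen_right:
  assumes y: "y * a = k *\<^sub>C y" and k: "k \<in> Sp a" and f: "c0_on (Sp a) f"
  shows "y * cal a f = f k *\<^sub>C y"
proof -
  have k': "cnj k = k" using Sp_selfadjoint_real[OF sa k] by (simp add: complex_eq_iff)
  have "a * star y = k *\<^sub>C star y"
    using arg_cong[OF y, of star] by (simp add: star_simps sa k')
  then have "cal a (\<lambda>z. cnj (f z)) * star y = cnj (f k) *\<^sub>C star y"
    by (rule cal_eigen) (auto intro: c0_on_intros f k)
  then have "star (cal a f) * star y = cnj (f k) *\<^sub>C star y" by (simp add: cal_star[OF sa f])
  then have "star (star (cal a f) * star y) = star (cnj (f k) *\<^sub>C star y)" by simp
  then show ?thesis by (simp add: star_simps)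
qed

end

lemma cal_left_unit:
  assumes sa: "star a = a" and h: "h * a = a" and f: "c0_on (Sp a) f"
  shows "h * cal a f = cal a f"
proof -
  obtain q where q: "unif (Sp a) q f" using weierstrass_Sp[OF sa f] by blast
  have "h * zev p a = zev p a" for p
    by (induction p) (simp_all add: zev_pCons distrib_left mult_scaleC_right h mult.assoc[symmetric])
  then have "(\<lambda>n. h * zev (q n) a) \<longlonglongrightarrow> cal a f" by (simp add: cal_tendsto[OF sa q])
  moreover have "(\<lambda>n. h * zev (q n) a) \<longlonglongrightarrow> h * cal a f"
    by (intro tendsto_intros cal_tendsto[OF sa q])
  ultimately show ?thesis by (rule LIMSEQ_unique[symmetric])
qed

lemma cal_right_unit:
  assumes sa: "star a = a" and h: "a * h = a" and f: "c0_on (Sp a) f"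
  shows "cal a f * h = cal a f"
proof -
  obtain q where q: "unif (Sp a) q f" using weierstrass_Sp[OF sa f] by blast
  have "zev p a * h = zev p a" for p
    by (induction p)
      (simp_all add: zev_pCons distrib_right mult_scaleC_left h zev_commute mult.assoc)
  then have "(\<lambda>n. zev (q n) a * h) \<longlonglongrightarrow> cal a f" by (simp add: cal_tendsto[OF sa q])
  moreover have "(\<lambda>n. zev (q n) a * h) \<longlonglongrightarrow> cal a f * h"
    by (intro tendsto_intros cal_tendsto[OF sa q])
  ultimately show ?thesis by (rule LIMSEQ_unique[symmetric])
qed

lemma cal_zero: "star a = a \<Longrightarrow> cal a (\<lambda>_. 0) = 0"
  using cal_poly[of a 0] by simp

text \<open>By compactness \<open>S\<close> is a union of three disjoint closed pieces, so a
  function that is continuous on each of them is continuous on \<open>S\<close>.\<close>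

lemma c0_on_indicators:
  assumes "compact (S - {0, 1})" and "0 \<in> S" and "1 \<in> S"
  shows "c0_on S (indicator {1})" and "c0_on S (indicator (S - {0}))"
    and "continuous_on S g \<Longrightarrow> c0_on S (\<lambda>z. g z * indicator (S - {0, 1}) z)"
proof -
  let ?M = "S - {0, 1}"
  have S: "S = {0} \<union> ({1} \<union> ?M)" using assms(2,3) by auto
  have M: "closed ?M" using assms(1) by (rule compact_imp_closed)
  have *: "continuous_on S f" if "continuous_on ?M f" for f :: "complex \<Rightarrow> complex"
  proof -
    have "continuous_on ({0} \<union> ({1} \<union> ?M)) f"
      by (intro continuous_on_closed_Un closed_Un M that) auto
    then show ?thesis using S by simp
  qed
  show "c0_on S (indicator {1})"
    unfolding c0_on_def
    by (intro conjI *, rule continuous_on_eq[of _ "\<lambda>_. 0"]) (auto simp: indicator_def)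
  show "c0_on S (indicator (S - {0}))"
    unfolding c0_on_def
    by (intro conjI *, rule continuous_on_eq[of _ "\<lambda>_. 1"]) (auto simp: indicator_def)
  show "c0_on S (\<lambda>z. g z * indicator ?M z)" if g: "continuous_on S g"
  proof -
    have "continuous_on ?M g" using g by (rule continuous_on_subset) auto
    then have "continuous_on ?M (\<lambda>z. g z * indicator ?M z)"
      by (rule continuous_on_eq) (auto simp: indicator_def)
    then show ?thesis using * by (simp add: c0_on_def)
  qed
qed

section \<open>Words and the weighted shift model\<close>

text \<open>A word is a list of letters, \<open>True\<close> standing for \<open>X\<close> and \<open>False\<close> for
  its adjoint; a *-polynomial is a list of coefficients and words.\<close>

fun letter :: "'a::cstar_algebra \<Rightarrow> bool \<Rightarrow> 'a"
  where "letter X True = X" | "letter X False = star X"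

text \<open>Without a unit the empty word has no value; 0 is a placeholder, and polynomials are
  later restricted to nonempty words.\<close>

fun weval :: "'a::cstar_algebra \<Rightarrow> bool list \<Rightarrow> 'a"
  where "weval X [] = 0"
  | "weval X [l] = letter X l"
  | "weval X (l # m # w) = letter X l * weval X (m # w)"

lemma weval_Cons: "w \<noteq> [] \<Longrightarrow> weval X (l # w) = letter X l * weval X w"
  by (cases w) auto

lemma weval_append: "v \<noteq> [] \<Longrightarrow> w \<noteq> [] \<Longrightarrow> weval X (v @ w) = weval X v * weval X w"
proof (induction v)
  case (Cons l v)
  then show ?case by (cases "v = []") (simp_all add: weval_Cons mult.assoc)
qed simp

definition wdeg :: "bool list \<Rightarrow> int"
  where "wdeg w = (\<Sum>l\<leftarrow>w. if l then 1 else - 1)"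

lemma wdeg_simps [simp]:
  "wdeg [] = 0" "wdeg (l # w) = (if l then 1 else - 1) + wdeg w" "wdeg (v @ w) = wdeg v + wdeg w"
  by (simp_all add: wdeg_def)

text \<open>In the model with parameter \<open>s\<close> the letter \<open>X\<close> maps \<open>e\<^sub>n\<close> to
  \<open>step True n s\<close> times \<open>e\<^sub>n\<^sub>+\<^sub>1\<close> and its adjoint maps \<open>e\<^sub>n\<close> to
  \<open>step False n s\<close> times \<open>e\<^sub>n\<^sub>-\<^sub>1\<close>. The basis is not normalized, so that no square root
  of \<open>s\<close> occurs; \<open>s\<close> stands for a spectral value of \<open>X X\<^sup>*\<close>.\<close>

definition step :: "bool \<Rightarrow> int \<Rightarrow> complex \<Rightarrow> complex"
  where "step l n s = (if l then (if n < 0 then 0 else if n = 0 then s else 1)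
    else (if n \<le> 0 then 0 else 1))"

text \<open>The coefficient with which the word maps e_n to the basis vector of index
  \<open>n + wdeg w\<close>; the last letter of the list acts first. In contrast to
  \<open>weval\<close>, the empty word acts as the identity.\<close>

primrec wcoeff :: "bool list \<Rightarrow> int \<Rightarrow> complex \<Rightarrow> complex"
  where "wcoeff [] n s = 1"
  | "wcoeff (l # w) n s = wcoeff w n s * step l (n + wdeg w) s"

lemma wcoeff_append: "wcoeff (v @ w) n s = wcoeff w n s * wcoeff v (n + wdeg w) s"
  by (induction v) (simp_all add: algebra_simps)

text \<open>The diagonal of \<open>elt i k\<close> in the model: that of h^k for i = 0 and of
  X^(i-1) b^k (star X)^(i-1) otherwise.\<close>

definition entry :: "nat \<Rightarrow> nat \<Rightarrow> int \<Rightarrow> complex \<Rightarrow> complex"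
  where "entry i k n s = (if n < int i then 0 else if n = int i then s ^ k else 1)"

text \<open>A discrete intermediate value argument: the height changes by one per letter, so a path
  from m to a negative height has a step from 0 to -1. The sign factor treats both letters at
  once.\<close>

lemma first_return:
  assumes "m \<ge> 0" and "m + (if l then 1 else - 1) * wdeg w < 0"
  shows "\<exists>v u. w = v @ (\<not> l) # u \<and> m + (if l then 1 else - 1) * wdeg v = 0"
  using assms
proof (induction w arbitrary: m)
  case (Cons k w)
  show ?case
  proof (cases "k = (\<not> l) \<and> m = 0")
    case True
    then show ?thesis by (intro exI[of _ "[]"] exI[of _ w]) auto
  next
    case False
    define m' where "m' = m + (if l then 1 else - 1) * (if k then 1 else - 1 :: int)"
    have "m' \<ge> 0" using False Cons.prems(1) by (auto simp: m'_def)
    moreover have "m' + (if l then 1 else - 1) * wdeg w < 0"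
      using Cons.prems(2) by (auto simp: m'_def)
    ultimately obtain v u where "w = v @ (\<not> l) # u" "m' + (if l then 1 else - 1) * wdeg v = 0"
      using Cons.IH by blast
    then show ?thesis
      by (intro exI[of _ "k # v"] exI[of _ u]) (auto simp: m'_def algebra_simps)
  qed
qed simp

text \<open>As for Dyck paths, the first letter is matched with an opposite letter that brings the
  degree back to zero; depending on the first letter the path runs above or below zero.\<close>

lemma word_decomp:
  assumes "w \<noteq> []" and "wdeg w = 0"
  obtains l v u where "w = l # v @ (\<not> l) # u" and "wdeg v = 0" and "wdeg u = 0"
proof -
  obtain l w' where w: "w = l # w'" using assms(1) by (cases w) auto
  have "0 + (if l then 1 else - 1) * wdeg w' < 0" using assms(2) by (auto simp: w)
  then obtain v u where vu: "w' = v @ (\<not> l) # u" "0 + (if l then 1 else - 1) * wdeg v = 0"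
    using first_return[of 0 l w'] by auto
  have "wdeg v = 0" using vu(2) by (auto split: if_splits)
  moreover have "wdeg u = 0" using assms(2) calculation by (auto simp: w vu(1) split: if_splits)
  ultimately show thesis using that w vu(1) by simp
qed

section \<open>Scaling elements\<close>

locale scaling =
  fixes X :: "'a::cstar_algebra"
  assumes scaling: "scaling_element X"
begin

definition h :: 'a where "h = star X * X"
definition b :: 'a where "b = X * star X"
definition S :: "complex set" where "S = Sp b"

lemma hX: "h * X = X" and h_neq_b: "h \<noteq> b"
  using scaling by (auto simp: scaling_element_def h_def b_def)

lemma sa [simp]: "star h = h" "star b = b"
  by (simp_all add: h_def b_def star_simps)

lemma Xh: "star X * h = star X"
  using arg_cong[OF hX, of star] by (simp add: star_mult)

lemma hb: "h * b = b" and bh: "b * h = b"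
  using hX Xh by (simp_all add: b_def mult.assoc[symmetric]) (simp add: mult.assoc)

lemma bX: "b * X = X * h"
  by (simp add: h_def b_def mult.assoc)

lemma Xb: "star X * b = h * star X"
  by (simp add: h_def b_def mult.assoc)

lemma Sp_b [simp]: "Sp b = S" by (simp add: S_def)

lemma Sp_h [simp]: "Sp h = S"
  unfolding S_def h_def b_def by (rule Sp_commute)

lemma compact_S: "compact S" unfolding S_def by (rule compact_Sp)

lemma real_S: "s \<in> S \<Longrightarrow> Im s = 0"
  using Sp_selfadjoint_real[of b s] by simp

lemma zero_in_S [simp]: "0 \<in> S" using zero_in_Sp[of b] by simp

lemma X_neq_0: "X \<noteq> 0"
  using h_neq_b by (auto simp: h_def b_def)

lemma one_in_S [simp]: "1 \<in> S"
proof (rule ccontr)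
  assume "1 \<notin> S"
  then have "1 \<notin> Sp h" by simp
  then have "invertible_el (emb h - usc 1)" by (simp only: Sp_def mem_Collect_eq not_not)
  then obtain v where v: "v * (emb h - 1) = 1" by (auto simp: invertible_el_def)
  have "emb X = v * (emb h - 1) * emb X" by (simp add: v)
  also have "\<dots> = v * (emb (h * X) - emb X)" by (simp add: emb_simps algebra_simps)
  finally have "emb X = 0" by (simp add: hX)
  then show False using X_neq_0 by (simp add: emb_def unitization_defs)
qed

lemma h_left_h: "h * y = y \<Longrightarrow> c0_on S f \<Longrightarrow> cal h f * y = f 1 *\<^sub>C y"
  using cal_eigen[of h y 1 f] by simp

lemma h_right_h: "y * h = y \<Longrightarrow> c0_on S f \<Longrightarrow> y * cal h f = f 1 *\<^sub>C y"
  using cal_eigen_right[of h y 1 f] by simp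

lemma b_left: "h * y = y \<Longrightarrow> c0_on S f \<Longrightarrow> cal b f * (X * y) = f 1 *\<^sub>C (X * y)"
  using cal_eigen[of b "X * y" 1 f] by (simp add: mult.assoc[symmetric] bX) (simp add: mult.assoc)

lemma b_right: "y * h = y \<Longrightarrow> c0_on S f \<Longrightarrow> (y * star X) * cal b f = f 1 *\<^sub>C (y * star X)"
  using cal_eigen_right[of b "y * star X" 1 f] by (simp add: mult.assoc Xb) (simp add: mult.assoc[symmetric])

lemma cal_b_X: "c0_on S f \<Longrightarrow> cal b f * X = X * cal h f"
  using cal_intertwine[of b h X f] by (simp add: bX)

lemma h_cal_b: "c0_on S f \<Longrightarrow> h * cal b f = cal b f" "c0_on S f \<Longrightarrow> cal b f * h = cal b f"
  using cal_left_unit[of b h f] cal_right_unit[of b h f] by (simp_all add: hb bh)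

lemma X_cal_h_X: "c0_on S f \<Longrightarrow> X * cal h f * star X = cal b (\<lambda>z. f z * z)"
  using cal_mult[of b f "\<lambda>z. z"] by (simp add: cal_b_X[symmetric] c0_on_intros cal_id mult.assoc b_def[symmetric])

section \<open>Diagonal elements and their spectra\<close>

lemma Sp_conj:
  assumes "y * h = y" shows "Sp (X * y * star X) = Sp y"
  using Sp_commute[of X "y * star X"] assms by (simp add: mult.assoc h_def)

text \<open>Horner form of the sum over i < N of X^i G_i(b) (star X)^i. The nesting allows induction
  from the outermost summand.\<close>

primrec tower :: "nat \<Rightarrow> (nat \<Rightarrow> complex \<Rightarrow> complex) \<Rightarrow> 'a"
  where "tower 0 G = 0"
  | "tower (Suc N) G = cal b (G 0) + X * tower N (\<lambda>i. G (Suc i)) * star X"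

definition diagonal :: "nat \<Rightarrow> (nat \<Rightarrow> complex \<Rightarrow> complex) \<Rightarrow> 'a"
  where "diagonal N G = cal h (G 0) + tower N (\<lambda>i. G (Suc i))"

lemma h_tower:
  assumes "\<And>i. c0_on S (G i)"
  shows "h * tower N G = tower N G" and "tower N G * h = tower N G"
  using assms
proof (induction N arbitrary: G)
  case (Suc N)
  {
    case 1
    have "h * (X * y) = X * y" for y by (simp add: mult.assoc[symmetric] hX)
    then show ?case using h_cal_b(1)[OF 1] by (simp add: distrib_left mult.assoc)
  next
    case 2
    then show ?case using h_cal_b(2)[OF 2] by (simp add: distrib_right mult.assoc Xh)
  }
qed simp_all

end

text \<open>Unfolded, this is the sum of \<open>G i 1\<close> over \<open>i < min n N\<close>, plus
  \<open>G n s\<close> if \<open>n < N\<close>. For \<open>tower N G\<close> it is the diagonal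
  entry of the model at e_(n+1); for \<open>diagonal N G\<close>, taken with \<open>Suc N\<close>,
  the entry at e_n.\<close>

primrec diag_value :: "nat \<Rightarrow> (nat \<Rightarrow> complex \<Rightarrow> complex) \<Rightarrow> nat \<Rightarrow> complex \<Rightarrow> complex"
  where "diag_value 0 G n s = 0"
  | "diag_value (Suc N) G n s =
      (case n of 0 \<Rightarrow> G 0 s | Suc m \<Rightarrow> G 0 1 + diag_value N (\<lambda>i. G (Suc i)) m s)"

context scaling
begin

text \<open>As \<open>h\<close> is a unit for the inner tower T, the relation
  \<open>b * X = X * h\<close> makes \<open>cal b (G 0)\<close> act as the scalar
  \<open>G 0 1\<close> on \<open>X * T * star X\<close>. So \<open>Sp_add_subset\<close> separates
  the outer level, and the conjugation by X leaves the spectrum of T unchanged.\<close>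

lemma Sp_tower:
  assumes "\<And>i. c0_on S (G i)" and "m \<in> Sp (tower N G)"
  shows "\<exists>n. \<exists>s\<in>S. m = diag_value N G n s"
  using assms
proof (induction N arbitrary: G m)
  case 0
  then have "m = 0" using Sp_norm_le[of m "0::'a"] by simp
  then show ?case by (intro exI[of _ 0] bexI[of _ 0]) simp_all
next
  case (Suc N)
  let ?G = "\<lambda>i. G (Suc i)" and ?T = "tower N (\<lambda>i. G (Suc i))"
  note hT = h_tower[of ?G N, OF Suc.prems(1)]
  have "cal b (G 0) * (X * (?T * star X)) = G 0 1 *\<^sub>C (X * (?T * star X))"
    by (rule b_left) (simp_all add: mult.assoc[symmetric] hT Suc.prems(1))
  moreover have "(X * ?T) * star X * cal b (G 0) = G 0 1 *\<^sub>C ((X * ?T) * star X)"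
    by (rule b_right) (simp_all add: mult.assoc hT Suc.prems(1))
  ultimately have "m \<in> Sp (cal b (G 0)) \<or> m = G 0 1 \<or> m - G 0 1 \<in> Sp (X * ?T * star X)"
    using Suc.prems(2) by (intro Sp_add_subset) (simp_all add: mult.assoc)
  then consider "m \<in> Sp (cal b (G 0))" | "m = G 0 1" | "m - G 0 1 \<in> Sp ?T"
    using Sp_conj[OF hT(2)] by auto
  then show ?case
  proof cases
    case 1
    then obtain s where "s \<in> S" "m = G 0 s" using Sp_cal[of b "G 0"] Suc.prems(1) by auto
    then show ?thesis by (intro exI[of _ 0] bexI[of _ s]) auto
  next
    case 2
    then show ?thesis by (intro exI[of _ 0] bexI[of _ 1]) auto
  next
    case 3
    then obtain n s where "s \<in> S" "m - G 0 1 = diag_value N ?G n s"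
      using Suc.IH[of ?G] Suc.prems(1) by blast
    then show ?thesis by (intro exI[of _ "Suc n"] bexI[of _ s]) (auto simp: algebra_simps)
  qed
qed

lemma Sp_diagonal:
  assumes G: "\<And>i. c0_on S (G i)" and m: "m \<in> Sp (diagonal N G)"
  shows "\<exists>n. \<exists>s\<in>S. m = diag_value (Suc N) G n s"
proof -
  let ?G = "\<lambda>i. G (Suc i)" and ?T = "tower N (\<lambda>i. G (Suc i))"
  note hT = h_tower[of ?G N, OF G]
  have "m \<in> Sp (cal h (G 0)) \<or> m = G 0 1 \<or> m - G 0 1 \<in> Sp ?T"
    using m unfolding diagonal_def
    by (intro Sp_add_subset h_left_h h_right_h) (simp_all add: hT G)
  then consider "m \<in> Sp (cal h (G 0))" | "m = G 0 1" | "m - G 0 1 \<in> Sp ?T" by blast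
  then show ?thesis
  proof cases
    case 1
    then obtain s where "s \<in> S" "m = G 0 s" using Sp_cal[of h "G 0"] G by auto
    then show ?thesis by (intro exI[of _ 0] bexI[of _ s]) auto
  next
    case 2
    then show ?thesis by (intro exI[of _ 0] bexI[of _ 1]) auto
  next
    case 3
    then obtain n s where "s \<in> S" "m - G 0 1 = diag_value N ?G n s"
      using Sp_tower[of ?G] G by blast
    then show ?thesis by (intro exI[of _ "Suc n"] bexI[of _ s]) (auto simp: algebra_simps)
  qed
qed

text \<open>The condition of non-properness, in terms of \<open>X\<^sup>* X\<close> and \<open>X X\<^sup>*\<close>
  instead of their square roots.\<close>

definition degenerate :: bool
  where "degenerate \<longleftrightarrow> compact (S - {0, 1}) \<and>
    cal h (indicator {1}) = cal b (indicator (S - {0}))"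

end

section \<open>Degenerate scaling elements: diagonal elements without contribution of the
  shift\<close>

locale degenerate_scaling = scaling +
  assumes degenerate: degenerate
begin

lemma compact_M: "compact (S - {0, 1})" and e_eq_q: "cal h (indicator {1}) = cal b (indicator (S - {0}))"
  using degenerate by (simp_all add: degenerate_def)

lemmas c0_indicators = c0_on_indicators[OF compact_M zero_in_S one_in_S]

definition q :: 'a where "q = cal b (indicator (S - {0}))"

lemma M_nonempty: "S - {0, 1} \<noteq> {}"
proof
  assume "S - {0, 1} = {}"
  then have S: "S \<subseteq> {0, 1}" by blast
  have "cal h (indicator {1}) = cal h (\<lambda>z. z)" "cal b (indicator (S - {0})) = cal b (\<lambda>z. z)"
    by (rule cal_cong; use S in \<open>force simp: indicator_def\<close>)+
  then have "h = b" using e_eq_q by (simp add: cal_id)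
  then show False using h_neq_b by simp
qed

lemma h_q: "h * q = q" "q * h = q"
  unfolding q_def by (rule h_cal_b, rule c0_indicators)+

text \<open>Degeneracy enters here: \<open>q\<close> is defined by \<open>b\<close> but is also the
  spectral projection of \<open>h\<close> at 1, so conjugation by X turns it into the spectral
  projection of \<open>b\<close> at 1.\<close>

lemma X_q_X: "X * q * star X = cal b (indicator {1})"
proof -
  have "X * q * star X = cal b (\<lambda>z. indicator {1} z * z)"
    unfolding q_def e_eq_q[symmetric] by (rule X_cal_h_X[OF c0_indicators(1)])
  also have "\<dots> = cal b (indicator {1})" by (rule cal_cong) (auto simp: indicator_def)
  finally show ?thesis .
qed

text \<open>The multiple of \<open>q\<close> carries the contributions \<open>G i 1\<close> of the
  levels already removed. By \<open>X_q_X\<close> the part of the current level at s = 1 moves into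
  the next level as a multiple of \<open>q\<close>. What stays behind is a function of
  \<open>b\<close> supported on \<open>S - {0, 1}\<close>, so only such s occur. The value 0 is
  excluded because it lies in every \<open>Sp\<close>.\<close>

lemma Sp_tower_degenerate:
  assumes "\<And>i. c0_on S (G i)" and "m \<in> Sp (\<alpha> *\<^sub>C q + tower N G)" and "m \<noteq> 0"
  shows "\<exists>n. \<exists>s\<in>S - {0, 1}. m = \<alpha> + diag_value N G n s"
  using assms
proof (induction N arbitrary: G m \<alpha>)
  case 0
  have "\<alpha> *\<^sub>C q = cal b (\<lambda>z. \<alpha> * indicator (S - {0}) z)"
    unfolding q_def by (rule cal_cmult[symmetric]) (simp_all add: c0_indicators)
  then have "Sp (\<alpha> *\<^sub>C q) = (\<lambda>z. \<alpha> * indicator (S - {0}) z) ` S"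
    using Sp_cal[of b "\<lambda>z. \<alpha> * indicator (S - {0}) z"] by (simp add: c0_indicators c0_on_intros)
  then have "m = \<alpha>" using 0 by (auto simp: indicator_def split: if_splits)
  then show ?case using M_nonempty by auto
next
  case (Suc N)
  let ?M = "S - {0, 1}"
  let ?G = "\<lambda>i. G (Suc i)" and ?T = "tower N (\<lambda>i. G (Suc i))"
  define \<beta> where "\<beta> = \<alpha> + G 0 1"
  define y where "y = \<beta> *\<^sub>C q + ?T"
  define f where "f = (\<lambda>z. (\<alpha> + G 0 z) * indicator ?M z)"
  have G0: "continuous_on S (G 0)" "G 0 0 = 0" using Suc.prems(1) by (auto simp: c0_on_def)
  have f: "c0_on S f" unfolding f_def by (rule c0_indicators) (intro continuous_intros G0)
  have f1: "f 1 = 0" by (simp add: f_def)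
  note hT = h_tower[of ?G N, OF Suc.prems(1)]
  have hy: "h * y = y" "y * h = y"
    by (simp_all add: y_def distrib_left distrib_right mult_scaleC_left mult_scaleC_right h_q hT)
  have "\<alpha> *\<^sub>C q + cal b (G 0) = cal b (\<lambda>z. \<alpha> * indicator (S - {0}) z + G 0 z)"
    by (simp add: cal_add cal_cmult c0_on_intros c0_indicators Suc.prems(1) q_def)
  also have "\<dots> = cal b (\<lambda>z. f z + \<beta> * indicator {1} z)"
    by (rule cal_cong) (auto simp: f_def \<beta>_def indicator_def G0)
  also have "\<dots> = cal b f + \<beta> *\<^sub>C (X * q * star X)"
    by (simp add: cal_add cal_cmult c0_on_intros c0_indicators f X_q_X)
  finally have e: "\<alpha> *\<^sub>C q + tower (Suc N) G = cal b f + X * y * star X"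
    by (simp add: y_def distrib_left distrib_right mult_scaleC_left mult_scaleC_right
        add.assoc[symmetric])
  have "cal b f * (X * (y * star X)) = f 1 *\<^sub>C (X * (y * star X))"
    by (rule b_left) (simp_all add: mult.assoc[symmetric] hy f)
  moreover have "(X * y) * star X * cal b f = f 1 *\<^sub>C ((X * y) * star X)"
    by (rule b_right) (simp_all add: mult.assoc hy f)
  ultimately have "m \<in> Sp (cal b f) \<or> m = 0 \<or> m - 0 \<in> Sp (X * y * star X)"
    using Suc.prems(2) unfolding e by (intro Sp_add_subset) (simp_all add: mult.assoc f1)
  then consider "m \<in> Sp (cal b f)" | "m \<in> Sp y"
    using Suc.prems(3) Sp_conj[OF hy(2)] by auto
  then show ?case
  proof cases
    case 1
    then obtain s where "s \<in> S" "m = f s" using Sp_cal[of b f] f by auto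
    then have "s \<in> ?M" "m = \<alpha> + G 0 s"
      using Suc.prems(3) by (auto simp: f_def indicator_def split: if_splits)
    then show ?thesis by (intro exI[of _ 0] bexI[of _ s]) auto
  next
    case 2
    then obtain n s where "s \<in> ?M" "m = \<beta> + diag_value N ?G n s"
      using Suc.IH[of ?G m \<beta>] Suc.prems(1,3) unfolding y_def by blast
    then show ?thesis by (intro exI[of _ "Suc n"] bexI[of _ s]) (auto simp: \<beta>_def)
  qed
qed

lemma Sp_diagonal_degenerate:
  assumes G: "\<And>i. c0_on S (G i)" and m: "m \<in> Sp (diagonal N G)" "m \<noteq> 0"
  shows "\<exists>n. \<exists>s\<in>S - {0, 1}. m = diag_value (Suc N) G n s"
proof -
  let ?M = "S - {0, 1}"
  let ?G = "\<lambda>i. G (Suc i)" and ?T = "tower N (\<lambda>i. G (Suc i))"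
  note hT = h_tower[of ?G N, OF G]
  define y where "y = G 0 1 *\<^sub>C q + ?T"
  define f where "f = (\<lambda>z. G 0 z * indicator ?M z)"
  have G0: "continuous_on S (G 0)" "G 0 0 = 0" using G by (auto simp: c0_on_def)
  have f: "c0_on S f" unfolding f_def by (rule c0_indicators) (intro G0)
  have f1: "f 1 = 0" by (simp add: f_def)
  have hy: "h * y = y" "y * h = y"
    by (simp_all add: y_def distrib_left distrib_right mult_scaleC_left mult_scaleC_right h_q hT)
  have "cal h (G 0) = cal h (\<lambda>z. f z + G 0 1 * indicator {1} z)"
    by (rule cal_cong) (auto simp: f_def indicator_def G0)
  also have "\<dots> = cal h f + G 0 1 *\<^sub>C q"
    by (simp add: cal_add cal_cmult c0_on_intros c0_indicators f e_eq_q q_def)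
  finally have e: "diagonal N G = cal h f + y" by (simp add: diagonal_def y_def add.assoc)
  have "m \<in> Sp (cal h f) \<or> m = 0 \<or> m - 0 \<in> Sp y"
    using m(1) unfolding e f1[symmetric] by (intro Sp_add_subset h_left_h h_right_h hy f)
  then consider "m \<in> Sp (cal h f)" | "m \<in> Sp y" using m(2) by auto
  then show ?thesis
  proof cases
    case 1
    then obtain s where "s \<in> S" "m = f s" using Sp_cal[of h f] f by auto
    then have "s \<in> ?M" "m = G 0 s"
      using m(2) by (auto simp: f_def indicator_def split: if_splits)
    then show ?thesis by (intro exI[of _ 0] bexI[of _ s]) auto
  next
    case 2
    then obtain n s where "s \<in> ?M" "m = G 0 1 + diag_value N ?G n s"
      using Sp_tower_degenerate[of ?G m "G 0 1"] G m(2) unfolding y_def by blast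
    then show ?thesis by (intro exI[of _ "Suc n"] bexI[of _ s]) auto
  qed
qed

end

section \<open>The *-polynomials of degree zero\<close>

type_synonym starpoly = "(complex \<times> bool list) list"

definition peval :: "'a::cstar_algebra \<Rightarrow> starpoly \<Rightarrow> 'a"
  where "peval X P = (\<Sum>(c, w)\<leftarrow>P. c *\<^sub>C weval X w)"

definition pcoeff :: "starpoly \<Rightarrow> int \<Rightarrow> complex \<Rightarrow> complex"
  where "pcoeff P n s = (\<Sum>(c, w)\<leftarrow>P. c * wcoeff w n s)"

lemma peval_simps [simp]:
  "peval X [] = 0" "peval X ((c, w) # P) = c *\<^sub>C weval X w + peval X P"
  "peval X (P @ Q) = peval X P + peval X Q"
  by (simp_all add: peval_def)

lemma pcoeff_simps [simp]:
  "pcoeff [] n s = 0" "pcoeff ((c, w) # P) n s = c * wcoeff w n s + pcoeff P n s"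
  "pcoeff (P @ Q) n s = pcoeff P n s + pcoeff Q n s"
  by (simp_all add: pcoeff_def)

lemma c0_on_power: "0 < k \<Longrightarrow> c0_on K (\<lambda>z. z ^ k)"
  by (auto simp: c0_on_def intro!: continuous_intros)

context scaling
begin

text \<open>With k > 0 these are all the values of nonempty words of degree zero, see
  \<open>word_normal_form\<close>.\<close>

fun elt :: "nat \<Rightarrow> nat \<Rightarrow> 'a"
  where "elt 0 k = cal h (\<lambda>z. z ^ k)"
  | "elt (Suc 0) k = cal b (\<lambda>z. z ^ k)"
  | "elt (Suc (Suc i)) k = X * elt (Suc i) k * star X"

lemma h_elt:
  assumes "0 < k" shows "h * elt (Suc i) k = elt (Suc i) k" "elt (Suc i) k * h = elt (Suc i) k"
proof -
  have "h * (X * y) = X * y" for y by (simp add: mult.assoc[symmetric] hX)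
  then show "h * elt (Suc i) k = elt (Suc i) k"
    by (cases i) (simp_all add: h_cal_b(1) c0_on_power assms mult.assoc)
  show "elt (Suc i) k * h = elt (Suc i) k"
    by (cases i) (simp_all add: h_cal_b(2) c0_on_power assms mult.assoc Xh)
qed

lemma elt_basic: "elt (Suc 0) 1 = b" "elt 0 1 = h"
  by (simp_all add: cal_id)

lemma X_elt_X:
  assumes "0 < k"
  shows "X * elt i k * star X = (if i = 0 then elt 1 (Suc k) else elt (Suc i) k)"
  by (cases i) (simp_all add: X_cal_h_X c0_on_power assms mult.commute)

text \<open>For i = 0 the exponent is lost, because \<open>h * X = X\<close>; for i = 1 a power of
  \<open>b\<close> becomes a power of \<open>h\<close>; beyond that one layer is removed, since
  \<open>h\<close> is a unit for what is inside.\<close>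

lemma star_X_elt_X:
  assumes "0 < k"
  shows "star X * elt i k * X
    = (if i = 0 then elt 0 1 else if i = 1 then elt 0 (Suc k) else elt (i - 1) k)"
proof -
  consider "i = 0" | "i = 1" | j where "i = Suc (Suc j)" by (metis One_nat_def not0_implies_Suc)
  then show ?thesis
  proof cases
    case 1
    have "cal h (\<lambda>z. z ^ k) * X = X" using h_left_h[OF hX c0_on_power[OF assms]] by simp
    then show ?thesis using 1 by (simp add: mult.assoc h_def[symmetric] cal_id)
  next
    case 2
    have "star X * elt i k * X = h * cal h (\<lambda>z. z ^ k)"
      using 2 by (simp add: mult.assoc cal_b_X c0_on_power assms h_def)
    also have "\<dots> = cal h (\<lambda>z. z * z ^ k)"
      using cal_mult[of h "\<lambda>z. z" "\<lambda>z. z ^ k"] by (simp add: cal_id c0_on_intros c0_on_power assms)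
    finally show ?thesis using 2 by simp
  next
    case 3
    have "star X * elt i k * X = h * elt (Suc j) k * h" using 3 by (simp add: h_def mult.assoc)
    then show ?thesis using 3 h_elt[OF assms, of j] by simp
  qed
qed

text \<open>In the model \<open>elt i k\<close> is the identity on all levels above i, and
  \<open>elt j l\<close> lives on the levels from j on. In the algebra this is the relation
  \<open>h * X = X\<close>, propagated by conjugation with X.\<close>

lemma elt_mult_less:
  assumes k: "0 < k" and l: "0 < l" and "i < j"
  shows "elt i k * elt j l = elt j l \<and> elt j l * elt i k = elt j l"
  using assms(3)
proof (induction i arbitrary: j)
  case 0
  then obtain j' where j: "j = Suc j'" by (cases j) auto
  show ?case unfolding j
    using h_left_h[OF h_elt(1)[OF l, of j'] c0_on_power[OF k]]
      h_right_h[OF h_elt(2)[OF l, of j'] c0_on_power[OF k]] by simp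
next
  case (Suc i)
  then obtain j' where j: "j = Suc (Suc j')" by (metis Suc_lessE less_imp_Suc_add)
  let ?y = "elt (Suc j') l"
  note hy = h_elt[OF l, of j']
  show ?case
  proof (cases i)
    case 0
    have "cal b (\<lambda>z. z ^ k) * (X * (?y * star X)) = X * (?y * star X)"
      using b_left[of "?y * star X" "\<lambda>z. z ^ k"] hy c0_on_power[OF k]
      by (simp add: mult.assoc[symmetric])
    moreover have "(X * ?y) * star X * cal b (\<lambda>z. z ^ k) = (X * ?y) * star X"
      using b_right[of "X * ?y" "\<lambda>z. z ^ k"] hy c0_on_power[OF k] by (simp add: mult.assoc)
    ultimately show ?thesis unfolding 0 j by (simp add: mult.assoc)
  next
    case (Suc i')
    let ?x = "elt (Suc i') k"
    have IH: "?x * ?y = ?y" "?y * ?x = ?y" using Suc.IH[of "Suc j'"] Suc.prems Suc j by auto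
    have "(X * ?x * star X) * (X * ?y * star X) = X * (?x * (h * ?y)) * star X"
      by (simp add: h_def mult.assoc)
    moreover have "(X * ?y * star X) * (X * ?x * star X) = X * (?y * (h * ?x)) * star X"
      by (simp add: h_def mult.assoc)
    ultimately show ?thesis unfolding Suc j
      by (simp add: hy h_elt[OF k, of i'] IH)
  qed
qed

lemma elt_mult_same:
  assumes k: "0 < k" and l: "0 < l"
  shows "elt i k * elt i l = elt i (k + l)"
proof (induction i rule: nat_induct)
  case 0
  show ?case
    using cal_mult[of h "\<lambda>z. z ^ k" "\<lambda>z. z ^ l"] by (simp add: c0_on_power k l power_add)
next
  case (Suc i)
  show ?case
  proof (cases i)
    case 0
    then show ?thesis
      using cal_mult[of b "\<lambda>z. z ^ k" "\<lambda>z. z ^ l"] by (simp add: c0_on_power k l power_add)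
  next
    case (Suc i')
    have "elt (Suc i) k * elt (Suc i) l = X * (elt i k * (h * elt i l)) * star X"
      using Suc by (simp add: h_def mult.assoc)
    then show ?thesis using Suc Suc.IH h_elt[OF l, of i'] by simp
  qed
qed

text \<open>Words of degree zero are built from the empty word by concatenation and by enclosing a
  word between a letter and its adjoint, and the elements \<open>elt i k\<close> are stable under both.\<close>

lemma word_normal_form:
  assumes "w \<noteq> []" and "wdeg w = 0"
  shows "\<exists>i k. 0 < k \<and> i \<le> length w \<and> weval X w = elt i k \<and> (\<forall>n s. wcoeff w n s = entry i k n s)"
  using assms
proof (induction "length w" arbitrary: w rule: less_induct)
  case less
  obtain l v u where w: "w = l # v @ (\<not> l) # u" and vu: "wdeg v = 0" "wdeg u = 0"
    using word_decomp[OF less.prems] by blast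
  define p where "p = l # v @ [\<not> l]"
  have p: "\<exists>i k. 0 < k \<and> i \<le> length p \<and> weval X p = elt i k \<and> (\<forall>n s. wcoeff p n s = entry i k n s)"
  proof (cases "v = []")
    case True
    show ?thesis
    proof (cases l)
      case l: True
      show ?thesis unfolding p_def True using l
        by (intro exI[of _ 1] exI[of _ 1])
          (auto simp: elt_basic b_def[symmetric] step_def entry_def cal_id)
    next
      case l: False
      show ?thesis unfolding p_def True using l
        by (intro exI[of _ 0] exI[of _ 1])
          (auto simp: elt_basic h_def[symmetric] step_def entry_def cal_id)
    qed
  next
    case False
    have "length v < length w" by (simp add: w)
    then obtain i k where ik: "0 < k" "i \<le> length v" "weval X v = elt i k"
      "\<And>n s. wcoeff v n s = entry i k n s" using less.hyps[OF _ False vu(1)] by blast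
    have ev: "weval X p = letter X l * elt i k * letter X (\<not> l)"
      using False by (simp add: p_def weval_Cons weval_append ik(3) mult.assoc)
    have wc: "wcoeff p n s = step (\<not> l) n s * entry i k (n + (if l then - 1 else 1)) s
        * step l (n + (if l then - 1 else 1)) s" for n s
      by (simp add: p_def wcoeff_append ik(4) vu(1))
    have lp: "length p = length v + 2" by (simp add: p_def)
    show ?thesis
    proof (cases l)
      case l: True
      show ?thesis
      proof (cases "i = 0")
        case True
        show ?thesis
          by (intro exI[of _ 1] exI[of _ "Suc k"])
            (use l True lp X_elt_X[OF ik(1), of i] in \<open>auto simp: ev wc step_def entry_def\<close>)
      next
        case False
        show ?thesis
          by (intro exI[of _ "Suc i"] exI[of _ k])
            (use ik(1,2) l False X_elt_X[OF ik(1), of i] lp in \<open>auto simp: ev wc step_def entry_def\<close>)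
      qed
    next
      case l: False
      consider "i = 0" | "i = 1" | j where "i = Suc (Suc j)" by (metis One_nat_def not0_implies_Suc)
      then show ?thesis
      proof cases
        case 1
        show ?thesis
          by (intro exI[of _ 0] exI[of _ 1])
            (use l 1 star_X_elt_X[OF ik(1), of i] in \<open>auto simp: ev wc step_def entry_def\<close>)
      next
        case 2
        show ?thesis
          by (intro exI[of _ 0] exI[of _ "Suc k"])
            (use l 2 star_X_elt_X[OF ik(1), of i] in \<open>auto simp: ev wc step_def entry_def\<close>)
      next
        case 3
        show ?thesis
          by (intro exI[of _ "Suc j"] exI[of _ k])
            (use l 3 ik(1,2) star_X_elt_X[OF ik(1), of i] lp in \<open>auto simp: ev wc step_def entry_def\<close>)
      qed
    qed
  qed
  have pw: "w = p @ u" by (simp add: w p_def)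
  have dp: "wdeg p = 0" using vu(1) by (simp add: p_def)
  show ?case
  proof (cases "u = []")
    case True
    then show ?thesis using p pw by simp
  next
    case False
    have "length u < length w" by (simp add: w)
    then obtain j m where jm: "0 < m" "j \<le> length u" "weval X u = elt j m"
      "\<And>n s. wcoeff u n s = entry j m n s" using less.hyps[OF _ False vu(2)] by blast
    obtain i k where ik: "0 < k" "i \<le> length p" "weval X p = elt i k"
      "\<And>n s. wcoeff p n s = entry i k n s" using p by blast
    have "p \<noteq> []" by (simp add: p_def)
    then have ev: "weval X w = elt i k * elt j m"
      using False by (simp add: pw weval_append ik(3) jm(3))
    have wc: "wcoeff w n s = entry j m n s * entry i k n s" for n s
      by (simp add: pw wcoeff_append vu(2) ik(4) jm(4))
    consider "i < j" | "j < i" | "i = j" by linarith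
    then show ?thesis
    proof cases
      case 1
      then have "\<forall>n s. wcoeff w n s = entry j m n s" by (auto simp: wc entry_def)
      then show ?thesis using elt_mult_less[OF ik(1) jm(1) 1] jm ev pw
        by (intro exI[of _ j] exI[of _ m]) auto
    next
      case 2
      then have "\<forall>n s. wcoeff w n s = entry i k n s" by (auto simp: wc entry_def)
      then show ?thesis using elt_mult_less[OF jm(1) ik(1) 2] ik ev pw
        by (intro exI[of _ i] exI[of _ k]) auto
    next
      case 3
      then have "\<forall>n s. wcoeff w n s = entry i (k + m) n s" by (auto simp: wc entry_def power_add)
      then show ?thesis using elt_mult_same[OF ik(1) jm(1), of i] ik ev pw 3
        by (intro exI[of _ i] exI[of _ "k + m"]) auto
    qed
  qed
qed

lemma tower_zero: "tower N (\<lambda>i z. 0) = 0"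
  by (induction N) (simp_all add: cal_zero)

lemma tower_add:
  assumes "\<And>i. c0_on S (G i)" "\<And>i. c0_on S (H i)"
  shows "tower N (\<lambda>i z. G i z + H i z) = tower N G + tower N H"
  using assms
proof (induction N arbitrary: G H)
  case (Suc N)
  have "tower N (\<lambda>i z. G (Suc i) z + H (Suc i) z) = tower N (\<lambda>i. G (Suc i)) + tower N (\<lambda>i. H (Suc i))"
    by (rule Suc.IH) (use Suc.prems in auto)
  then show ?case using Suc.prems by (simp add: cal_add algebra_simps)
qed simp

lemma tower_single:
  assumes "0 < k" "i < N"
  shows "tower N (\<lambda>j z. if j = i then c * z ^ k else 0) = c *\<^sub>C elt (Suc i) k"
  using assms(2)
proof (induction N arbitrary: i)
  case (Suc N)
  show ?case
  proof (cases i)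
    case 0
    then show ?thesis by (simp add: tower_zero cal_cmult c0_on_power assms(1))
  next
    case (Suc i')
    have "tower N (\<lambda>j z. if Suc j = i then c * z ^ k else 0) = c *\<^sub>C elt i k"
      using Suc.IH[of i'] Suc.prems Suc by simp
    then show ?thesis using Suc by (simp add: cal_zero mult_scaleC_left mult_scaleC_right)
  qed
qed simp

end

lemma diag_value_zero: "diag_value N (\<lambda>i z. 0) n s = 0"
  by (induction N arbitrary: n) (auto split: nat.split)

lemma diag_value_add:
  "diag_value N (\<lambda>i z. G i z + H i z) n s = diag_value N G n s + diag_value N H n s"
  by (induction N arbitrary: G H n) (auto split: nat.split)

lemma diag_value_single:
  assumes "i < N"
  shows "diag_value N (\<lambda>j z. if j = i then c * z ^ k else 0) n s = c * entry i k (int n) s"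
  using assms
proof (induction N arbitrary: i n)
  case (Suc N)
  show ?case
  proof (cases i)
    case 0
    then show ?thesis by (auto simp: diag_value_zero entry_def split: nat.split)
  next
    case (Suc i')
    have "diag_value N (\<lambda>j z. if Suc j = i then c * z ^ k else 0) m s = c * entry i' k (int m) s" for m
      using Suc.IH[of i' m] Suc.prems Suc by simp
    then show ?thesis using Suc by (auto simp: entry_def split: nat.split)
  qed
qed simp

context scaling
begin

text \<open>One family \<open>G\<close> describes both the element of the algebra and the diagonal
  of the model. This turns the spectral inclusions for \<open>diagonal N G\<close> into bounds by
  \<open>pcoeff\<close>.\<close>

lemma degree_zero_diagonal:
  assumes "\<And>c w. (c, w) \<in> set R \<Longrightarrow> w \<noteq> [] \<and> wdeg w = 0 \<and> length w \<le> N"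
  shows "\<exists>G. (\<forall>i. c0_on S (G i)) \<and> peval X R = diagonal N G
    \<and> (\<forall>n s. pcoeff R (int n) s = diag_value (Suc N) G n s)"
  using assms
proof (induction R)
  case Nil
  show ?case
    by (rule exI[of _ "\<lambda>i z. 0"])
      (simp add: diagonal_def tower_zero cal_zero diag_value_zero c0_on_def del: diag_value.simps)
next
  case (Cons t R)
  obtain c w where t: "t = (c, w)" by (cases t)
  obtain G where G: "\<And>i. c0_on S (G i)" "peval X R = diagonal N G"
    "\<And>n s. pcoeff R (int n) s = diag_value (Suc N) G n s" using Cons by auto
  have w: "w \<noteq> []" "wdeg w = 0" "length w \<le> N" using Cons.prems[of c w] by (auto simp: t)
  then obtain i k where ik: "0 < k" "i \<le> length w" "weval X w = elt i k"
    "\<And>n s. wcoeff w n s = entry i k n s" using word_normal_form by blast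
  define H where "H = (\<lambda>j (z::complex). if j = i then c * z ^ k else 0)"
  have H: "c0_on S (H j)" for j
    using ik(1) by (auto simp: H_def c0_on_def intro!: continuous_intros)
  have "diagonal N H = c *\<^sub>C elt i k"
  proof (cases i)
    case 0
    then show ?thesis by (simp add: diagonal_def H_def tower_zero cal_cmult c0_on_power ik(1))
  next
    case (Suc i')
    have "tower N (\<lambda>j. H (Suc j)) = c *\<^sub>C elt i k"
      using tower_single[OF ik(1), of i' N c] w(3) ik(2) Suc by (simp add: H_def)
    then show ?thesis using Suc by (simp add: diagonal_def H_def cal_zero)
  qed
  moreover have "diagonal N (\<lambda>j z. H j z + G j z) = diagonal N H + diagonal N G"
    unfolding diagonal_def by (simp add: tower_add cal_add G(1) H algebra_simps)
  moreover have "diag_value (Suc N) H n s = c * entry i k (int n) s" for n s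
    unfolding H_def by (rule diag_value_single) (use ik(2) w(3) in auto)
  ultimately show ?case
    using G H ik by (intro exI[of _ "\<lambda>j z. H j z + G j z"])
      (simp add: t diag_value_add c0_on_intros(2) del: diag_value.simps)
qed

lemma degree_zero_bound:
  assumes R: "\<And>c w. (c, w) \<in> set R \<Longrightarrow> w \<noteq> [] \<and> wdeg w = 0"
    and self: "star (peval X R) = peval X R" and B: "B \<ge> 0"
    and le: "\<And>n s. s \<in> S \<Longrightarrow> (degenerate \<Longrightarrow> s \<notin> {0, 1}) \<Longrightarrow> cmod (pcoeff R (int n) s) \<le> B"
  shows "norm (peval X R) \<le> B"
proof -
  define N where "N = Max (insert 0 ((\<lambda>(c, w). length w) ` set R))"
  have "length w \<le> N" if "(c, w) \<in> set R" for c w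
    unfolding N_def by (rule Max_ge) (use that in force)+
  then obtain G where G: "\<And>i. c0_on S (G i)" "peval X R = diagonal N G"
    "\<And>n s. pcoeff R (int n) s = diag_value (Suc N) G n s"
    using degree_zero_diagonal[of R N] R by blast
  obtain m where m: "m \<in> Sp (diagonal N G)" "norm (peval X R) \<le> cmod m"
    using spectral_radius_selfadjoint[OF self] G(2) by metis
  have "cmod m \<le> B"
  proof (cases "m = 0 \<or> \<not> degenerate")
    case True
    then show ?thesis
    proof
      assume "\<not> degenerate"
      obtain n s where "s \<in> S" "m = diag_value (Suc N) G n s" using Sp_diagonal[OF G(1) m(1)] by blast
      then show ?thesis using le[of s n] \<open>\<not> degenerate\<close> by (simp add: G(3))
    qed (use B in simp)
  next
    case False
    then interpret degenerate_scaling X by unfold_locales simp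
    obtain n s where "s \<in> S - {0, 1}" "m = diag_value (Suc N) G n s"
      using Sp_diagonal_degenerate[OF G(1) m(1)] False by blast
    then show ?thesis using le[of s n] by (simp add: G(3))
  qed
  then show ?thesis using m(2) by simp
qed

end

section \<open>Asymptotic copies of the model inside the algebra\<close>

lemma Bseq_mult_null:
  fixes f g :: "nat \<Rightarrow> 'a::cstar_algebra"
  assumes "Bseq f" and "g \<longlonglongrightarrow> 0"
  shows "(\<lambda>i. f i * g i) \<longlonglongrightarrow> 0" and "(\<lambda>i. star (f i) * g i) \<longlonglongrightarrow> 0"
    and "(\<lambda>i. star (g i) * f i) \<longlonglongrightarrow> 0"
proof -
  obtain K where K: "\<And>i. norm (f i) \<le> K" using assms(1) by (auto simp: Bseq_def)
  have lim: "(\<lambda>i. K * norm (g i)) \<longlonglongrightarrow> 0"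
    using tendsto_mult[OF tendsto_const tendsto_norm_zero[OF assms(2)], of K] by simp
  have le: "norm u * norm (g i) \<le> K * norm (g i)" if "norm u \<le> K" for u :: 'a and i
    using that by (rule mult_right_mono) simp
  show "(\<lambda>i. f i * g i) \<longlonglongrightarrow> 0"
    by (rule Lim_null_comparison[OF always_eventually lim])
      (use K le norm_mult_ineq order_trans in blast)
  have 2: "norm (star (f i) * g i) \<le> K * norm (g i)" for i
    using order_trans[OF norm_mult_ineq[of "star (f i)" "g i"], of "K * norm (g i)"] le[OF K, of i i]
    by simp
  then show "(\<lambda>i. star (f i) * g i) \<longlonglongrightarrow> 0"
    by (intro Lim_null_comparison[OF always_eventually lim]) simp
  have "norm (star (g i) * f i) \<le> K * norm (g i)" for i
    using 2[of i] norm_star[of "star (f i) * g i"] by (simp add: star_simps)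
  then show "(\<lambda>i. star (g i) * f i) \<longlonglongrightarrow> 0"
    by (intro Lim_null_comparison[OF always_eventually lim]) simp
qed

definition component :: "int \<Rightarrow> starpoly \<Rightarrow> starpoly"
  where "component k P = filter (\<lambda>(c, w). wdeg w = k) P"

text \<open>For large i the elements \<open>\<xi> n i\<close> behave like the vectors e_n.
  Orthogonality and a limiting norm are required of e_0 only and are propagated by
  \<open>gram_shift\<close>. Vectors of negative index are zero, so that words of any degree can be
  applied.\<close>

locale asymptotic_model =
  fixes X :: "'a::cstar_algebra" and s :: complex and \<xi> :: "int \<Rightarrow> nat \<Rightarrow> 'a" and \<nu> :: real
  assumes s: "s \<noteq> 0"
    and letter_xi: "(\<lambda>i. letter X l * \<xi> n i - step l n s *\<^sub>C \<xi> (n + (if l then 1 else - 1)) i) \<longlonglongrightarrow> 0"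
    and Bseq_xi: "Bseq (\<xi> n)"
    and orth_0: "n > 0 \<Longrightarrow> (\<lambda>i. star (\<xi> 0 i) * \<xi> n i) \<longlonglongrightarrow> 0"
    and norm_0: "(\<lambda>i. (norm (\<xi> 0 i))\<^sup>2) \<longlonglongrightarrow> \<nu>" and \<nu>: "\<nu> > 0"
    and xi_neg: "n < 0 \<Longrightarrow> \<xi> n i = 0"
begin

lemma word_xi:
  assumes "w \<noteq> []"
  shows "(\<lambda>i. weval X w * \<xi> n i - wcoeff w n s *\<^sub>C \<xi> (n + wdeg w) i) \<longlonglongrightarrow> 0"
  using assms
proof (induction w)
  case (Cons l w)
  show ?case
  proof (cases "w = []")
    case True
    then show ?thesis using letter_xi[of l n] by (simp cong: if_cong)
  next
    case False
    let ?m = "n + wdeg w"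
    have "(\<lambda>i. letter X l * (weval X w * \<xi> n i - wcoeff w n s *\<^sub>C \<xi> ?m i)
        + wcoeff w n s *\<^sub>C (letter X l * \<xi> ?m i - step l ?m s *\<^sub>C \<xi> (?m + (if l then 1 else - 1)) i))
        \<longlonglongrightarrow> letter X l * 0 + wcoeff w n s *\<^sub>C 0"
      by (intro tendsto_intros Cons.IH False letter_xi)
    then show ?thesis
      using False by (simp add: weval_Cons algebra_simps scaleC_diff_right scaleC_scaleC
          mult_scaleC_right cong: if_cong)
  qed
qed simp

text \<open>Evaluate \<open>star (\<xi> m i) * star X * \<xi> (n + 1) i\<close> in two ways, by
  letting X act on the left factor or its adjoint on the right factor.\<close>

lemma gram_shift:
  assumes "m \<ge> 0" "n \<ge> 0"
  shows "(\<lambda>i. cnj (step True m s) *\<^sub>C (star (\<xi> (m + 1) i) * \<xi> (n + 1) i) - star (\<xi> m i) * \<xi> n i)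
    \<longlonglongrightarrow> 0"
proof -
  have "(\<lambda>i. star (\<xi> m i) * (star X * \<xi> (n + 1) i - \<xi> n i)) \<longlonglongrightarrow> 0"
    by (rule Bseq_mult_null(2)[OF Bseq_xi]) (use letter_xi[of False "n + 1"] assms in \<open>simp add: step_def\<close>)
  moreover have "(\<lambda>i. star (X * \<xi> m i - step True m s *\<^sub>C \<xi> (m + 1) i) * \<xi> (n + 1) i) \<longlonglongrightarrow> 0"
    by (rule Bseq_mult_null(3)[OF Bseq_xi]) (use letter_xi[of True m] in simp)
  ultimately have "(\<lambda>i. star (\<xi> m i) * (star X * \<xi> (n + 1) i - \<xi> n i)
      - star (X * \<xi> m i - step True m s *\<^sub>C \<xi> (m + 1) i) * \<xi> (n + 1) i) \<longlonglongrightarrow> 0 - 0"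
    by (rule tendsto_diff)
  then show ?thesis
    by (simp add: star_simps right_diff_distrib left_diff_distrib mult_scaleC_left mult.assoc)
qed

lemma step_neq_0: "m \<ge> 0 \<Longrightarrow> step True m s \<noteq> 0"
  using s by (simp add: step_def)

lemma orth_less: "(\<lambda>i. star (\<xi> (int m) i) * \<xi> (int m + int (Suc j)) i) \<longlonglongrightarrow> 0"
proof (induction m)
  case 0
  then show ?case using orth_0[of "int (Suc j)"] by simp
next
  case (Suc m)
  let ?c = "cnj (step True (int m) s)"
  have c: "?c \<noteq> 0" using step_neq_0[of "int m"] by simp
  have "(\<lambda>i. ?c *\<^sub>C (star (\<xi> (int m + 1) i) * \<xi> (int m + int (Suc j) + 1) i)
      - star (\<xi> (int m) i) * \<xi> (int m + int (Suc j)) i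
      + star (\<xi> (int m) i) * \<xi> (int m + int (Suc j)) i) \<longlonglongrightarrow> 0 + 0"
    by (intro tendsto_add gram_shift Suc.IH) auto
  then have "(\<lambda>i. (1 / ?c) *\<^sub>C (?c *\<^sub>C (star (\<xi> (int m + 1) i) * \<xi> (int m + int (Suc j) + 1) i)))
      \<longlonglongrightarrow> (1 / ?c) *\<^sub>C 0"
    by (intro tendsto_scaleC tendsto_const) simp
  then have "(\<lambda>i. star (\<xi> (int m + 1) i) * \<xi> (int m + int (Suc j) + 1) i) \<longlonglongrightarrow> 0"
    using c by (simp add: scaleC_scaleC)
  then show ?case by (simp add: algebra_simps)
qed

lemma orth:
  assumes "m \<ge> 0" "m \<noteq> n"
  shows "(\<lambda>i. star (\<xi> m i) * \<xi> n i) \<longlonglongrightarrow> 0"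
proof -
  have lt: "(\<lambda>i. star (\<xi> k i) * \<xi> l i) \<longlonglongrightarrow> 0" if "0 \<le> k" "k < l" for k l
  proof -
    have "k = int (nat k)" "l = int (nat k) + int (Suc (nat (l - k - 1)))" using that by auto
    then show ?thesis using orth_less[of "nat k" "nat (l - k - 1)"] by simp
  qed
  consider "n < 0" | "0 \<le> n" "n < m" | "m < n" using assms(2) by linarith
  then show ?thesis
  proof cases
    case 1
    then show ?thesis by (simp add: xi_neg)
  next
    case 2
    then show ?thesis using tendsto_star[OF lt[OF 2]] by (simp add: star_simps)
  next
    case 3
    then show ?thesis using lt assms(1) by blast
  qed
qed

text \<open>Limits of the squared norms. The jump by \<open>cmod s\<close> is the price of avoiding
  square roots: X maps e_0 to s e_1, while its adjoint maps e_1 to e_0.\<close>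

definition norm_limit :: "int \<Rightarrow> real"
  where "norm_limit m = (if m = 0 then \<nu> else \<nu> / cmod s)"

lemma norm_limit_pos: "norm_limit m > 0"
  using \<nu> s by (simp add: norm_limit_def)

lemma norm_xi: "m \<ge> 0 \<Longrightarrow> (\<lambda>i. (norm (\<xi> m i))\<^sup>2) \<longlonglongrightarrow> norm_limit m"
proof -
  have "(\<lambda>i. (norm (\<xi> (int k) i))\<^sup>2) \<longlonglongrightarrow> norm_limit (int k)" for k
  proof (induction k)
    case 0
    then show ?case using norm_0 by (simp add: norm_limit_def)
  next
    case (Suc k)
    let ?c = "step True (int k) s"
    have c: "cmod ?c > 0" using step_neq_0[of "int k"] by simp
    let ?g = "\<lambda>i. cnj ?c *\<^sub>C (star (\<xi> (int k + 1) i) * \<xi> (int k + 1) i)"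
    have "(\<lambda>i. norm (?g i) - (norm (\<xi> (int k) i))\<^sup>2) \<longlonglongrightarrow> 0"
    proof (rule Lim_null_comparison[OF always_eventually tendsto_norm_zero[OF gram_shift[of "int k" "int k"]]])
      show "\<forall>i. norm (norm (?g i) - (norm (\<xi> (int k) i))\<^sup>2)
        \<le> norm (?g i - star (\<xi> (int k) i) * \<xi> (int k) i)"
        using norm_triangle_ineq3 by (metis cstar_identity real_norm_def)
    qed auto
    then have "(\<lambda>i. norm (?g i) - (norm (\<xi> (int k) i))\<^sup>2 + (norm (\<xi> (int k) i))\<^sup>2) \<longlonglongrightarrow> 0 + norm_limit (int k)"
      by (intro tendsto_add Suc.IH)
    then have "(\<lambda>i. (1 / cmod ?c) * (cmod ?c * (norm (\<xi> (int k + 1) i))\<^sup>2)) \<longlonglongrightarrow> (1 / cmod ?c) * norm_limit (int k)"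
      by (intro tendsto_intros) (simp add: norm_scaleC cstar_identity)
    then have "(\<lambda>i. (norm (\<xi> (int k + 1) i))\<^sup>2) \<longlonglongrightarrow> norm_limit (int k) / cmod ?c" using c by simp
    moreover have "norm_limit (int k) / cmod ?c = norm_limit (int k + 1)"
      by (auto simp: norm_limit_def step_def)
    ultimately show ?case by (simp add: add.commute)
  qed
  then show "m \<ge> 0 \<Longrightarrow> (\<lambda>i. (norm (\<xi> m i))\<^sup>2) \<longlonglongrightarrow> norm_limit m" by (metis nonneg_int_cases)
qed

text \<open>Orthogonality removes every word whose degree is not \<open>m - n\<close>. The inner
  product of \<xi> m with itself is an element and not a scalar, so it stays as a factor of the
  coefficient.\<close>

lemma matrix_coefficient:
  assumes P: "\<And>c w. (c, w) \<in> set P \<Longrightarrow> w \<noteq> []" and m: "m \<ge> 0"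
  shows "(\<lambda>i. star (\<xi> m i) * (peval X P * \<xi> n i)
    - pcoeff (component (m - n) P) n s *\<^sub>C (star (\<xi> m i) * \<xi> m i)) \<longlonglongrightarrow> 0"
  using P
proof (induction P)
  case Nil
  then show ?case by (simp add: component_def)
next
  case (Cons t P)
  obtain c w where t: "t = (c, w)" by (cases t)
  have w: "w \<noteq> []" using Cons.prems by (auto simp: t)
  let ?a = "if wdeg w = m - n then wcoeff w n s else 0"
  have "(\<lambda>i. star (\<xi> m i) * (weval X w * \<xi> n i - wcoeff w n s *\<^sub>C \<xi> (n + wdeg w) i)) \<longlonglongrightarrow> 0"
    by (rule Bseq_mult_null(2)[OF Bseq_xi word_xi[OF w]])
  moreover have "(\<lambda>i. wcoeff w n s *\<^sub>C (star (\<xi> m i) * \<xi> (n + wdeg w) i)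
      - ?a *\<^sub>C (star (\<xi> m i) * \<xi> m i)) \<longlonglongrightarrow> 0"
  proof (cases "wdeg w = m - n")
    case False
    have "(\<lambda>i. wcoeff w n s *\<^sub>C (star (\<xi> m i) * \<xi> (n + wdeg w) i)) \<longlonglongrightarrow> wcoeff w n s *\<^sub>C 0"
      by (intro tendsto_intros orth m) (use False in auto)
    then show ?thesis using False by simp
  qed simp
  ultimately have "(\<lambda>i. star (\<xi> m i) * (weval X w * \<xi> n i - wcoeff w n s *\<^sub>C \<xi> (n + wdeg w) i)
      + (wcoeff w n s *\<^sub>C (star (\<xi> m i) * \<xi> (n + wdeg w) i) - ?a *\<^sub>C (star (\<xi> m i) * \<xi> m i))) \<longlonglongrightarrow> 0 + 0"
    by (rule tendsto_add)
  then have 1: "(\<lambda>i. star (\<xi> m i) * (weval X w * \<xi> n i) - ?a *\<^sub>C (star (\<xi> m i) * \<xi> m i)) \<longlonglongrightarrow> 0"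
    by (simp add: right_diff_distrib mult_scaleC_right)
  have 2: "(\<lambda>i. star (\<xi> m i) * (peval X P * \<xi> n i)
    - pcoeff (component (m - n) P) n s *\<^sub>C (star (\<xi> m i) * \<xi> m i)) \<longlonglongrightarrow> 0"
    by (rule Cons.IH) (use Cons.prems in auto)
  have "pcoeff (component (m - n) (t # P)) n s = c * ?a + pcoeff (component (m - n) P) n s"
    by (simp add: component_def t)
  moreover have "(\<lambda>i. c *\<^sub>C (star (\<xi> m i) * (weval X w * \<xi> n i) - ?a *\<^sub>C (star (\<xi> m i) * \<xi> m i))
      + (star (\<xi> m i) * (peval X P * \<xi> n i)
        - pcoeff (component (m - n) P) n s *\<^sub>C (star (\<xi> m i) * \<xi> m i))) \<longlonglongrightarrow> c *\<^sub>C 0 + 0"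
    by (intro tendsto_intros 1 2)
  ultimately show ?case
    by (simp only: t peval_simps)
      (simp add: scaleC_diff_right scaleC_scaleC scaleC_add_left distrib_left distrib_right
        mult_scaleC_left mult_scaleC_right algebra_simps)
qed

lemma coefficient_bound:
  assumes P: "\<And>c w. (c, w) \<in> set P \<Longrightarrow> w \<noteq> []" and m: "m \<ge> 0" and n: "n \<ge> 0"
  shows "cmod (pcoeff (component (m - n) P) n s) * norm_limit m
    \<le> norm (peval X P) * (sqrt (norm_limit m) * sqrt (norm_limit n))"
proof -
  let ?a = "pcoeff (component (m - n) P) n s"
  let ?v = "\<lambda>i. star (\<xi> m i) * (peval X P * \<xi> n i)" and ?z = "\<lambda>i. ?a *\<^sub>C (star (\<xi> m i) * \<xi> m i)"
  have nx: "(\<lambda>i. norm (\<xi> k i)) \<longlonglongrightarrow> sqrt (norm_limit k)" if "k \<ge> 0" for k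
    using tendsto_real_sqrt[OF norm_xi[OF that]] by simp
  have "(\<lambda>i. norm (?z i) - norm (?v i - ?z i)) \<longlonglongrightarrow> cmod ?a * norm_limit m - 0"
    unfolding norm_scaleC cstar_identity
    by (intro tendsto_intros norm_xi m tendsto_norm_zero matrix_coefficient P)
  moreover have "(\<lambda>i. norm (peval X P) * (norm (\<xi> m i) * norm (\<xi> n i)))
      \<longlonglongrightarrow> norm (peval X P) * (sqrt (norm_limit m) * sqrt (norm_limit n))"
    by (intro tendsto_intros nx m n)
  moreover have "norm (?z i) - norm (?v i - ?z i) \<le> norm (peval X P) * (norm (\<xi> m i) * norm (\<xi> n i))" for i
  proof -
    have "norm (?v i) \<le> norm (star (\<xi> m i)) * norm (peval X P * \<xi> n i)" by (rule norm_mult_ineq)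
    also have "\<dots> \<le> norm (\<xi> m i) * (norm (peval X P) * norm (\<xi> n i))"
      unfolding norm_star by (intro mult_left_mono norm_mult_ineq) auto
    finally show ?thesis
      using norm_triangle_ineq2[of "?z i" "?v i"] norm_minus_commute[of "?z i" "?v i"]
      by (simp add: mult_ac)
  qed
  ultimately show ?thesis by (auto intro: LIMSEQ_le)
qed

text \<open>A single coefficient is controlled only up to the ratio of the lengths of two basis
  vectors. On the way from level n to n + k and back these ratios cancel.\<close>

lemma coefficient_product_bound:
  assumes P: "\<And>c w. (c, w) \<in> set P \<Longrightarrow> w \<noteq> []" and Q: "\<And>c w. (c, w) \<in> set Q \<Longrightarrow> w \<noteq> []"
    and n: "n \<ge> 0" and m: "n + k \<ge> 0"
  shows "cmod (pcoeff (component k P) n s * pcoeff (component (- k) Q) (n + k) s)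
    \<le> norm (peval X P) * norm (peval X Q)"
proof -
  let ?m = "n + k"
  let ?a = "cmod (pcoeff (component k P) n s)" and ?b = "cmod (pcoeff (component (- k) Q) ?m s)"
  let ?M = "norm_limit ?m" and ?N = "norm_limit n"
  have "?a * ?M \<le> norm (peval X P) * (sqrt ?M * sqrt ?N)"
    using coefficient_bound[OF P m n] by simp
  moreover have "?b * ?N \<le> norm (peval X Q) * (sqrt ?N * sqrt ?M)"
    using coefficient_bound[OF Q n m] by simp
  ultimately have "(?a * ?M) * (?b * ?N)
      \<le> (norm (peval X P) * (sqrt ?M * sqrt ?N)) * (norm (peval X Q) * (sqrt ?N * sqrt ?M))"
    using norm_limit_pos[of ?m] norm_limit_pos[of n]
    by (intro mult_mono[of "?a * ?M" _ "?b * ?N"]) (simp_all add: less_imp_le)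
  also have "\<dots> = (norm (peval X P) * norm (peval X Q)) * ((sqrt ?M * sqrt ?M) * (sqrt ?N * sqrt ?N))"
    by (simp only: mult_ac)
  also have "\<dots> = (norm (peval X P) * norm (peval X Q)) * (?M * ?N)"
    using norm_limit_pos[of ?m] norm_limit_pos[of n] by simp
  finally have "(?a * ?b) * (?M * ?N) \<le> (norm (peval X P) * norm (peval X Q)) * (?M * ?N)"
    by (simp only: mult_ac)
  then show ?thesis
    using norm_limit_pos[of ?m] norm_limit_pos[of n]
    by (simp add: norm_mult mult_le_cancel_right)
qed

end

section \<open>Models obtained from spectral values and from the defect projection\<close>

lemma Bseq_const_mult:
  fixes f :: "nat \<Rightarrow> 'a::real_normed_algebra"
  assumes "Bseq f" shows "Bseq (\<lambda>i. a * f i)"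
proof -
  obtain K where "\<And>i. norm (f i) \<le> K" using assms by (auto simp: Bseq_def)
  then have "norm (a * f i) \<le> norm a * K" for i
    by (rule order_trans[OF norm_mult_ineq mult_left_mono]) simp
  then show ?thesis by (rule BseqI')
qed

context scaling
begin

lemma star_X_star_X_b: "star X * (star X * b) = star X * star X"
  using Xh Xb by (simp add: mult.assoc[symmetric])

text \<open>An approximate eigenvector u of \<open>b\<close> takes the place of e_1;
  \<open>star X * u\<close> serves as e_0, and powers of X applied to u give the other
  vectors.\<close>

lemma asymptotic_model_spectral_value:
  assumes s: "s \<in> S" "s \<noteq> 0" "s \<noteq> 1"
  obtains \<xi> where "asymptotic_model X s \<xi> (cmod s)"
proof -
  obtain u where u: "(\<lambda>i. norm (u i)) \<longlonglongrightarrow> 1" "(\<lambda>i. b * u i - s *\<^sub>C u i) \<longlonglongrightarrow> 0"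
    using approximate_eigenvector_selfadjoint[of b s] s by auto
  have real: "cnj s = s" using real_S[OF s(1)] by (simp add: complex_eq_iff)
  define p where "p = (\<lambda>(k::nat) y. ((*) X ^^ k) y)"
  have p_simps: "p 0 y = y" "p (Suc k) y = X * p k y" for k y by (simp_all add: p_def)
  define \<xi> where "\<xi> = (\<lambda>(n::int) (i::nat). if n < 0 then 0 else if n = 0 then star X * u i else p (nat (n - 1)) (u i))"
  have "Bseq (\<lambda>i. norm (u i))" using u(1) by (blast intro: convergent_imp_Bseq convergentI)
  then have Bu: "Bseq u" by (simp add: Bseq_def)
  have Bp: "Bseq (\<lambda>i. p k (u i))" for k
  proof (induction k)
    case (Suc k)
    then show ?case unfolding p_simps by (rule Bseq_const_mult)
  qed (simp add: p_simps Bu)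
  have hu: "(\<lambda>i. h * u i - u i) \<longlonglongrightarrow> 0"
  proof -
    have hbx: "h * (b * x) = b * x" for x by (simp add: mult.assoc[symmetric] hb)
    have "(\<lambda>i. (1 / s) *\<^sub>C ((b * u i - s *\<^sub>C u i) - h * (b * u i - s *\<^sub>C u i))) \<longlonglongrightarrow> (1 / s) *\<^sub>C (0 - h * 0)"
      by (intro tendsto_intros u)
    then show ?thesis
      using s(2) by (simp add: right_diff_distrib hbx mult_scaleC_right scaleC_diff_right scaleC_scaleC)
  qed
  have hp: "(\<lambda>i. h * p k (u i) - p k (u i)) \<longlonglongrightarrow> 0" for k
  proof (cases k)
    case (Suc k')
    have "h * (X * y) = X * y" for y by (simp add: mult.assoc[symmetric] hX)
    then show ?thesis by (simp add: Suc p_simps)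
  qed (simp add: p_simps hu)
  \<comment> \<open>\<open>b\<close> acts on u as s but is absorbed by
    \<open>star X * star X\<close>, so 1 - s times the product tends to 0.\<close>
  have XXu: "(\<lambda>i. star X * (star X * u i)) \<longlonglongrightarrow> 0"
  proof -
    have e: "star X * (star X * (b * x)) = star X * (star X * x)" for x
      using star_X_star_X_b by (metis mult.assoc)
    have "(\<lambda>i. (1 / (1 - s)) *\<^sub>C (star X * (star X * (b * u i - s *\<^sub>C u i)))) \<longlonglongrightarrow> (1 / (1 - s)) *\<^sub>C (star X * (star X * 0))"
      by (intro tendsto_intros u)
    moreover have "star X * (star X * (b * x - s *\<^sub>C x)) = (1 - s) *\<^sub>C (star X * (star X * x))" for x
      by (simp add: right_diff_distrib e mult_scaleC_right scaleC_diff_left)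
    ultimately show ?thesis using s(3) by (simp add: scaleC_scaleC)
  qed
  \<comment> \<open>In the inner product of u with X y, the element \<open>b\<close> gives the
    factor s when applied to u and asymptotically the factor 1 when applied to X y.\<close>
  have orth: "(\<lambda>i. star (u i) * p (Suc k) (u i)) \<longlonglongrightarrow> 0" for k
  proof -
    let ?y = "\<lambda>i. p (Suc k) (u i)"
    have "(\<lambda>i. star (b * u i - s *\<^sub>C u i) * ?y i) \<longlonglongrightarrow> 0"
      by (rule Bseq_mult_null(3)[OF Bp u(2)])
    moreover have "(\<lambda>i. star (u i) * (X * (h * p k (u i) - p k (u i)))) \<longlonglongrightarrow> 0"
      by (rule Bseq_mult_null(2)[OF Bu]) (use tendsto_mult[OF tendsto_const hp] in \<open>simp add: tendsto_mult_right_zero\<close>)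
    ultimately have "(\<lambda>i. (1 / (1 - s)) *\<^sub>C (star (b * u i - s *\<^sub>C u i) * ?y i
        - star (u i) * (X * (h * p k (u i) - p k (u i))))) \<longlonglongrightarrow> (1 / (1 - s)) *\<^sub>C (0 - 0)"
      by (intro tendsto_intros)
    moreover have "star (b * v - s *\<^sub>C v) * (X * y) - star v * (X * (h * y - y)) = (1 - s) *\<^sub>C (star v * (X * y))"
      for v y
    proof -
      have "b * (X * y) = X * (h * y)" by (simp add: mult.assoc[symmetric] bX)
      then show ?thesis
        by (simp add: star_simps real right_diff_distrib left_diff_distrib mult_scaleC_left
            scaleC_diff_left mult.assoc)
    qed
    ultimately show ?thesis using s(3) by (simp add: p_simps scaleC_scaleC)
  qed
  have "asymptotic_model X s \<xi> (cmod s)"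
  proof
    show "s \<noteq> 0" "cmod s > 0" using s by auto
    show "\<xi> n i = 0" if "n < 0" for n i using that by (simp add: \<xi>_def)
    show "Bseq (\<xi> n)" for n
    proof -
      consider "n < 0" | "n = 0" | "n > 0" by linarith
      then show ?thesis
      proof cases
        case 1
        then show ?thesis by (simp add: \<xi>_def)
      next
        case 2
        then show ?thesis using Bseq_const_mult[OF Bu, of "star X"] by (simp add: \<xi>_def)
      next
        case 3
        then show ?thesis using Bp by (simp add: \<xi>_def)
      qed
    qed
    show "(\<lambda>i. star (\<xi> 0 i) * \<xi> n i) \<longlonglongrightarrow> 0" if "n > 0" for n
    proof -
      have "star (\<xi> 0 i) * \<xi> n i = star (u i) * p (Suc (nat (n - 1))) (u i)" for i
        using that by (simp add: \<xi>_def star_simps p_simps mult.assoc)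
      then show ?thesis using orth by simp
    qed
    show "(\<lambda>i. (norm (\<xi> 0 i))\<^sup>2) \<longlonglongrightarrow> cmod s"
    proof -
      have "(\<lambda>i. star (u i) * (b * u i - s *\<^sub>C u i)) \<longlonglongrightarrow> 0"
        by (rule Bseq_mult_null(2)[OF Bu u(2)])
      then have "(\<lambda>i. norm (star (u i) * (b * u i) - s *\<^sub>C (star (u i) * u i))) \<longlonglongrightarrow> 0"
        by (simp add: right_diff_distrib mult_scaleC_right tendsto_norm_zero)
      then have "(\<lambda>i. norm (star (u i) * (b * u i)) - norm (s *\<^sub>C (star (u i) * u i))) \<longlonglongrightarrow> 0"
        by (rule Lim_null_comparison[OF always_eventually, rotated]) (simp add: norm_triangle_ineq3)
      moreover have "(\<lambda>i. norm (s *\<^sub>C (star (u i) * u i))) \<longlonglongrightarrow> cmod s * 1\<^sup>2"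
        unfolding norm_scaleC cstar_identity by (intro tendsto_intros u)
      ultimately have "(\<lambda>i. norm (star (u i) * (b * u i)) - norm (s *\<^sub>C (star (u i) * u i))
          + norm (s *\<^sub>C (star (u i) * u i))) \<longlonglongrightarrow> 0 + cmod s * 1\<^sup>2" by (rule tendsto_add)
      then have "(\<lambda>i. norm (star (u i) * (b * u i))) \<longlonglongrightarrow> cmod s" by simp
      moreover have "(norm (\<xi> 0 i))\<^sup>2 = norm (star (u i) * (b * u i))" for i
        using cstar_identity[of "\<xi> 0 i"] by (simp add: \<xi>_def star_simps b_def mult.assoc)
      ultimately show ?thesis by simp
    qed
    show "(\<lambda>i. letter X l * \<xi> n i - step l n s *\<^sub>C \<xi> (n + (if l then 1 else - 1)) i) \<longlonglongrightarrow> 0" for l n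
    proof (cases l)
      case l: True
      consider "n < - 1" | "n = - 1" | "n = 0" | "n > 0" by linarith
      then show ?thesis
      proof cases
        case 3
        then show ?thesis using l u(2) by (simp add: \<xi>_def step_def p_simps b_def mult.assoc)
      next
        case 4
        then have "nat n = Suc (nat (n - 1))" by simp
        then show ?thesis using l 4 by (simp add: \<xi>_def step_def p_simps)
      qed (use l in \<open>simp_all add: \<xi>_def step_def\<close>)
    next
      case l: False
      consider "n < 0" | "n = 0" | "n = 1" | "n \<ge> 2"
        by linarith
      then show ?thesis
      proof cases
        case 2
        then show ?thesis using l XXu by (simp add: \<xi>_def step_def)
      next
        case 3
        then show ?thesis using l by (simp add: \<xi>_def step_def p_simps)
      next
        case 4
        define k where "k = nat (n - 2)"
        have n: "n = int k + 2" using 4 by (simp add: k_def)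
        have "star X * p (Suc k) (u i) = h * p k (u i)" for i by (simp add: p_simps h_def mult.assoc)
        moreover have "nat (int k + 2 - 1) = Suc k" "nat (int k + 2 - 1 - 1) = k" by auto
        ultimately show ?thesis using l hp[of k] by (simp add: n \<xi>_def step_def)
      qed (use l in \<open>simp add: \<xi>_def step_def\<close>)
    qed
  qed
  then show thesis by (rule that)
qed

text \<open>The difference \<open>d\<close> of the two projections satisfies
  \<open>h * d = d\<close> and \<open>star X * d = 0\<close>. If it is not zero, it is the vector
  e_0 of an exact copy of the unilateral shift, the model with s = 1.\<close>

lemma asymptotic_model_defect:
  assumes M: "compact (S - {0, 1})" and nd: "\<not> degenerate"
  obtains \<xi> \<nu> where "asymptotic_model X 1 \<xi> \<nu>"
proof -
  note ind = c0_on_indicators[OF M zero_in_S one_in_S]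
  define q where "q = cal b (indicator (S - {0}))"
  define d where "d = cal h (indicator {1}) - q"
  have d0: "d \<noteq> 0" using M nd by (simp add: d_def q_def degenerate_def)
  have "h * cal h (indicator {1}) = cal h (\<lambda>z. z * indicator {1} z)"
    using cal_mult[of h "\<lambda>z. z" "indicator {1}"] by (simp add: cal_id c0_on_intros ind)
  also have "\<dots> = cal h (indicator {1})" by (rule cal_cong) (auto simp: indicator_def)
  finally have hd: "h * d = d" by (simp add: d_def q_def right_diff_distrib h_cal_b ind)
  have bq: "b * q = b" "q * b = b"
  proof -
    have "cal b (\<lambda>z. z * indicator (S - {0}) z) = cal b (\<lambda>z. z)"
      "cal b (\<lambda>z. indicator (S - {0}) z * z) = cal b (\<lambda>z. z)"
      by (rule cal_cong; force simp: indicator_def)+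
    then show "b * q = b" "q * b = b"
      using cal_mult[of b "\<lambda>z. z" "indicator (S - {0})"] cal_mult[of b "indicator (S - {0})" "\<lambda>z. z"]
      by (simp_all add: cal_id c0_on_intros ind q_def)
  qed
  have "(\<lambda>z. cnj (indicator (S - {0}) z)) = indicator (S - {0})"
    by (auto simp: indicator_def fun_eq_iff)
  then have sq: "star q = q"
    unfolding q_def using cal_star[of b "indicator (S - {0})"] ind(2) by simp
  \<comment> \<open>The C*-identity carries \<open>b * q = b\<close> over to
    \<open>star X * q = star X\<close>.\<close>
  have "star (star X * q - star X) * (star X * q - star X) = q * b * q - q * b - b * q + b"
    by (simp add: star_simps sq b_def left_diff_distrib right_diff_distrib mult.assoc)
  also have "\<dots> = 0" by (simp add: bq)
  finally have "(norm (star X * q - star X))\<^sup>2 = 0" using cstar_identity[of "star X * q - star X"] by simp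
  then have "star X * q = star X" by simp
  moreover have "star X * cal h (indicator {1}) = star X"
    using h_right_h[OF Xh ind(1)] by simp
  ultimately have Xd: "star X * d = 0" by (simp add: d_def right_diff_distrib)
  define \<xi> where "\<xi> = (\<lambda>(n::int) (i::nat). if n < 0 then 0 else ((*) X ^^ nat n) d)"
  have hXx: "h * (X * y) = X * y" for y by (simp add: mult.assoc[symmetric] hX)
  have "asymptotic_model X 1 \<xi> ((norm d)\<^sup>2)"
  proof
    show "(1::complex) \<noteq> 0" "(norm d)\<^sup>2 > 0" using d0 by auto
    show "\<xi> n i = 0" if "n < 0" for n i using that by (simp add: \<xi>_def)
    show "Bseq (\<xi> n)" for n by (simp add: \<xi>_def)
    show "(\<lambda>i. (norm (\<xi> 0 i))\<^sup>2) \<longlonglongrightarrow> (norm d)\<^sup>2" by (simp add: \<xi>_def)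
    show "(\<lambda>i. star (\<xi> 0 i) * \<xi> n i) \<longlonglongrightarrow> 0" if "n > 0" for n
    proof -
      have "nat n = Suc (nat (n - 1))" using that by simp
      moreover have "star d * (X * y) = 0" for y
        using arg_cong[OF Xd, of star] by (simp add: star_simps mult.assoc[symmetric])
      ultimately show ?thesis using that by (simp add: \<xi>_def)
    qed
    show "(\<lambda>i. letter X l * \<xi> n i - step l n 1 *\<^sub>C \<xi> (n + (if l then 1 else - 1)) i) \<longlonglongrightarrow> 0" for l n
    proof (cases l)
      case l: True
      consider "n < - 1" | "n = - 1" | "n \<ge> 0" by linarith
      then show ?thesis
      proof cases
        case 3
        then have "nat (n + 1) = Suc (nat n)" by simp
        then show ?thesis using l 3 by (simp add: \<xi>_def step_def)
      qed (use l in \<open>simp_all add: \<xi>_def step_def\<close>)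
    next
      case l: False
      consider "n < 0" | "n = 0" | "n > 0" by linarith
      then show ?thesis
      proof cases
        case 2
        then show ?thesis using l Xd by (simp add: \<xi>_def step_def)
      next
        case 3
        then obtain k where k: "n = int (Suc k)" by (metis zero_less_imp_eq_int gr0_implies_Suc)
        have "star X * (X * ((*) X ^^ k) d) = h * ((*) X ^^ k) d" by (simp add: h_def mult.assoc)
        also have "\<dots> = ((*) X ^^ k) d" by (cases k) (simp_all add: hd hXx)
        finally have "star X * \<xi> (int (Suc k)) i = \<xi> (int k) i" for i
          unfolding \<xi>_def nat_int by simp
        then show ?thesis using l by (simp add: step_def k)
      qed (use l in \<open>simp add: \<xi>_def step_def\<close>)
    qed
  qed
  then show thesis by (rule that)
qed

end

section \<open>Norm comparison\<close>

definition nonempty_words :: "starpoly \<Rightarrow> bool"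
  where "nonempty_words P \<longleftrightarrow> (\<forall>(c, w)\<in>set P. w \<noteq> [])"

definition pmul :: "starpoly \<Rightarrow> starpoly \<Rightarrow> starpoly"
  where "pmul Q P = concat (map (\<lambda>(d, v). map (\<lambda>(c, w). (d * c, v @ w)) P) Q)"

definition pstar :: "starpoly \<Rightarrow> starpoly"
  where "pstar P = map (\<lambda>(c, w). (cnj c, map Not (rev w))) P"

definition pscale :: "complex \<Rightarrow> starpoly \<Rightarrow> starpoly"
  where "pscale d P = map (\<lambda>(c, w). (d * c, w)) P"

lemma set_pmul: "set (pmul Q P) = {(d * c, v @ w) | d v c w. (d, v) \<in> set Q \<and> (c, w) \<in> set P}"
  by (force simp: pmul_def)

lemma nonempty_words_simps [simp]:
  "nonempty_words []" "nonempty_words ((c, w) # P) \<longleftrightarrow> w \<noteq> [] \<and> nonempty_words P"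
  "nonempty_words (P @ Q) \<longleftrightarrow> nonempty_words P \<and> nonempty_words Q"
  by (auto simp: nonempty_words_def)

lemma nonempty_words_closed:
  "nonempty_words P \<Longrightarrow> nonempty_words (pmul Q P)" "nonempty_words P \<Longrightarrow> nonempty_words (pstar P)"
  "nonempty_words P \<Longrightarrow> nonempty_words (pscale d P)" "nonempty_words P \<Longrightarrow> nonempty_words (component k P)"
  by (auto simp: nonempty_words_def set_pmul pstar_def pscale_def component_def)

lemma peval_pscale: "peval X (pscale d P) = d *\<^sub>C peval X P"
  by (induction P) (auto simp: pscale_def scaleC_add_right scaleC_scaleC)

lemma weval_star: "weval X (map Not (rev w)) = star (weval X w)"
proof (induction w)
  case (Cons l w)
  have l: "letter X (\<not> l) = star (letter X l)" by (cases l) (simp_all add: star_star)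
  show ?case
  proof (cases "w = []")
    case False
    then show ?thesis using Cons l by (simp add: weval_append weval_Cons star_mult)
  qed (simp add: l)
qed simp

lemma peval_pstar: "peval X (pstar P) = star (peval X P)"
  by (induction P) (auto simp: pstar_def weval_star star_simps)

lemma peval_pmul:
  assumes "nonempty_words Q" "nonempty_words P"
  shows "peval X (pmul Q P) = peval X Q * peval X P"
proof -
  have 1: "peval X (map (\<lambda>(c, w). (d * c, v @ w)) P) = (d *\<^sub>C weval X v) * peval X P" if "v \<noteq> []" for d v
    using assms(2)
  proof (induction P)
    case (Cons t P)
    then show ?case using that
      by (cases t) (simp add: weval_append distrib_left mult_scaleC_left mult_scaleC_right scaleC_scaleC mult.commute)
  qed simp
  show ?thesis using assms(1)
  proof (induction Q)
    case (Cons t Q)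
    then show ?case by (cases t) (simp add: pmul_def 1 distrib_right)
  qed (simp add: pmul_def)
qed

lemma wdeg_star: "wdeg (map Not (rev w)) = - wdeg w"
  by (induction w) auto

lemma component_pstar: "component k (pstar P) = pstar (component (- k) P)"
  by (induction P) (auto simp: component_def pstar_def wdeg_star)

lemma pcoeff_pmul:
  assumes "\<And>c w. (c, w) \<in> set P \<Longrightarrow> wdeg w = k"
  shows "pcoeff (pmul Q P) n s = pcoeff P n s * pcoeff Q (n + k) s"
proof -
  have 1: "pcoeff (map (\<lambda>(c, w). (d * c, v @ w)) P) n s = pcoeff P n s * (d * wcoeff v (n + k) s)" for d v
    using assms
  proof (induction P)
    case (Cons t P)
    obtain c w where t: "t = (c, w)" by (cases t)
    have "pcoeff (map (\<lambda>(c, w). (d * c, v @ w)) P) n s = pcoeff P n s * (d * wcoeff v (n + k) s)"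
      by (rule Cons.IH) (use Cons.prems in auto)
    moreover have "wdeg w = k" using Cons.prems by (auto simp: t)
    ultimately show ?case by (simp add: t wcoeff_append algebra_simps)
  qed simp
  show ?thesis
  proof (induction Q)
    case (Cons t Q)
    then show ?case by (cases t) (simp add: pmul_def 1 algebra_simps)
  qed (simp add: pmul_def)
qed

lemma wcoeff_below:
  assumes "n \<ge> 0" "n + wdeg w < 0" shows "wcoeff w n s = 0"
proof (rule ccontr)
  assume "wcoeff w n s \<noteq> 0"
  then have "n + wdeg w \<ge> 0" using assms(1)
    by (induction w) (auto simp: step_def split: if_splits)
  then show False using assms(2) by simp
qed

lemma pcoeff_below:
  assumes "n \<ge> 0" "n + k < 0" shows "pcoeff (component k P) n s = 0"
  using assms by (induction P) (auto simp: component_def wcoeff_below)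

lemma tendsto_wcoeff:
  "(f \<longlongrightarrow> s) F \<Longrightarrow> ((\<lambda>i. wcoeff w n (f i)) \<longlongrightarrow> wcoeff w n s) F"
proof (induction w)
  case (Cons l w)
  have "((\<lambda>i. step l (n + wdeg w) (f i)) \<longlongrightarrow> step l (n + wdeg w) s) F"
    using Cons.prems by (simp add: step_def)
  then show ?case using Cons by (simp add: tendsto_mult)
qed simp

lemma tendsto_pcoeff:
  "(f \<longlongrightarrow> s) F \<Longrightarrow> ((\<lambda>i. pcoeff P n (f i)) \<longlongrightarrow> pcoeff P n s) F"
  by (induction P) (auto intro!: tendsto_intros tendsto_wcoeff)

section \<open>Parameters whose model is controlled by the norm of X\<close>

context scaling
begin

definition dominated :: "complex \<Rightarrow> bool"
  where "dominated s \<longleftrightarrow> (\<forall>P Q k n. nonempty_words P \<longrightarrow> nonempty_words Q \<longrightarrow> n \<ge> 0 \<longrightarrow>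
    cmod (pcoeff (pmul (component (- k) Q) (component k P)) n s) \<le> norm (peval X P) * norm (peval X Q))"

lemma pcoeff_product:
  "pcoeff (pmul (component (- k) Q) (component k P)) n s
    = pcoeff (component k P) n s * pcoeff (component (- k) Q) (n + k) s"
  by (rule pcoeff_pmul) (auto simp: component_def)

lemma dominated_model:
  assumes "asymptotic_model X s \<xi> \<nu>" shows "dominated s"
proof -
  interpret asymptotic_model X s \<xi> \<nu> by (rule assms)
  show ?thesis
    unfolding dominated_def
  proof (intro allI impI)
    fix P Q k and n :: int
    assume *: "nonempty_words P" "nonempty_words Q" "n \<ge> 0"
    show "cmod (pcoeff (pmul (component (- k) Q) (component k P)) n s) \<le> norm (peval X P) * norm (peval X Q)"
    proof (cases "n + k \<ge> 0")
      case True
      show ?thesis unfolding pcoeff_product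
        by (rule coefficient_product_bound) (use * True in \<open>auto simp: nonempty_words_def\<close>)
    next
      case False
      then show ?thesis using * by (simp add: pcoeff_product pcoeff_below)
    qed
  qed
qed

lemma dominated_limit:
  assumes "\<And>i. dominated (f i)" and lim: "f \<longlonglongrightarrow> s" shows "dominated s"
  unfolding dominated_def
proof (intro allI impI)
  fix P Q k and n :: int
  assume "nonempty_words P" "nonempty_words Q" "n \<ge> 0"
  then have "cmod (pcoeff (pmul (component (- k) Q) (component k P)) n (f i)) \<le> norm (peval X P) * norm (peval X Q)" for i
    using assms(1)[of i] unfolding dominated_def by blast
  then show "cmod (pcoeff (pmul (component (- k) Q) (component k P)) n s) \<le> norm (peval X P) * norm (peval X Q)"
    by (intro LIMSEQ_le_const2[OF tendsto_norm[OF tendsto_pcoeff[OF lim]]]) blast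
qed

text \<open>With normalized vectors, at s = 0 both X and its adjoint kill e_0, and e_1, e_2, ...
  form the model for s = 1. Words of degree zero have diagonal entries, which do not depend on the
  normalization.\<close>

lemma wcoeff_0_1:
  assumes "w \<noteq> []" "wdeg w = 0"
  shows "wcoeff w (n + 1) 0 = wcoeff w n 1" and "wcoeff w 0 0 = 0"
  using word_normal_form[OF assms] by (auto simp: entry_def)

lemma pcoeff_0_1:
  assumes "\<And>c w. (c, w) \<in> set R \<Longrightarrow> w \<noteq> [] \<and> wdeg w = 0"
  shows "pcoeff R (n + 1) 0 = pcoeff R n 1" and "pcoeff R 0 0 = 0"
proof -
  have "pcoeff R (n + 1) 0 = pcoeff R n 1 \<and> pcoeff R 0 0 = 0"
    using assms
  proof (induction R)
    case (Cons t R)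
    obtain c w where t: "t = (c, w)" by (cases t)
    have "pcoeff R (n + 1) 0 = pcoeff R n 1 \<and> pcoeff R 0 0 = 0"
      by (rule Cons.IH) (use Cons.prems in auto)
    moreover have "w \<noteq> []" "wdeg w = 0" using Cons.prems by (auto simp: t)
    ultimately show ?case using wcoeff_0_1 by (simp add: t)
  qed simp
  then show "pcoeff R (n + 1) 0 = pcoeff R n 1" "pcoeff R 0 0 = 0" by auto
qed

lemma dominated_0_1: "dominated 0 \<longleftrightarrow> dominated 1"
proof -
  have R: "w \<noteq> [] \<and> wdeg w = 0"
    if "nonempty_words P" "(c, w) \<in> set (pmul (component (- k) Q) (component k P))" for P Q k c w
    using that by (auto simp: set_pmul component_def nonempty_words_def)
  show ?thesis
  proof
    assume d: "dominated 0"
    show "dominated 1" unfolding dominated_def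
    proof (intro allI impI)
      fix P Q k and n :: int
      assume *: "nonempty_words P" "nonempty_words Q" "n \<ge> 0"
      let ?R = "pmul (component (- k) Q) (component k P)"
      have "0 \<le> n + 1" using *(3) by simp
      then have "cmod (pcoeff ?R (n + 1) 0) \<le> norm (peval X P) * norm (peval X Q)"
        using d *(1,2) unfolding dominated_def by blast
      moreover have "pcoeff ?R (n + 1) 0 = pcoeff ?R n 1"
        by (rule pcoeff_0_1) (rule R[OF *(1)])
      ultimately show "cmod (pcoeff ?R n 1) \<le> norm (peval X P) * norm (peval X Q)" by simp
    qed
  next
    assume d: "dominated 1"
    show "dominated 0" unfolding dominated_def
    proof (intro allI impI)
      fix P Q k and n :: int
      assume *: "nonempty_words P" "nonempty_words Q" "n \<ge> 0"
      let ?R = "pmul (component (- k) Q) (component k P)"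
      show "cmod (pcoeff ?R n 0) \<le> norm (peval X P) * norm (peval X Q)"
      proof (cases "n = 0")
        case True
        have "pcoeff ?R 0 0 = 0" by (rule pcoeff_0_1) (rule R[OF *(1)])
        then show ?thesis using True by simp
      next
        case False
        then have "cmod (pcoeff ?R (n - 1) 1) \<le> norm (peval X P) * norm (peval X Q)"
          using d * unfolding dominated_def by auto
        moreover have "pcoeff ?R (n - 1 + 1) 0 = pcoeff ?R (n - 1) 1"
          by (rule pcoeff_0_1) (rule R[OF *(1)])
        ultimately show ?thesis by simp
      qed
    qed
  qed
qed

text \<open>For 0 and 1 it suffices to treat one of them. If \<open>S - {0, 1}\<close> is compact,
  the defect provides the model for s = 1; otherwise 0 or 1 is a limit of points of
  \<open>S - {0, 1}\<close>, and domination passes to the limit.\<close>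

lemma dominated_S:
  assumes "s \<in> S" and "degenerate \<Longrightarrow> s \<notin> {0, 1}"
  shows "dominated s"
proof -
  have M: "dominated t" if "t \<in> S - {0, 1}" for t
    using that asymptotic_model_spectral_value[of t] dominated_model by blast
  show ?thesis
  proof (cases "s \<in> {0, 1}")
    case True
    then have nd: "\<not> degenerate" using assms(2) by blast
    have "\<exists>t\<in>{0, 1}. dominated t"
    proof (cases "compact (S - {0, 1})")
      case True
      then show ?thesis using asymptotic_model_defect[OF _ nd] dominated_model by blast
    next
      case False
      have "bounded (S - {0, 1})" using compact_imp_bounded[OF compact_S] by (rule bounded_subset) auto
      then have "\<not> closed (S - {0, 1})" using False by (simp add: compact_eq_bounded_closed)
      then obtain f t where f: "\<And>i. f i \<in> S - {0, 1}" "f \<longlonglongrightarrow> t" "t \<notin> S - {0, 1}"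
        unfolding closed_sequential_limits by blast
      have "t \<in> S"
        by (rule closed_sequentially[OF compact_imp_closed[OF compact_S] _ f(2)]) (use f(1) in auto)
      then show ?thesis using f(3) dominated_limit[OF M[OF f(1)] f(2)] by blast
    qed
    then show ?thesis using True dominated_0_1 by auto
  qed (use M assms(1) in auto)
qed

end

lemma peval_components:
  assumes "\<And>c w. (c, w) \<in> set P \<Longrightarrow> length w \<le> L"
  shows "peval X P = (\<Sum>k\<in>{- int L..int L}. peval X (component k P))"
  using assms
proof (induction P)
  case Nil
  then show ?case by (simp add: component_def)
next
  case (Cons t P)
  obtain c w where t: "t = (c, w)" by (cases t)
  have "\<bar>wdeg v\<bar> \<le> int (length v)" for v by (induction v) auto
  then have "\<bar>wdeg w\<bar> \<le> int (length w)" .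
  also have "length w \<le> L" using Cons.prems[of c w] by (simp add: t)
  finally have w: "wdeg w \<in> {- int L..int L}" by auto
  have "peval X P = (\<Sum>k\<in>{- int L..int L}. peval X (component k P))"
    by (rule Cons.IH) (use Cons.prems in auto)
  moreover have "peval X (component k (t # P))
      = (if k = wdeg w then c *\<^sub>C weval X w else 0) + peval X (component k P)" for k
    by (auto simp: component_def t)
  ultimately show ?case using w by (simp add: t sum.distrib)
qed

lemma closed_star_subalgebra_generated: "closed_star_subalgebra (cstar_generated Z)"
  unfolding cstar_generated_def closed_star_subalgebra_def by (auto intro!: closed_Inter)

lemma peval_generated:
  assumes "nonempty_words P" shows "peval Z P \<in> cstar_generated Z"
proof -
  note B = closed_star_subalgebra_generated[of Z, unfolded closed_star_subalgebra_def]
  have Z: "Z \<in> cstar_generated Z" by (auto simp: cstar_generated_def)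
  have l: "letter Z l \<in> cstar_generated Z" for l using B Z by (cases l) auto
  have w: "weval Z w \<in> cstar_generated Z" for w
    using l B by (induction w rule: weval.induct) auto
  have "peval Z P \<in> cstar_generated Z" using w B by (induction P) (auto simp: peval_def)
  then show ?thesis .
qed

section \<open>Comparison of the norms of P(Y) and P(X)\<close>

context
  fixes X :: "'a::cstar_algebra" and Y :: "'b::cstar_algebra"
  assumes X: "scaling X" and Y: "scaling Y"
    and spec: "scaling.S Y \<subseteq> scaling.S X" and deg: "scaling.degenerate X \<Longrightarrow> scaling.degenerate Y"
begin

interpretation X: scaling X by (rule X)
interpretation Y: scaling Y by (rule Y)

lemma norm_component_le:
  assumes P: "nonempty_words P"
  shows "norm (peval Y (component k P)) \<le> norm (peval X P)"
proof -
  let ?R = "pmul (component (- k) (pstar P)) (component k P)"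
  have ne: "nonempty_words (component k P)" "nonempty_words (component (- k) (pstar P))"
    "nonempty_words (pstar P)"
    using P by (simp_all add: nonempty_words_closed)
  have R: "peval Y ?R = star (peval Y (component k P)) * peval Y (component k P)"
    using ne by (simp add: peval_pmul component_pstar peval_pstar)
  have "norm (peval Y ?R) \<le> (norm (peval X P))\<^sup>2"
  proof (rule Y.degree_zero_bound)
    show "w \<noteq> [] \<and> wdeg w = 0" if "(c, w) \<in> set ?R" for c w
      using that P by (auto simp: set_pmul component_def nonempty_words_def)
    show "star (peval Y ?R) = peval Y ?R" by (simp add: R star_simps)
    fix n s assume s: "s \<in> Y.S" "Y.degenerate \<Longrightarrow> s \<notin> {0, 1}"
    \<comment> \<open>The values 0 and 1 have to be considered only if Y is not degenerate, and then
      X is not degenerate either.\<close>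
    then have "X.dominated s" using spec deg by (intro X.dominated_S) auto
    then have "cmod (pcoeff ?R (int n) s) \<le> norm (peval X P) * norm (peval X (pstar P))"
      using P ne(3) unfolding X.dominated_def by simp
    then show "cmod (pcoeff ?R (int n) s) \<le> (norm (peval X P))\<^sup>2"
      by (simp add: peval_pstar power2_eq_square)
  qed simp
  then have "(norm (peval Y (component k P)))\<^sup>2 \<le> (norm (peval X P))\<^sup>2"
    by (simp only: R cstar_identity)
  then show ?thesis by (rule power2_le_imp_le) simp
qed

lemma norm_peval_le_length:
  assumes P: "nonempty_words P" and L: "\<And>c w. (c, w) \<in> set P \<Longrightarrow> length w \<le> L"
  shows "norm (peval Y P) \<le> (2 * real L + 1) * norm (peval X P)"
proof -
  have "norm (peval Y P) \<le> (\<Sum>k\<in>{- int L..int L}. norm (peval Y (component k P)))"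
    by (subst peval_components[OF L]) (auto intro: norm_sum)
  also have "\<dots> \<le> (\<Sum>k\<in>{- int L..int L}. norm (peval X P))"
    by (intro sum_mono norm_component_le P)
  also have "\<dots> = (2 * real L + 1) * norm (peval X P)" by simp
  finally show ?thesis .
qed

text \<open>The linear loss in the length of the words disappears by passing to the powers of
  \<open>P\<^sup>* P\<close>.\<close>

theorem norm_peval_le:
  assumes P: "nonempty_words P"
  shows "norm (peval Y P) \<le> norm (peval X P)"
proof -
  define L where "L = Max (insert 0 ((\<lambda>(c, w). length w) ` set P))"
  have L: "length w \<le> L" if "(c, w) \<in> set P" for c w
    unfolding L_def by (rule Max_ge) (use that in force)+
  \<comment> \<open>Q is the power of \<open>pmul (pstar P) P\<close> with exponent 2^m. It is
    self-adjoint on both sides, so each squaring squares both norms exactly, while the bound on the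
    word length only doubles.\<close>
  have pw: "\<exists>Q. nonempty_words Q \<and> (\<forall>(c, w)\<in>set Q. length w \<le> 2 ^ Suc m * L)
    \<and> norm (peval X Q) = norm (peval X P) ^ 2 ^ Suc m \<and> norm (peval Y Q) = norm (peval Y P) ^ 2 ^ Suc m
    \<and> star (peval X Q) = peval X Q \<and> star (peval Y Q) = peval Y Q" for m
  proof (induction m)
    case 0
    have "peval X (pmul (pstar P) P) = star (peval X P) * peval X P"
      "peval Y (pmul (pstar P) P) = star (peval Y P) * peval Y P"
      using P by (simp_all add: peval_pmul peval_pstar nonempty_words_closed)
    moreover have "length w \<le> 2 * L" if mem: "(c, w) \<in> set (pmul (pstar P) P)" for c w
    proof -
      obtain v u c' d' where vu: "w = map Not (rev v) @ u" "(c', v) \<in> set P" "(d', u) \<in> set P"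
        using mem by (auto simp: set_pmul pstar_def)
      then show ?thesis using L[OF vu(2)] L[OF vu(3)] by simp
    qed
    ultimately show ?case using P
      by (intro exI[of _ "pmul (pstar P) P"]) (auto simp: nonempty_words_closed cstar_identity star_simps)
  next
    case (Suc m)
    then obtain Q where Q: "nonempty_words Q" "\<And>c w. (c, w) \<in> set Q \<Longrightarrow> length w \<le> 2 ^ Suc m * L"
      "norm (peval X Q) = norm (peval X P) ^ 2 ^ Suc m" "norm (peval Y Q) = norm (peval Y P) ^ 2 ^ Suc m"
      "star (peval X Q) = peval X Q" "star (peval Y Q) = peval Y Q" by blast
    have e: "peval X (pmul Q Q) = peval X Q * peval X Q" "peval Y (pmul Q Q) = peval Y Q * peval Y Q"
      using Q(1) by (simp_all add: peval_pmul)
    have sq: "norm (peval X Q * peval X Q) = (norm (peval X Q))\<^sup>2" "norm (peval Y Q * peval Y Q) = (norm (peval Y Q))\<^sup>2"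
      using cstar_identity[of "peval X Q"] cstar_identity[of "peval Y Q"] Q(5,6) by simp_all
    have "length w \<le> 2 ^ Suc (Suc m) * L" if mem: "(c, w) \<in> set (pmul Q Q)" for c w
    proof -
      obtain v u c d where "w = v @ u" "(c, v) \<in> set Q" "(d, u) \<in> set Q"
        using mem by (auto simp: set_pmul)
      then show ?thesis using Q(2)[of c v] Q(2)[of d u] by simp
    qed
    moreover have "norm (peval X (pmul Q Q)) = norm (peval X P) ^ 2 ^ Suc (Suc m)"
      "norm (peval Y (pmul Q Q)) = norm (peval Y P) ^ 2 ^ Suc (Suc m)"
      unfolding e sq Q(3,4) by (simp_all add: power_mult[symmetric] mult.commute)
    ultimately show ?case using Q(1,5,6)
      by (intro exI[of _ "pmul Q Q"]) (auto simp: nonempty_words_closed e star_mult)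
  qed
  have ineq: "norm (peval Y P) ^ 2 ^ Suc m \<le> (2 * real (2 ^ Suc m * L) + 1) * norm (peval X P) ^ 2 ^ Suc m" for m
  proof -
    obtain Q where "nonempty_words Q" "\<forall>(c, w)\<in>set Q. length w \<le> 2 ^ Suc m * L"
      "norm (peval X Q) = norm (peval X P) ^ 2 ^ Suc m" "norm (peval Y Q) = norm (peval Y P) ^ 2 ^ Suc m"
      using pw[of m] by blast
    then show ?thesis using norm_peval_le_length[of Q "2 ^ Suc m * L"] by auto
  qed
  show ?thesis
  proof (rule ccontr)
    define x where "x = norm (peval X P)"
    define y where "y = norm (peval Y P)"
    assume "\<not> ?thesis"
    then have xy: "0 \<le> x" "x < y" by (simp_all add: x_def y_def)
    define t where "t = x / y"
    have t: "0 \<le> t" "t < 1" using xy by (simp_all add: t_def)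
    have "1 \<le> (2 * real (2 ^ Suc m * L) + 1) * t ^ 2 ^ Suc m" for m
      using ineq[of m] xy by (simp add: t_def x_def[symmetric] y_def[symmetric] power_divide field_simps)
    moreover have "(\<lambda>m. (2 * real (2 ^ Suc m * L) + 1) * t ^ 2 ^ Suc m) \<longlonglongrightarrow> 0"
    proof -
      have "(\<lambda>n. 2 * real L * (real n * t ^ n) + t ^ n) \<longlonglongrightarrow> 2 * real L * 0 + 0"
        using t by (intro tendsto_intros powser_times_n_limit_0 LIMSEQ_realpow_zero) auto
      moreover have "strict_mono (\<lambda>m. 2 ^ Suc m :: nat)" by (rule strict_monoI) simp
      ultimately have "((\<lambda>n. 2 * real L * (real n * t ^ n) + t ^ n) \<circ> (\<lambda>m. 2 ^ Suc m)) \<longlonglongrightarrow> 2 * real L * 0 + 0"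
        by (rule LIMSEQ_subseq_LIMSEQ)
      then show ?thesis by (simp add: o_def algebra_simps)
    qed
    ultimately have "(1::real) \<le> 0" by (intro LIMSEQ_le_const) auto
    then show False by simp
  qed
qed

section \<open>Construction of the homomorphism\<close>

text \<open>The closure of the graph of the correspondence between P(X) and P(Y); by
  \<open>norm_peval_le\<close> it is the graph of a contraction.\<close>

definition related :: "'a \<Rightarrow> 'b \<Rightarrow> bool"
  where "related x y \<longleftrightarrow> (\<exists>P. (\<forall>i. nonempty_words (P i)) \<and>
    (\<lambda>i::nat. peval X (P i)) \<longlonglongrightarrow> x \<and> (\<lambda>i. peval Y (P i)) \<longlonglongrightarrow> y)"

lemma related_norm: "related x y \<Longrightarrow> norm y \<le> norm x"
proof -
  assume "related x y"
  then obtain P where P: "\<And>i. nonempty_words (P i)" "(\<lambda>i. peval X (P i)) \<longlonglongrightarrow> x"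
    "(\<lambda>i. peval Y (P i)) \<longlonglongrightarrow> y" unfolding related_def by blast
  show ?thesis
    using LIMSEQ_le[OF tendsto_norm[OF P(3)] tendsto_norm[OF P(2)]] norm_peval_le[OF P(1)] by blast
qed

lemma related_peval: "nonempty_words P \<Longrightarrow> related (peval X P) (peval Y P)"
  unfolding related_def by (intro exI[of _ "\<lambda>_. P"]) simp

lemma related_closed:
  assumes "related x y"
  shows "related x' y' \<Longrightarrow> related (x + x') (y + y')" "related x' y' \<Longrightarrow> related (x * x') (y * y')"
    "related (c *\<^sub>C x) (c *\<^sub>C y)" "related (star x) (star y)"
proof -
  obtain P where P: "\<And>i. nonempty_words (P i)" "(\<lambda>i. peval X (P i)) \<longlonglongrightarrow> x"
    "(\<lambda>i. peval Y (P i)) \<longlonglongrightarrow> y" using assms unfolding related_def by blast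
  show "related (c *\<^sub>C x) (c *\<^sub>C y)" unfolding related_def
    by (intro exI[of _ "\<lambda>i. pscale c (P i)"] conjI allI)
      (simp_all add: peval_pscale nonempty_words_closed P tendsto_scaleC)
  show "related (star x) (star y)" unfolding related_def
    by (intro exI[of _ "\<lambda>i. pstar (P i)"] conjI allI)
      (simp_all add: peval_pstar nonempty_words_closed P tendsto_star)
  assume "related x' y'"
  then obtain Q where Q: "\<And>i. nonempty_words (Q i)" "(\<lambda>i. peval X (Q i)) \<longlonglongrightarrow> x'"
    "(\<lambda>i. peval Y (Q i)) \<longlonglongrightarrow> y'" unfolding related_def by blast
  show "related (x + x') (y + y')" unfolding related_def
    by (intro exI[of _ "\<lambda>i. P i @ Q i"] conjI allI) (simp_all add: P Q tendsto_add)
  show "related (x * x') (y * y')" unfolding related_def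
    by (intro exI[of _ "\<lambda>i. pmul (P i) (Q i)"] conjI allI)
      (simp_all add: peval_pmul nonempty_words_closed P Q tendsto_mult)
qed

lemma related_unique:
  assumes "related x y" "related x y'" shows "y = y'"
proof -
  have "related (x + (- 1) *\<^sub>C x) (y + (- 1) *\<^sub>C y')" by (intro related_closed assms)
  then have "norm (y - y') \<le> norm (x - x)" using related_norm by (force simp: scaleC_minus_left)
  then show ?thesis by simp
qed

text \<open>A diagonal choice of polynomials, within 1/(i+1) of \<open>f i\<close>, reduces the
  claim to a sequence of values P(X); the norm estimate makes the values P(Y) a Cauchy
  sequence.\<close>

lemma related_complete:
  assumes x: "\<And>i. related (f i) (g i)" and lim: "f \<longlonglongrightarrow> x"
  shows "\<exists>y. related x y"
proof -
  have "\<exists>P. nonempty_words P \<and> norm (peval X P - f i) < 1 / real (Suc i)" for i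
  proof -
    obtain P where P: "\<And>j. nonempty_words (P j)" "(\<lambda>j. peval X (P j)) \<longlonglongrightarrow> f i"
      using x[of i] unfolding related_def by blast
    then have "\<forall>\<^sub>F j in sequentially. dist (peval X (P j)) (f i) < 1 / real (Suc i)"
      by (intro tendstoD) auto
    then obtain j where "dist (peval X (P j)) (f i) < 1 / real (Suc i)"
      using eventually_happens' sequentially_bot by blast
    then show ?thesis using P(1) by (auto simp: dist_norm)
  qed
  then obtain P where P: "\<And>i. nonempty_words (P i)" "\<And>i. norm (peval X (P i) - f i) < 1 / real (Suc i)"
    by metis
  have "(\<lambda>i. peval X (P i) - f i) \<longlonglongrightarrow> 0"
    by (rule Lim_null_comparison[OF always_eventually LIMSEQ_Suc[OF lim_1_over_n]])
      (use P(2) in \<open>auto intro: less_imp_le\<close>)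
  from tendsto_add[OF this lim] have PX: "(\<lambda>i. peval X (P i)) \<longlonglongrightarrow> x" by simp
  have le: "norm (peval Y (P i) - peval Y (P j)) \<le> norm (peval X (P i) - peval X (P j))" for i j
    using norm_peval_le[of "P i @ pscale (- 1) (P j)"] P(1)
    by (simp add: nonempty_words_closed peval_pscale scaleC_minus_left)
  have "Cauchy (\<lambda>i. peval Y (P i))"
  proof (rule CauchyI)
    fix e :: real assume "e > 0"
    then obtain M where "\<forall>m\<ge>M. \<forall>n\<ge>M. norm (peval X (P m) - peval X (P n)) < e"
      using CauchyD[OF LIMSEQ_imp_Cauchy[OF PX]] by blast
    then show "\<exists>M. \<forall>m\<ge>M. \<forall>n\<ge>M. norm (peval Y (P m) - peval Y (P n)) < e"
      using le order_le_less_trans by blast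
  qed
  then obtain y where "(\<lambda>i. peval Y (P i)) \<longlonglongrightarrow> y"
    using Cauchy_convergent convergent_def by blast
  then show ?thesis using P(1) PX unfolding related_def by blast
qed

lemma related_generated:
  assumes "x \<in> cstar_generated X"
  shows "\<exists>y. related x y"
proof -
  have "closed_star_subalgebra {x. \<exists>y. related x y}"
    unfolding closed_star_subalgebra_def
  proof (intro conjI ballI allI)
    show "closed {x. \<exists>y. related x y}"
      unfolding closed_sequential_limits
    proof (intro allI impI, elim conjE)
      fix f x assume "\<forall>n. f n \<in> {x. \<exists>y. related x y}" "f \<longlonglongrightarrow> x"
      moreover then obtain g where "\<And>n. related (f n) (g n)" by (simp, metis)
      ultimately show "x \<in> {x. \<exists>y. related x y}" using related_complete by blast
    qed
    show "0 \<in> {x. \<exists>y. related x y}" using related_peval[of "[]"] by auto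
  qed (use related_closed in blast)+
  moreover have "related X Y" using related_peval[of "[(1, [True])]"] by simp
  ultimately show ?thesis using assms unfolding cstar_generated_def by blast
qed

theorem homomorphism_exists:
  "\<exists>\<phi>. star_homomorphism_on (cstar_generated X) (cstar_generated Y) \<phi> \<and> \<phi> X = Y"
proof -
  define \<phi> where "\<phi> x = (THE y. related x y)" for x
  have eq: "\<phi> x = y" if "related x y" for x y
    unfolding \<phi>_def using that related_unique by blast
  have rel: "related x (\<phi> x)" if "x \<in> cstar_generated X" for x
    using related_generated[OF that] eq by metis
  have "\<phi> x \<in> cstar_generated Y" if x: "x \<in> cstar_generated X" for x
  proof -
    obtain P where P: "\<And>i. nonempty_words (P i)" "(\<lambda>i. peval Y (P i)) \<longlonglongrightarrow> \<phi> x"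
      using rel[OF x] unfolding related_def by blast
    have "closed (cstar_generated Y)"
      using closed_star_subalgebra_generated[of Y] by (simp add: closed_star_subalgebra_def)
    then show ?thesis by (rule closed_sequentially[OF _ peval_generated[OF P(1)] P(2)])
  qed
  moreover have "\<phi> (x + y) = \<phi> x + \<phi> y" "\<phi> (x * y) = \<phi> x * \<phi> y"
    if "x \<in> cstar_generated X" "y \<in> cstar_generated X" for x y
    by (intro eq related_closed rel that)+
  moreover have "\<phi> (star x) = star (\<phi> x)" "\<phi> (c *\<^sub>C x) = c *\<^sub>C \<phi> x" if "x \<in> cstar_generated X" for x c
    by (intro eq related_closed rel that)+
  moreover have "\<phi> X = Y" by (rule eq) (use related_peval[of "[(1, [True])]"] in simp)
  ultimately show ?thesis unfolding star_homomorphism_on_def by blast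
qed

end

section \<open>Absolute values and properness\<close>

text \<open>\<open>sqrt\<close> is an odd function on the reals, so this map is injective on real
  arguments of either sign, with inverse x |x|.\<close>

definition real_sqrt_fun :: "complex \<Rightarrow> complex"
  where "real_sqrt_fun z = complex_of_real (sqrt (Re z))"

lemma c0_on_real_sqrt: "c0_on K real_sqrt_fun"
  unfolding real_sqrt_fun_def c0_on_def by (auto intro!: continuous_intros)

lemma real_sqrt_fun_inj:
  assumes "Im z = 0" "Im w = 0" "real_sqrt_fun z = real_sqrt_fun w" shows "z = w"
  using assms by (simp add: real_sqrt_fun_def complex_eq_iff)

context scaling
begin

lemma cstar_abs_eq: "cstar_abs X = cal h real_sqrt_fun" "cstar_abs (star X) = cal b real_sqrt_fun"
  unfolding cstar_abs_def real_sqrt_fun_def[symmetric, abs_def] star_star h_def[symmetric] b_def[symmetric]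
  by (simp_all add: cfc_eq_cal c0_on_real_sqrt)

lemma star_cal_sqrt:
  "star (cal h real_sqrt_fun) = cal h real_sqrt_fun" "star (cal b real_sqrt_fun) = cal b real_sqrt_fun"
proof -
  have "(\<lambda>z. cnj (real_sqrt_fun z)) = real_sqrt_fun" by (simp add: real_sqrt_fun_def fun_eq_iff)
  then show "star (cal h real_sqrt_fun) = cal h real_sqrt_fun" "star (cal b real_sqrt_fun) = cal b real_sqrt_fun"
    using cal_star[of h real_sqrt_fun] cal_star[of b real_sqrt_fun] c0_on_real_sqrt by simp_all
qed

text \<open>Otherwise the absolute value r of \<open>star X\<close> is invertible, and
  \<open>h * r = r\<close> forces \<open>h\<close> to be the unit e. Then \<open>b\<close> is
  idempotent, so r annihilates \<open>b - e\<close> and \<open>b = e = h\<close>, a contradiction.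
  As a consequence \<open>spectrum\<close> and \<open>Sp\<close> agree on r.\<close>

lemma zero_in_spectrum_abs: "0 \<in> spectrum (cstar_abs (star X))"
proof (rule ccontr)
  let ?r = "cal b real_sqrt_fun"
  assume "0 \<notin> spectrum (cstar_abs (star X))"
  then have no: "0 \<notin> spectrum ?r" by (simp add: cstar_abs_eq)
  have "\<exists>e::'a. is_identity e"
  proof (rule ccontr)
    assume "\<not> ?thesis"
    then have "Sp ?r = spectrum ?r" by (rule Sp_nonunital)
    then show False using no zero_in_Sp[of ?r] by simp
  qed
  then obtain e :: 'a where e: "is_identity e" by blast
  then have e': "e * x = x" "x * e = x" for x by (simp_all add: is_identity_def)
  obtain y where y: "?r * y = e" "y * ?r = e" using not_in_spectrum_unital[OF e, of 0 ?r] no by auto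
  have "h * (?r * y) = ?r * y"
    by (simp only: mult.assoc[symmetric] h_cal_b(1)[OF c0_on_real_sqrt])
  then have "h * e = e" by (simp only: y)
  then have he: "h = e" by (simp add: e')
  have "b * b = X * h * star X" by (simp add: b_def h_def mult.assoc)
  then have "b * (b - e) = 0 *\<^sub>C (b - e)" by (simp add: he e' right_diff_distrib b_def)
  then have "?r * (b - e) = real_sqrt_fun 0 *\<^sub>C (b - e)"
    by (intro cal_eigen) (simp_all add: c0_on_real_sqrt)
  then have "?r * (b - e) = 0" by (simp add: real_sqrt_fun_def)
  then have "y * (?r * (b - e)) = 0" by simp
  then have "b - e = 0" by (simp add: mult.assoc[symmetric] y e')
  then show False using he h_neq_b by simp
qed

lemma spectrum_abs: "spectrum (cstar_abs (star X)) = real_sqrt_fun ` S"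
proof -
  have "spectrum (cstar_abs (star X)) = Sp (cstar_abs (star X))"
    using zero_in_spectrum_abs by (simp only: Sp_eq insert_absorb)
  also have "\<dots> = real_sqrt_fun ` Sp b"
    unfolding cstar_abs_eq by (rule Sp_cal) (simp_all add: c0_on_real_sqrt)
  finally show ?thesis by simp
qed

lemma compact_spectrum_abs_iff: "compact (real_sqrt_fun ` S - {0, 1}) \<longleftrightarrow> compact (S - {0, 1})"
proof -
  define g where "g z = complex_of_real (Re z * \<bar>Re z\<bar>)" for z
  have g: "g (real_sqrt_fun z) = z" if "z \<in> S" for z
  proof -
    have "sqrt (Re z) * \<bar>sqrt (Re z)\<bar> = Re z"
      by (cases "Re z \<ge> 0") (simp_all add: abs_if)
    then show ?thesis using real_S[OF that] by (simp add: g_def real_sqrt_fun_def complex_eq_iff)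
  qed
  have "inj_on real_sqrt_fun S" by (rule inj_on_inverseI[of _ g]) (rule g)
  moreover have "real_sqrt_fun ` {0, 1} = {0, 1}" by (simp add: real_sqrt_fun_def)
  ultimately have e: "real_sqrt_fun ` S - {0, 1} = real_sqrt_fun ` (S - {0, 1})"
    using inj_on_image_set_diff[of real_sqrt_fun S S "{0, 1}"] by simp
  have "g ` (real_sqrt_fun ` (S - {0, 1})) = S - {0, 1}"
    unfolding image_image using image_cong[OF refl g, of "S - {0, 1}"] by simp
  moreover have "continuous_on K g" for K unfolding g_def by (intro continuous_intros)
  moreover have "continuous_on K real_sqrt_fun" for K using c0_on_real_sqrt by (simp add: c0_on_def)
  ultimately show ?thesis unfolding e by (metis compact_continuous_image)
qed

text \<open>The square root fixes 0 and 1 and is a homeomorphism on \<open>S\<close>, so it carries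
  the compactness condition and both indicator functions over.\<close>

lemma non_proper_iff: "non_proper X \<longleftrightarrow> degenerate"
proof (cases "compact (S - {0, 1})")
  case False
  then show ?thesis
    by (simp add: non_proper_def degenerate_def spectrum_abs compact_spectrum_abs_iff)
next
  case M: True
  let ?K = "real_sqrt_fun ` S"
  have K: "compact (?K - {0, 1})" "0 \<in> ?K" "1 \<in> ?K"
    using M compact_spectrum_abs_iff zero_in_S one_in_S
    by (auto simp: image_iff real_sqrt_fun_def intro: bexI[of _ 0] bexI[of _ 1])
  have ind: "c0_on ?K (indicator {1})" "c0_on ?K (indicator (?K - {0}))"
    using c0_on_indicators[OF K] by auto
  have Sp: "Sp (cal h real_sqrt_fun) = ?K" "Sp (cal b real_sqrt_fun) = ?K"
    using Sp_cal[of h real_sqrt_fun] Sp_cal[of b real_sqrt_fun] c0_on_real_sqrt by simp_all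
  have inj: "real_sqrt_fun z = w \<longleftrightarrow> z = w" if "z \<in> S" "w \<in> {0, 1}" for z w
    using real_S[OF that(1)] that(2) real_sqrt_fun_inj[of z w] by (auto simp: real_sqrt_fun_def)
  have "cfc (indicator {1}) (cstar_abs X) = cal h (\<lambda>z. indicator {1} (real_sqrt_fun z))"
    unfolding cstar_abs_eq
    by (subst cfc_eq_cal) (simp_all add: star_cal_sqrt Sp ind cal_comp c0_on_real_sqrt)
  also have "\<dots> = cal h (indicator {1})"
    by (rule cal_cong) (use inj in \<open>auto simp: indicator_def\<close>)
  finally have 1: "cfc (indicator {1}) (cstar_abs X) = cal h (indicator {1})" .
  have "cfc (indicator (?K - {0})) (cstar_abs (star X)) = cal b (\<lambda>z. indicator (?K - {0}) (real_sqrt_fun z))"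
    unfolding cstar_abs_eq
    by (subst cfc_eq_cal) (simp_all add: star_cal_sqrt Sp ind cal_comp c0_on_real_sqrt)
  also have "\<dots> = cal b (indicator (S - {0}))"
    by (rule cal_cong) (use inj in \<open>auto simp: indicator_def\<close>)
  finally have 2: "cfc (indicator (?K - {0})) (cstar_abs (star X)) = cal b (indicator (S - {0}))" .
  show ?thesis
    using scaling K(1) M by (simp add: non_proper_def degenerate_def spectrum_abs 1 2)
qed

end

section \<open>Necessity\<close>

lemma zev_in_subalgebra:
  assumes B: "closed_star_subalgebra B" and a: "a \<in> B"
  shows "zev q a \<in> B"
  using B a by (induction q) (auto simp: zev_pCons closed_star_subalgebra_def)

lemma star_hom_zev:
  assumes B: "closed_star_subalgebra B" and f: "star_homomorphism_on B C f" and a: "a \<in> B"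
  shows "f (zev q a) = zev q (f a)"
proof (induction q)
  case 0
  have "f (0 *\<^sub>C a) = 0 *\<^sub>C f a" using f a unfolding star_homomorphism_on_def by blast
  then show ?case by simp
next
  case (pCons c q)
  have m: "zev q a \<in> B" "c *\<^sub>C a \<in> B" "a * zev q a \<in> B"
    using zev_in_subalgebra[OF B a] B a unfolding closed_star_subalgebra_def by auto
  have "f (c *\<^sub>C a + a * zev q a) = f (c *\<^sub>C a) + f (a * zev q a)"
    using f m(2,3) unfolding star_homomorphism_on_def by blast
  moreover have "f (a * zev q a) = f a * f (zev q a)"
    using f a m(1) unfolding star_homomorphism_on_def by blast
  moreover have "f (c *\<^sub>C a) = c *\<^sub>C f a" using f a unfolding star_homomorphism_on_def by blast
  ultimately show ?case by (simp add: zev_pCons pCons)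
qed

text \<open>An inverse of \<open>a - s\<close> may lie outside the domain \<open>B\<close> of f, so
  it cannot be transported. Instead, polynomials that tend to 0 on \<open>Sp a\<close> and to 1 at a
  point s of \<open>Sp (f a)\<close> outside \<open>Sp a\<close> would violate
  contractivity.\<close>

lemma star_hom_Sp_subset:
  assumes B: "closed_star_subalgebra B" and f: "star_homomorphism_on B C f" and a: "a \<in> B" "star a = a"
  shows "Sp (f a) \<subseteq> Sp a"
proof
  fix s assume s: "s \<in> Sp (f a)"
  have "star (f a) = f a" using f a unfolding star_homomorphism_on_def by metis
  then have "Im s = 0" using s by (rule Sp_selfadjoint_real)
  show "s \<in> Sp a"
  proof (rule ccontr)
    assume no: "s \<notin> Sp a"
    then have "s \<noteq> 0" by auto
    define g where "g z = (if z = s then 1 else 0 :: complex)" for z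
    have "continuous_on (Sp a \<union> {s}) g"
      by (intro continuous_on_closed_Un closed_Sp)
        (use no in \<open>auto simp: g_def intro: continuous_on_eq[of _ "\<lambda>_. 0"]\<close>)
    then have "c0_on (Sp a \<union> {s}) g" using \<open>s \<noteq> 0\<close> by (simp add: c0_on_def g_def)
    moreover have "compact (Sp a \<union> {s})" using compact_Sp[of a] by (simp add: compact_Un)
    moreover have "Im z = 0" if "z \<in> Sp a \<union> {s}" for z
      using that Sp_selfadjoint_real[OF a(2), of z] \<open>Im s = 0\<close> by blast
    ultimately obtain q where q: "unif (Sp a \<union> {s}) q g"
      using weierstrass_c0[of "Sp a \<union> {s}" g] by auto
    have "(\<lambda>n. zev (q n) a) \<longlonglongrightarrow> cal a g"
      by (rule cal_tendsto[OF a(2)], rule uniform_limit_on_subset[OF q]) auto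
    moreover have "cal a g = cal a (\<lambda>_. 0)"
      by (rule cal_cong[OF a(2)]) (use no in \<open>auto simp: g_def\<close>)
    ultimately have lim: "(\<lambda>n. zev (q n) a) \<longlonglongrightarrow> 0" by (simp add: cal_zero a(2))
    have le: "cmod (s * poly (q n) s) \<le> norm (zev (q n) a)" for n
    proof -
      have "s * poly (q n) s \<in> Sp (zev (q n) (f a))" unfolding Sp_zev using s by blast
      then have "cmod (s * poly (q n) s) \<le> norm (zev (q n) (f a))" by (rule Sp_norm_le)
      also have "\<dots> \<le> norm (zev (q n) a)"
        unfolding star_hom_zev[OF B f a(1), symmetric]
        by (rule star_homomorphism_contractive[OF B f zev_in_subalgebra[OF B a(1)]])
      finally show ?thesis .
    qed
    have "(\<lambda>n. s * poly (q n) s) \<longlonglongrightarrow> 0"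
      by (rule Lim_null_comparison[OF always_eventually tendsto_norm_zero[OF lim]]) (rule allI, rule le)
    moreover have "(\<lambda>n. s * poly (q n) s) \<longlonglongrightarrow> g s" by (rule tendsto_uniform_limitI[OF q]) simp
    ultimately have "g s = 0" by (rule LIMSEQ_unique[symmetric])
    then show False by (simp add: g_def)
  qed
qed

lemma star_hom_cal:
  assumes B: "closed_star_subalgebra B" and f: "star_homomorphism_on B C f" and a: "a \<in> B" "star a = a"
    and g: "c0_on (Sp a) g"
  shows "f (cal a g) = cal (f a) g"
proof -
  obtain q where q: "unif (Sp a) q g" using weierstrass_Sp[OF a(2) g] by blast
  have fa: "star (f a) = f a" using f a unfolding star_homomorphism_on_def by metis
  note lim = cal_tendsto[OF a(2) q]
  have zB: "zev (q n) a \<in> B" for n by (rule zev_in_subalgebra[OF B a(1)])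
  have "closed B" using B by (simp add: closed_star_subalgebra_def)
  then have cB: "cal a g \<in> B" by (rule closed_sequentially[OF _ zB lim])
  have le: "norm (f (zev (q n) a) - f (cal a g)) \<le> norm (zev (q n) a - cal a g)" for n
  proof -
    have "f (zev (q n) a + (- 1) *\<^sub>C cal a g) = f (zev (q n) a) + (- 1) *\<^sub>C f (cal a g)"
      using f zB[of n] cB B unfolding star_homomorphism_on_def closed_star_subalgebra_def by metis
    moreover have "norm (f (zev (q n) a + (- 1) *\<^sub>C cal a g)) \<le> norm (zev (q n) a + (- 1) *\<^sub>C cal a g)"
      by (rule star_homomorphism_contractive[OF B f])
        (use zB[of n] cB B in \<open>simp add: closed_star_subalgebra_def\<close>)
    ultimately show ?thesis by (simp add: scaleC_minus_left)
  qed
  have "(\<lambda>n. norm (zev (q n) a - cal a g)) \<longlonglongrightarrow> 0"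
    using lim by (simp add: LIM_zero tendsto_norm_zero)
  then have "(\<lambda>n. f (zev (q n) a) - f (cal a g)) \<longlonglongrightarrow> 0"
    by (rule Lim_null_comparison[OF always_eventually, rotated]) (rule allI, rule le)
  then have "(\<lambda>n. zev (q n) (f a)) \<longlonglongrightarrow> f (cal a g)"
    by (simp add: LIM_zero_iff star_hom_zev[OF B f a(1)])
  moreover have "unif (Sp (f a)) q g"
    by (rule uniform_limit_on_subset[OF q star_hom_Sp_subset[OF B f a]])
  ultimately show ?thesis using cal_eqI[OF fa] by metis
qed

theorem propositionD:
  fixes X :: "'a::cstar_algebra" and Y :: "'b::cstar_algebra"
  assumes "scaling_element X" and "scaling_element Y"
  shows "(proper X \<longrightarrow>
           ((\<exists>\<phi>. star_homomorphism_on (cstar_generated X) (cstar_generated Y) \<phi> \<and> \<phi> X = Y) \<longleftrightarrow>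
            spectrum (cstar_abs (star X)) \<supseteq> spectrum (cstar_abs (star Y)))) \<and>
         (non_proper X \<longrightarrow>
           ((\<exists>\<phi>. star_homomorphism_on (cstar_generated X) (cstar_generated Y) \<phi> \<and> \<phi> X = Y) \<longleftrightarrow>
            spectrum (cstar_abs (star X)) \<supseteq> spectrum (cstar_abs (star Y)) \<and> non_proper Y))"
proof -
  have XY: "scaling X" "scaling Y" using assms by (simp_all add: scaling_def)
  interpret X: scaling X by (rule XY)
  interpret Y: scaling Y by (rule XY)
  have spec: "spectrum (cstar_abs (star Y)) \<subseteq> spectrum (cstar_abs (star X)) \<longleftrightarrow> Y.S \<subseteq> X.S"
    unfolding X.spectrum_abs Y.spectrum_abs
  proof (intro iffI subsetI)
    fix s assume sub: "real_sqrt_fun ` Y.S \<subseteq> real_sqrt_fun ` X.S" and s: "s \<in> Y.S"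
    then obtain t where t: "t \<in> X.S" "real_sqrt_fun s = real_sqrt_fun t" by blast
    have "s = t" by (rule real_sqrt_fun_inj[OF Y.real_S[OF s] X.real_S[OF t(1)] t(2)])
    then show "s \<in> X.S" using t(1) by simp
  qed blast
  have suff: "\<exists>\<phi>. star_homomorphism_on (cstar_generated X) (cstar_generated Y) \<phi> \<and> \<phi> X = Y"
    if "Y.S \<subseteq> X.S" "X.degenerate \<Longrightarrow> Y.degenerate"
    using homomorphism_exists[OF XY] that by blast
  have nec: "Y.S \<subseteq> X.S \<and> (X.degenerate \<longrightarrow> Y.degenerate)"
    if hom: "star_homomorphism_on (cstar_generated X) (cstar_generated Y) \<phi>" and "\<phi> X = Y" for \<phi>
  proof -
    note B = closed_star_subalgebra_generated[of X]
    note B' = B[unfolded closed_star_subalgebra_def] and hom' = hom[unfolded star_homomorphism_on_def]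
    have X: "X \<in> cstar_generated X" by (auto simp: cstar_generated_def)
    then have m: "star X \<in> cstar_generated X" "X.h \<in> cstar_generated X" "X.b \<in> cstar_generated X"
      using B' by (auto simp: X.h_def X.b_def)
    have sX: "\<phi> (star X) = star Y" using hom' X \<open>\<phi> X = Y\<close> by auto
    have h: "\<phi> X.h = Y.h" and b: "\<phi> X.b = Y.b"
      unfolding X.h_def X.b_def Y.h_def Y.b_def using hom' X m(1) \<open>\<phi> X = Y\<close> sX by metis+
    have S: "Y.S \<subseteq> X.S" using star_hom_Sp_subset[OF B hom m(3)] b by simp
    moreover have "Y.degenerate" if d: "X.degenerate"
    proof -
      have M: "compact (X.S - {0, 1})" using d by (simp add: X.degenerate_def)
      note ind = c0_on_indicators[OF M X.zero_in_S X.one_in_S]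
      have "Y.S - {0, 1} = Y.S \<inter> (X.S - {0, 1})" using S by auto
      then have "compact (Y.S - {0, 1})" using M Y.compact_S by (simp add: compact_Int)
      moreover have "cal Y.h (indicator {1}) = \<phi> (cal X.h (indicator {1}))"
        using star_hom_cal[OF B hom m(2), of "indicator {1}"] ind(1) by (simp add: h)
      moreover have "cal X.h (indicator {1}) = cal X.b (indicator (X.S - {0}))"
        using d by (simp add: X.degenerate_def)
      moreover have "\<phi> (cal X.b (indicator (X.S - {0}))) = cal Y.b (indicator (X.S - {0}))"
        using star_hom_cal[OF B hom m(3), of "indicator (X.S - {0})"] ind(2) by (simp add: b)
      moreover have "cal Y.b (indicator (X.S - {0})) = cal Y.b (indicator (Y.S - {0}))"
        by (rule cal_cong) (use S in \<open>auto simp: indicator_def\<close>)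
      ultimately show ?thesis by (simp add: Y.degenerate_def)
    qed
    ultimately show ?thesis by blast
  qed
  show ?thesis
    unfolding proper_def X.non_proper_iff Y.non_proper_iff spec
    using suff nec by blast
qed

end
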